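(* Let $\mathcal V$ be a nontrivial single-sorted finitary variety of all set-based algebras (including empty algebras when its signature permits them), equipped with the factorization system of surjective and injective homomorphisms. Then $\mathcal V$ is a universal target for existence of a noetherian form. That is: for every category $\mathcal C$ with a proper factorization system $(\mathcal E,\mathcal M)$, pullbacks of two $\mathcal M$-morphisms with common codomain, and pushouts of two $\mathcal E$-morphisms with common domain, $\mathcal C$ has a noetherian form inducing $(\mathcal E,\mathcal M)$ if and only if there is a transfer functor $\mathcal C\to\mathcal V$.
   Context: Nontrivial means that some algebra of $\mathcal V$ has at least two elements. Conventions: categories are locally small; "set" is relative to a fixed universe. A conservative functor is one that reflects isomorphisms. A proper factorization system $(\mathcal E,\mathcal M)$ is an orthogonal factorization system with every morphism in $\mathcal E$ an epimorphism and every morphism in $\mathcal M$ a monomorphism. Transfer functors. Let $\mathcal C,\mathcal D$ have specified proper factorization systems $(\mathcal E_{\mathcal C},\mathcal M_{\mathcal C})$, $(\mathcal E_{\mathcal D},\mathcal M_{\mathcal D})$, and suppose both have pullbacks of two right-class morphisms with common codomain and pushouts of two left-class morphisms with common domain. A transfer functor $T:\mathcal C\to\mathcal D$ is a conservative functor with $T(\mathcal E_{\mathcal C})\subseteq\mathcal E_{\mathcal D}$, $T(\mathcal M_{\mathcal C})\subseteq\mathcal M_{\mathcal D}$, preserving pullbacks of two $\mathcal M_{\mathcal C}$-morphisms and pushouts of two $\mathcal E_{\mathcal C}$-morphisms. Forms. An (orean) form $\mathsf F$ on a category $\mathcal C$ assigns to each object $X$ a set-sized bounded lattice $\mathsf F(X)$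 (the fibre over $X$; its elements are called clusters) and to each morphism $f:X\to Y$ monotone maps $f_!:\mathsf F(X)\to\mathsf F(Y)$ and $f^*:\mathsf F(Y)\to\mathsf F(X)$ with $f_!S\le T\iff S\le f^*T$, such that $(gf)_!=g_!f_!$, $(gf)^*=f^*g^*$, and identities act as identities. Put $\operatorname{Im}f=f_!\top_X$ and $\operatorname{Ker}f=f^*\bot_Y$. A cluster in $\mathsf F(X)$ is conormal if it is the image of some morphism of $\mathcal C$ with codomain $X$, and normal if it is the kernel of some morphism of $\mathcal C$ with domain $X$. An embedding of a conormal $S\in\mathsf F(X)$ is a morphism $\iota$ into $X$ with $\operatorname{Im}\iota=S$ such that every morphism $f$ into $X$ with $\operatorname{Im}f\le S$ factors as $f=\iota h$ for a unique $h$. A quotient of a normal $K\in\mathsf F(X)$ is a morphism $\pi$ out of $X$ with $\operatorname{Ker}\pi=K$ such that every morphism $g$ out of $X$ with $K\le\operatorname{Ker}g$ factors as $g=h\pi$ for a unique $h$. The form is noetherian if: (N1) $f^*f_!S=S\vee\operatorname{Ker}f$ and $f_!f^*T=T\wedge\operatorname{Im}f$ for all $f,S,T$; (N2) every morphism $f$ factors as $f=me$ with $e$ a quotient of $\operatorname{Ker}f$ and $m$ an embedding of $\operatorname{Im}f$; (N3) the join of two normal clusters (in the same fibre) is normal, and the meet of two conormal clusters is conormal. For a noetherian form, the class $\mathcal E$ of all quotients (of normal clusters) and the class $\mathcal M$ of all embeddings (of conormal clusters) form a proper factorization system, the one induced by the form. *)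

theory Defs
  imports "HOL-Library.Equipollence" "HOL-Algebra.Lattice"
begin

section \<open>The universe\<close>

text \<open>
  The fixed universe of sets is represented, up to bijections, by a type \<open>'u\<close>: a set (of elements of
  any type) is small if its cardinality is strictly below that of \<open>'u\<close>.  The predicate \<open>universe\<close>
  says that \<open>'u\<close> has uncountable inaccessible cardinality, that is, that the small sets behave as the
  members of a Grothendieck universe containing the set of natural numbers.  Every small set is then
  in bijection with a small subset of \<open>'u\<close>, so algebras and fibres may be carried by subsets of \<open>'u\<close>.
\<close>

definition small :: "'u itself \<Rightarrow> 'a set \<Rightarrow> bool" where
  "small (u :: 'u itself) A \<longleftrightarrow> A \<prec> (UNIV :: 'u set)"

definition universe :: "'u itself \<Rightarrow> bool" where
  "universe (u :: 'u itself) \<longleftrightarrow>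
     small u (UNIV :: nat set) \<and>
     (\<forall>A :: 'u set. small u A \<longrightarrow> small u (Pow A)) \<and>
     (\<forall>(A :: 'u set) (B :: 'u \<Rightarrow> 'u set).
        small u A \<and> (\<forall>a\<in>A. small u (B a)) \<longrightarrow> small u (\<Union>a\<in>A. B a))"


section \<open>Categories\<close>

record ('o, 'm) category =
  Obj :: "'o set"
  Arr :: "'m set"
  Dom :: "'m \<Rightarrow> 'o"
  Cod :: "'m \<Rightarrow> 'o"
  Idt :: "'o \<Rightarrow> 'm"
  Comp :: "'m \<Rightarrow> 'm \<Rightarrow> 'm"  (infixr \<open>\<odot>\<index>\<close> 75)

definition hom :: "('o, 'm) category \<Rightarrow> 'o \<Rightarrow> 'o \<Rightarrow> 'm set" where
  "hom C X Y = {f \<in> Arr C. Dom C f = X \<and> Cod C f = Y}"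

text \<open>\<open>g \<odot>\<^bsub>C\<^esub> f\<close> is the composite in which \<open>f\<close> comes first.\<close>

locale locally_small_category =
  fixes u :: "'u itself" and C :: "('o, 'm) category" (structure)
  assumes dom_obj: "f \<in> Arr C \<Longrightarrow> Dom C f \<in> Obj C"
    and cod_obj: "f \<in> Arr C \<Longrightarrow> Cod C f \<in> Obj C"
    and idt_hom: "X \<in> Obj C \<Longrightarrow> Idt C X \<in> hom C X X"
    and comp_hom: "f \<in> hom C X Y \<Longrightarrow> g \<in> hom C Y Z \<Longrightarrow> g \<odot> f \<in> hom C X Z"
    and comp_idt: "f \<in> hom C X Y \<Longrightarrow> f \<odot> Idt C X = f"
    and idt_comp: "f \<in> hom C X Y \<Longrightarrow> Idt C Y \<odot> f = f"
    and comp_assoc: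
      "f \<in> hom C W X \<Longrightarrow> g \<in> hom C X Y \<Longrightarrow> h \<in> hom C Y Z \<Longrightarrow> (h \<odot> g) \<odot> f = h \<odot> (g \<odot> f)"
    and small_hom: "X \<in> Obj C \<Longrightarrow> Y \<in> Obj C \<Longrightarrow> small u (hom C X Y)"

definition is_iso :: "('o, 'm) category \<Rightarrow> 'm \<Rightarrow> bool" where
  "is_iso C f \<longleftrightarrow> f \<in> Arr C \<and>
     (\<exists>g \<in> hom C (Cod C f) (Dom C f).
        g \<odot>\<^bsub>C\<^esub> f = Idt C (Dom C f) \<and> f \<odot>\<^bsub>C\<^esub> g = Idt C (Cod C f))"

definition is_epi :: "('o, 'm) category \<Rightarrow> 'm \<Rightarrow> bool" where
  "is_epi C e \<longleftrightarrow> e \<in> Arr C \<and>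
     (\<forall>Z. \<forall>g \<in> hom C (Cod C e) Z. \<forall>h \<in> hom C (Cod C e) Z.
        g \<odot>\<^bsub>C\<^esub> e = h \<odot>\<^bsub>C\<^esub> e \<longrightarrow> g = h)"

definition is_mono :: "('o, 'm) category \<Rightarrow> 'm \<Rightarrow> bool" where
  "is_mono C m \<longleftrightarrow> m \<in> Arr C \<and>
     (\<forall>Z. \<forall>g \<in> hom C Z (Dom C m). \<forall>h \<in> hom C Z (Dom C m).
        m \<odot>\<^bsub>C\<^esub> g = m \<odot>\<^bsub>C\<^esub> h \<longrightarrow> g = h)"

text \<open>\<open>is_pullback C f g p q\<close>: the square \<open>f p = g q\<close> is a pullback of the cospan \<open>(f, g)\<close>.\<close>

definition is_pullback :: "('o, 'm) category \<Rightarrow> 'm \<Rightarrow> 'm \<Rightarrow> 'm \<Rightarrow> 'm \<Rightarrow> bool" where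
  "is_pullback C f g p q \<longleftrightarrow>
     f \<in> Arr C \<and> g \<in> Arr C \<and> Cod C f = Cod C g \<and>
     p \<in> hom C (Dom C p) (Dom C f) \<and> q \<in> hom C (Dom C p) (Dom C g) \<and>
     f \<odot>\<^bsub>C\<^esub> p = g \<odot>\<^bsub>C\<^esub> q \<and>
     (\<forall>Z. \<forall>a \<in> hom C Z (Dom C f). \<forall>b \<in> hom C Z (Dom C g).
        f \<odot>\<^bsub>C\<^esub> a = g \<odot>\<^bsub>C\<^esub> b \<longrightarrow>
        (\<exists>!h. h \<in> hom C Z (Dom C p) \<and> p \<odot>\<^bsub>C\<^esub> h = a \<and> q \<odot>\<^bsub>C\<^esub> h = b))"

text \<open>\<open>is_pushout C f g p q\<close>: the square \<open>p f = q g\<close> is a pushout of the span \<open>(f, g)\<close>.\<close>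

definition is_pushout :: "('o, 'm) category \<Rightarrow> 'm \<Rightarrow> 'm \<Rightarrow> 'm \<Rightarrow> 'm \<Rightarrow> bool" where
  "is_pushout C f g p q \<longleftrightarrow>
     f \<in> Arr C \<and> g \<in> Arr C \<and> Dom C f = Dom C g \<and>
     p \<in> hom C (Cod C f) (Cod C p) \<and> q \<in> hom C (Cod C g) (Cod C p) \<and>
     p \<odot>\<^bsub>C\<^esub> f = q \<odot>\<^bsub>C\<^esub> g \<and>
     (\<forall>Z. \<forall>a \<in> hom C (Cod C f) Z. \<forall>b \<in> hom C (Cod C g) Z.
        a \<odot>\<^bsub>C\<^esub> f = b \<odot>\<^bsub>C\<^esub> g \<longrightarrow>
        (\<exists>!h. h \<in> hom C (Cod C p) Z \<and> h \<odot>\<^bsub>C\<^esub> p = a \<and> h \<odot>\<^bsub>C\<^esub> q = b))"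

locale proper_factorization_system = locally_small_category u C
  for u :: "'u itself" and C :: "('o, 'm) category" (structure) +
  fixes E M :: "'m set"
  assumes E_arr: "E \<subseteq> Arr C" and M_arr: "M \<subseteq> Arr C"
    and iso_E: "is_iso C f \<Longrightarrow> f \<in> E" and iso_M: "is_iso C f \<Longrightarrow> f \<in> M"
    and comp_E: "e \<in> E \<Longrightarrow> e' \<in> E \<Longrightarrow> Cod C e = Dom C e' \<Longrightarrow> e' \<odot> e \<in> E"
    and comp_M: "m \<in> M \<Longrightarrow> m' \<in> M \<Longrightarrow> Cod C m = Dom C m' \<Longrightarrow> m' \<odot> m \<in> M"
    and factorization: "f \<in> Arr C \<Longrightarrow> \<exists>e\<in>E. \<exists>m\<in>M. Cod C e = Dom C m \<and> f = m \<odot> e"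
    and orthogonality:
      "e \<in> E \<Longrightarrow> m \<in> M \<Longrightarrow> a \<in> hom C (Dom C e) (Dom C m) \<Longrightarrow> b \<in> hom C (Cod C e) (Cod C m) \<Longrightarrow>
       m \<odot> a = b \<odot> e \<Longrightarrow> \<exists>!d. d \<in> hom C (Cod C e) (Dom C m) \<and> d \<odot> e = a \<and> m \<odot> d = b"
    and E_epi: "e \<in> E \<Longrightarrow> is_epi C e"
    and M_mono: "m \<in> M \<Longrightarrow> is_mono C m"

locale factorized_category = proper_factorization_system u C E M
  for u :: "'u itself" and C :: "('o, 'm) category" (structure) and E M :: "'m set" +
  assumes pullback_exists:
      "m \<in> M \<Longrightarrow> m' \<in> M \<Longrightarrow> Cod C m = Cod C m' \<Longrightarrow> \<exists>p q. is_pullback C m m' p q"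
    and pushout_exists:
      "e \<in> E \<Longrightarrow> e' \<in> E \<Longrightarrow> Dom C e = Dom C e' \<Longrightarrow> \<exists>p q. is_pushout C e e' p q"


section \<open>Transfer functors\<close>

locale transfer_functor =
  C: factorized_category u C EC MC + D: factorized_category u D ED MD
  for u :: "'u itself"
    and C :: "('o, 'm) category" and EC MC :: "'m set"
    and D :: "('p, 'n) category" and ED MD :: "'n set" +
  fixes To :: "'o \<Rightarrow> 'p" and Ta :: "'m \<Rightarrow> 'n"
  assumes map_obj: "X \<in> Obj C \<Longrightarrow> To X \<in> Obj D"
    and map_hom: "f \<in> hom C X Y \<Longrightarrow> Ta f \<in> hom D (To X) (To Y)"
    and map_idt: "X \<in> Obj C \<Longrightarrow> Ta (Idt C X) = Idt D (To X)"
    and map_comp: "f \<in> hom C X Y \<Longrightarrow> g \<in> hom C Y Z \<Longrightarrow> Ta (g \<odot>\<^bsub>C\<^esub> f) = Ta g \<odot>\<^bsub>D\<^esub> Ta f"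
    and conservative: "f \<in> Arr C \<Longrightarrow> is_iso D (Ta f) \<Longrightarrow> is_iso C f"
    and map_E: "Ta ` EC \<subseteq> ED"
    and map_M: "Ta ` MC \<subseteq> MD"
    and preserves_pullback:
      "m \<in> MC \<Longrightarrow> m' \<in> MC \<Longrightarrow> is_pullback C m m' p q \<Longrightarrow>
       is_pullback D (Ta m) (Ta m') (Ta p) (Ta q)"
    and preserves_pushout:
      "e \<in> EC \<Longrightarrow> e' \<in> EC \<Longrightarrow> is_pushout C e e' p q \<Longrightarrow>
       is_pushout D (Ta e) (Ta e') (Ta p) (Ta q)"


section \<open>Forms\<close>

text \<open>\<open>dir_img F f\<close> is \<open>f\<^sub>!\<close> and \<open>inv_img F f\<close> is \<open>f\<^sup>*\<close>; only their values on clusters matter.\<close>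

record ('o, 'm, 'u) form =
  fib :: "'o \<Rightarrow> 'u gorder"
  dir_img :: "'m \<Rightarrow> 'u \<Rightarrow> 'u"
  inv_img :: "'m \<Rightarrow> 'u \<Rightarrow> 'u"

locale orean_form = locally_small_category u C
  for u :: "'u itself" and C :: "('o, 'm) category" (structure) +
  fixes F :: "('o, 'm, 'u) form"
  assumes fib_lattice: "X \<in> Obj C \<Longrightarrow> bounded_lattice (fib F X)"
    and fib_small: "X \<in> Obj C \<Longrightarrow> small u (carrier (fib F X))"
    and dir_closed: "f \<in> hom C X Y \<Longrightarrow> dir_img F f \<in> carrier (fib F X) \<rightarrow> carrier (fib F Y)"
    and inv_closed: "f \<in> hom C X Y \<Longrightarrow> inv_img F f \<in> carrier (fib F Y) \<rightarrow> carrier (fib F X)"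
    and dir_mono: "f \<in> hom C X Y \<Longrightarrow> isotone (fib F X) (fib F Y) (dir_img F f)"
    and inv_mono: "f \<in> hom C X Y \<Longrightarrow> isotone (fib F Y) (fib F X) (inv_img F f)"
    and adjunction:
      "f \<in> hom C X Y \<Longrightarrow> S \<in> carrier (fib F X) \<Longrightarrow> T \<in> carrier (fib F Y) \<Longrightarrow>
       dir_img F f S \<sqsubseteq>\<^bsub>fib F Y\<^esub> T \<longleftrightarrow> S \<sqsubseteq>\<^bsub>fib F X\<^esub> inv_img F f T"
    and dir_comp:
      "f \<in> hom C X Y \<Longrightarrow> g \<in> hom C Y Z \<Longrightarrow> S \<in> carrier (fib F X) \<Longrightarrow>
       dir_img F (g \<odot> f) S = dir_img F g (dir_img F f S)"
    and inv_comp: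
      "f \<in> hom C X Y \<Longrightarrow> g \<in> hom C Y Z \<Longrightarrow> T \<in> carrier (fib F Z) \<Longrightarrow>
       inv_img F (g \<odot> f) T = inv_img F f (inv_img F g T)"
    and dir_idt: "X \<in> Obj C \<Longrightarrow> S \<in> carrier (fib F X) \<Longrightarrow> dir_img F (Idt C X) S = S"
    and inv_idt: "X \<in> Obj C \<Longrightarrow> S \<in> carrier (fib F X) \<Longrightarrow> inv_img F (Idt C X) S = S"

definition Im :: "('o, 'm) category \<Rightarrow> ('o, 'm, 'u) form \<Rightarrow> 'm \<Rightarrow> 'u" where
  "Im C F f = dir_img F f \<top>\<^bsub>fib F (Dom C f)\<^esub>"

definition Ker :: "('o, 'm) category \<Rightarrow> ('o, 'm, 'u) form \<Rightarrow> 'm \<Rightarrow> 'u" where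
  "Ker C F f = inv_img F f \<bottom>\<^bsub>fib F (Cod C f)\<^esub>"

definition conormal :: "('o, 'm) category \<Rightarrow> ('o, 'm, 'u) form \<Rightarrow> 'o \<Rightarrow> 'u \<Rightarrow> bool" where
  "conormal C F X S \<longleftrightarrow> (\<exists>f\<in>Arr C. Cod C f = X \<and> Im C F f = S)"

definition normal :: "('o, 'm) category \<Rightarrow> ('o, 'm, 'u) form \<Rightarrow> 'o \<Rightarrow> 'u \<Rightarrow> bool" where
  "normal C F X K \<longleftrightarrow> (\<exists>f\<in>Arr C. Dom C f = X \<and> Ker C F f = K)"

definition embedding_of ::
    "('o, 'm) category \<Rightarrow> ('o, 'm, 'u) form \<Rightarrow> 'o \<Rightarrow> 'u \<Rightarrow> 'm \<Rightarrow> bool" where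
  "embedding_of C F X S m \<longleftrightarrow>
     conormal C F X S \<and> m \<in> Arr C \<and> Cod C m = X \<and> Im C F m = S \<and>
     (\<forall>f\<in>Arr C. Cod C f = X \<and> Im C F f \<sqsubseteq>\<^bsub>fib F X\<^esub> S \<longrightarrow>
        (\<exists>!h. h \<in> hom C (Dom C f) (Dom C m) \<and> f = m \<odot>\<^bsub>C\<^esub> h))"

definition quotient_of ::
    "('o, 'm) category \<Rightarrow> ('o, 'm, 'u) form \<Rightarrow> 'o \<Rightarrow> 'u \<Rightarrow> 'm \<Rightarrow> bool" where
  "quotient_of C F X K e \<longleftrightarrow>
     normal C F X K \<and> e \<in> Arr C \<and> Dom C e = X \<and> Ker C F e = K \<and>
     (\<forall>g\<in>Arr C. Dom C g = X \<and> K \<sqsubseteq>\<^bsub>fib F X\<^esub> Ker C F g \<longrightarrow>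
        (\<exists>!h. h \<in> hom C (Cod C e) (Cod C g) \<and> g = h \<odot>\<^bsub>C\<^esub> e))"

definition embeddings :: "('o, 'm) category \<Rightarrow> ('o, 'm, 'u) form \<Rightarrow> 'm set" where
  "embeddings C F = {m. \<exists>X\<in>Obj C. \<exists>S. embedding_of C F X S m}"

definition quotients :: "('o, 'm) category \<Rightarrow> ('o, 'm, 'u) form \<Rightarrow> 'm set" where
  "quotients C F = {e. \<exists>X\<in>Obj C. \<exists>K. quotient_of C F X K e}"

locale noetherian_form = orean_form u C F
  for u :: "'u itself" and C :: "('o, 'm) category" (structure) and F :: "('o, 'm, 'u) form" +
  assumes N1_inv_dir:
      "f \<in> hom C X Y \<Longrightarrow> S \<in> carrier (fib F X) \<Longrightarrow>
       inv_img F f (dir_img F f S) = S \<squnion>\<^bsub>fib F X\<^esub> Ker C F f"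
    and N1_dir_inv:
      "f \<in> hom C X Y \<Longrightarrow> T \<in> carrier (fib F Y) \<Longrightarrow>
       dir_img F f (inv_img F f T) = T \<sqinter>\<^bsub>fib F Y\<^esub> Im C F f"
    and N2:
      "f \<in> hom C X Y \<Longrightarrow>
       \<exists>e m. quotient_of C F X (Ker C F f) e \<and> embedding_of C F Y (Im C F f) m \<and>
             Cod C e = Dom C m \<and> f = m \<odot> e"
    and N3_normal:
      "X \<in> Obj C \<Longrightarrow> normal C F X K \<Longrightarrow> normal C F X L \<Longrightarrow> normal C F X (K \<squnion>\<^bsub>fib F X\<^esub> L)"
    and N3_conormal:
      "X \<in> Obj C \<Longrightarrow> conormal C F X S \<Longrightarrow> conormal C F X T \<Longrightarrow>
       conormal C F X (S \<sqinter>\<^bsub>fib F X\<^esub> T)"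


section \<open>Varieties of algebras\<close>

record 'f signature =
  ops :: "'f set"
  arity :: "'f \<Rightarrow> nat"

datatype ('f, 'v) trm = Var 'v | App 'f "('f, 'v) trm list"

inductive wf_trm :: "'f signature \<Rightarrow> ('f, 'v) trm \<Rightarrow> bool" for Sg where
  "wf_trm Sg (Var x)"
| "s \<in> ops Sg \<Longrightarrow> length ts = arity Sg s \<Longrightarrow> (\<And>t. t \<in> set ts \<Longrightarrow> wf_trm Sg t) \<Longrightarrow> wf_trm Sg (App s ts)"

record ('f, 'u) algebra = "'u partial_object" +
  oper :: "'f \<Rightarrow> 'u list \<Rightarrow> 'u"

text \<open>
  Operations are normalised to \<open>undefined\<close> on arguments outside their domain, so that an algebra is
  determined by its carrier and by its operations on the carrier.  The carrier may be empty if there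
  is no operation of arity 0.
\<close>

definition is_algebra :: "'f signature \<Rightarrow> ('f, 'u) algebra \<Rightarrow> bool" where
  "is_algebra Sg A \<longleftrightarrow>
     (\<forall>s xs. if s \<in> ops Sg \<and> length xs = arity Sg s \<and> set xs \<subseteq> carrier A
             then oper A s xs \<in> carrier A
             else oper A s xs = undefined)"

primrec eval_trm :: "('f, 'u) algebra \<Rightarrow> ('v \<Rightarrow> 'u) \<Rightarrow> ('f, 'v) trm \<Rightarrow> 'u" where
  "eval_trm A \<rho> (Var x) = \<rho> x"
| "eval_trm A \<rho> (App s ts) = oper A s (map (eval_trm A \<rho>) ts)"

text \<open>
  Valuations assign a value to every variable, so every equation holds in the empty algebra.  This
  is the usual notion, since a signature that permits an empty algebra has no closed terms.
\<close>

definition satisfies :: "('f, 'u) algebra \<Rightarrow> ('f, nat) trm \<times> ('f, nat) trm \<Rightarrow> bool" where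
  "satisfies A eqn \<longleftrightarrow>
     (\<forall>\<rho> :: nat \<Rightarrow> 'u. range \<rho> \<subseteq> carrier A \<longrightarrow> eval_trm A \<rho> (fst eqn) = eval_trm A \<rho> (snd eqn))"

type_synonym 'f equations = "(('f, nat) trm \<times> ('f, nat) trm) set"

definition presentation :: "'u itself \<Rightarrow> 'f signature \<Rightarrow> 'f equations \<Rightarrow> bool" where
  "presentation u Sg Eqs \<longleftrightarrow>
     small u (ops Sg) \<and> (\<forall>(s, t) \<in> Eqs. wf_trm Sg s \<and> wf_trm Sg t)"

definition variety :: "'u itself \<Rightarrow> 'f signature \<Rightarrow> 'f equations \<Rightarrow> ('f, 'u) algebra set" where
  "variety u Sg Eqs =
     {A. is_algebra Sg A \<and> small u (carrier A) \<and> (\<forall>eqn\<in>Eqs. satisfies A eqn)}"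

definition nontrivial :: "('f, 'u) algebra set \<Rightarrow> bool" where
  "nontrivial V \<longleftrightarrow> (\<exists>A\<in>V. \<exists>x\<in>carrier A. \<exists>y\<in>carrier A. x \<noteq> y)"

definition alg_homs ::
    "'f signature \<Rightarrow> ('f, 'u) algebra \<Rightarrow> ('f, 'u) algebra \<Rightarrow> ('u \<Rightarrow> 'u) set" where
  "alg_homs Sg A B =
     {h \<in> carrier A \<rightarrow>\<^sub>E carrier B.
        \<forall>s\<in>ops Sg. \<forall>xs. length xs = arity Sg s \<and> set xs \<subseteq> carrier A \<longrightarrow>
          h (oper A s xs) = oper B s (map h xs)}"

text \<open>An arrow is a homomorphism together with its domain and codomain.\<close>

type_synonym ('f, 'u) alg_arrow = "('f, 'u) algebra \<times> ('f, 'u) algebra \<times> ('u \<Rightarrow> 'u)"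

definition variety_cat ::
    "'u itself \<Rightarrow> 'f signature \<Rightarrow> 'f equations \<Rightarrow> (('f, 'u) algebra, ('f, 'u) alg_arrow) category"
where
  "variety_cat u Sg Eqs =
     \<lparr> Obj = variety u Sg Eqs,
       Arr = {(A, B, h). A \<in> variety u Sg Eqs \<and> B \<in> variety u Sg Eqs \<and> h \<in> alg_homs Sg A B},
       Dom = (\<lambda>(A, B, h). A),
       Cod = (\<lambda>(A, B, h). B),
       Idt = (\<lambda>A. (A, A, \<lambda>x\<in>carrier A. x)),
       Comp = (\<lambda>(B', D, k) (A, B, h). (A, D, compose (carrier A) k h)) \<rparr>"

definition surjective_homs :: "'u itself \<Rightarrow> 'f signature \<Rightarrow> 'f equations \<Rightarrow> ('f, 'u) alg_arrow set"
where
  "surjective_homs u Sg Eqs =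
     {(A, B, h) \<in> Arr (variety_cat u Sg Eqs). h ` carrier A = carrier B}"

definition injective_homs :: "'u itself \<Rightarrow> 'f signature \<Rightarrow> 'f equations \<Rightarrow> ('f, 'u) alg_arrow set"
where
  "injective_homs u Sg Eqs =
     {(A, B, h) \<in> Arr (variety_cat u Sg Eqs). inj_on h (carrier A)}"

end

theory Submission
  imports Defs "HOL-Library.Poly_Mapping"
begin

text \<open>
  A noetherian form \<open>F\<close> on \<open>C\<close> gives, for a fixed algebra \<open>A\<close> with at least two elements, the
  functor \<open>X \<mapsto> A\<^bsup>F(X)\<^esup>\<close>, where a morphism \<open>f\<close> acts by precomposition with \<open>f\<^sup>*\<close>.
  Here \<open>f\<^sup>*\<close> is injective along quotients and surjective along embeddings; a pullback of
  embeddings becomes a pushout of sets of clusters, a pushout of quotients becomes an intersection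
  of sets of clusters, and powers of \<open>A\<close> turn these into pullbacks and pushouts of algebras.

  Conversely, given a transfer functor \<open>T\<close>, the fibre over \<open>X\<close> is the lattice of subgroups of the
  free abelian group on the underlying set of \<open>T X\<close>, with direct and inverse images of subgroups
  under the induced linear maps.  The kernel of such a linear map determines which points are
  identified.  As operations are finitary, the kernel of a pushout of surjective homomorphisms is
  the equivalence relation generated by the two kernels, so joins of normal clusters are normal.
\<close>

section \<open>Small sets\<close>

text \<open>A fibre must hold images, which come from subsets, and kernels, which come from
  equivalence relations, in one lattice where (N1) is valid. Subsets alone lose kernels and
  equivalence relations lose images; subgroups of an abelian group hold both, and (N1) is there the
  usual calculus of images and preimages under homomorphisms. Passing to free abelian groups loses
  nothing that matters: \<open>frag_of x - frag_of y\<close> lies in the kernel of the induced map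
  exactly when \<open>x\<close> and \<open>y\<close> are identified, and the chains supported on a
  subset determine the subset. The remaining obstacle is to return from the variety to
  \<open>C\<close>: an inclusion of kernels or images only gives a factorization in the variety.
  There it makes a leg of a suitable pushout or pullback of \<open>C\<close> invertible;
  conservativity makes that leg invertible in \<open>C\<close>, and its inverse supplies the missing
  arrow. In the other direction (N3) identifies the pullback of two embeddings with an embedding of
  the meet of their images, and dually, while (N1) computes the maps between fibres. Two distinct
  elements of \<open>A\<close> make the power functor conservative.\<close>

lemma small_lepoll:
  assumes "A \<lesssim> B" "small u B"
  shows "small u A"
  using assms unfolding small_def by (rule lesspoll_trans1)

text \<open>The closure conditions in \<open>universe\<close> speak only of sets of elements of
  \<open>'u\<close>; a small set of another type is first moved into \<open>'u\<close> by an
  injection, where they apply.\<close>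

lemma small_eqpoll_copy:
  assumes "small TYPE('u) A"
  obtains B :: "'u set" where "A \<approx> B" "small TYPE('u) B"
proof -
  have "A \<lesssim> (UNIV :: 'u set)"
    using assms unfolding small_def by (rule lesspoll_imp_lepoll)
  then obtain f :: "_ \<Rightarrow> 'u" where "inj_on f A"
    unfolding lepoll_def by blast
  then have "A \<approx> f ` A"
    using inj_on_image_eqpoll_self eqpoll_sym by blast
  moreover have "small TYPE('u) (f ` A)"
    by (rule small_lepoll[OF image_lepoll assms])
  ultimately show thesis by (rule that)
qed

lemma small_Pow:
  assumes "universe TYPE('u)" "small TYPE('u) A"
  shows "small TYPE('u) (Pow A)"
proof -
  obtain B :: "'u set" where B: "A \<approx> B" "small TYPE('u) B"
    by (rule small_eqpoll_copy[OF assms(2)])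
  obtain f where f: "bij_betw f A B"
    using B(1) unfolding eqpoll_def by blast
  have "Pow A \<approx> Pow B"
    unfolding eqpoll_def using bij_betw_Pow[OF f] by blast
  then have "Pow A \<lesssim> Pow B" by (rule eqpoll_imp_lepoll)
  moreover have "small TYPE('u) (Pow B)"
    using assms(1) B(2) unfolding universe_def by blast
  ultimately show ?thesis by (rule small_lepoll)
qed

text \<open>The condition on unions concerns sets of elements of \<open>'u\<close>, so pairs are
  coded back into \<open>'u\<close> by an injection of \<open>'u \<times> 'u\<close>, available
  because \<open>'u\<close> is infinite; the product becomes a small union of rows.\<close>

lemma small_Times:
  assumes U: "universe TYPE('u)" and "small TYPE('u) A" "small TYPE('u) B"
  shows "small TYPE('u) (A \<times> B)"
proof -
  obtain A' :: "'u set" where A': "A \<approx> A'" "small TYPE('u) A'"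
    by (rule small_eqpoll_copy[OF assms(2)])
  obtain B' :: "'u set" where B': "B \<approx> B'" "small TYPE('u) B'"
    by (rule small_eqpoll_copy[OF assms(3)])
  have "(UNIV :: nat set) \<prec> (UNIV :: 'u set)"
    using U unfolding universe_def small_def by blast
  then have "infinite (UNIV :: 'u set)"
    by (simp add: infinite_le_lepoll lesspoll_imp_lepoll)
  then obtain j :: "'u \<times> 'u \<Rightarrow> 'u" where j: "inj j"
    using card_of_Times_same_infinite[of "UNIV :: 'u set"]
    unfolding card_of_ordIso[symmetric] bij_betw_def by auto
  have "small TYPE('u) (\<Union>a\<in>A'. (\<lambda>b. j (a, b)) ` B')"
  proof -
    have "small TYPE('u) ((\<lambda>b. j (a, b)) ` B')" for a
      by (rule small_lepoll[OF image_lepoll B'(2)])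
    moreover have "\<forall>(A :: 'u set) (B :: 'u \<Rightarrow> 'u set).
        small TYPE('u) A \<and> (\<forall>a\<in>A. small TYPE('u) (B a)) \<longrightarrow> small TYPE('u) (\<Union>a\<in>A. B a)"
      using U unfolding universe_def by (elim conjE)
    ultimately show ?thesis using A'(2) by simp
  qed
  moreover have "A' \<times> B' \<lesssim> (\<Union>a\<in>A'. (\<lambda>b. j (a, b)) ` B')"
  proof -
    have "inj_on j (A' \<times> B')" using j by (rule inj_on_subset) simp
    moreover have "j ` (A' \<times> B') \<subseteq> (\<Union>a\<in>A'. (\<lambda>b. j (a, b)) ` B')" by blast
    ultimately show ?thesis unfolding lepoll_def by blast
  qed
  ultimately have "small TYPE('u) (A' \<times> B')"
    by (rule small_lepoll[rotated])
  then show ?thesis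
    by (rule small_lepoll[OF eqpoll_imp_lepoll[OF times_eqpoll_cong[OF A'(1) B'(1)]]])
qed

text \<open>A function is determined by its graph, so the function space embeds into the power set
  of a small product.\<close>

lemma small_PiE:
  assumes "universe TYPE('u)" "small TYPE('u) A" "small TYPE('u) B"
  shows "small TYPE('u) (A \<rightarrow>\<^sub>E B)"
proof -
  let ?G = "\<lambda>f. (\<lambda>x. (x, f x)) ` A"
  have "inj_on ?G (A \<rightarrow>\<^sub>E B)"
    by (rule inj_onI, rule PiE_ext) (auto simp: set_eq_iff image_iff)
  moreover have "?G ` (A \<rightarrow>\<^sub>E B) \<subseteq> Pow (A \<times> B)" by (auto simp: PiE_iff)
  ultimately have "(A \<rightarrow>\<^sub>E B) \<lesssim> Pow (A \<times> B)" unfolding lepoll_def by blast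
  then show ?thesis
    by (rule small_lepoll[OF _ small_Pow[OF assms(1) small_Times[OF assms]]])
qed

lemma small_int:
  assumes "universe TYPE('u)"
  shows "small TYPE('u) (UNIV :: int set)"
proof -
  have "(UNIV :: int set) \<lesssim> (UNIV :: nat set)"
    using inj_to_nat lepoll_def by blast
  moreover have "small TYPE('u) (UNIV :: nat set)"
    using assms unfolding universe_def by blast
  ultimately show ?thesis by (rule small_lepoll)
qed

text \<open>Elements of algebras and clusters must be of type \<open>'u\<close>. Function spaces and
  sets of subgroups are stored there along a chosen injection, which exists as soon as the set is
  small.\<close>

definition code :: "'a set \<Rightarrow> 'a \<Rightarrow> 'u" where
  "code A = (SOME f. inj_on f A)"

definition decode :: "'a set \<Rightarrow> 'u \<Rightarrow> 'a" where
  "decode A = inv_into A (code A)"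

lemma inj_on_code:
  assumes "small TYPE('u) A"
  shows "inj_on (code A :: 'a \<Rightarrow> 'u) A"
proof -
  have "A \<lesssim> (UNIV :: 'u set)"
    using assms unfolding small_def by (rule lesspoll_imp_lepoll)
  then have "\<exists>f :: 'a \<Rightarrow> 'u. inj_on f A"
    unfolding lepoll_def by blast
  then show ?thesis unfolding code_def by (rule someI_ex)
qed

lemma decode_code [simp]:
  assumes "small TYPE('u) A" "a \<in> A"
  shows "decode A (code A a :: 'u) = a"
  using inj_on_code[OF assms(1)] assms(2) by (simp add: decode_def)

lemma code_decode [simp]:
  assumes "x \<in> code A ` A"
  shows "code A (decode A x) = x"
  using assms by (simp add: decode_def f_inv_into_f)

lemma decode_in:
  assumes "x \<in> code A ` A"
  shows "decode A x \<in> A"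
  using assms by (simp add: decode_def inv_into_into)

lemma small_code_image: "small u A \<Longrightarrow> small u (code A ` A)"
  by (rule small_lepoll[OF image_lepoll])

section \<open>Categories\<close>

context locally_small_category
begin

lemma homD: "f \<in> hom C X Y \<Longrightarrow> f \<in> Arr C" "f \<in> hom C X Y \<Longrightarrow> Dom C f = X"
    "f \<in> hom C X Y \<Longrightarrow> Cod C f = Y"
  by (simp_all add: hom_def)

lemma hom_objs: "f \<in> hom C X Y \<Longrightarrow> X \<in> Obj C" "f \<in> hom C X Y \<Longrightarrow> Y \<in> Obj C"
  using dom_obj cod_obj by (auto simp: hom_def)

lemma arr_hom: "f \<in> Arr C \<Longrightarrow> f \<in> hom C (Dom C f) (Cod C f)"
  by (simp add: hom_def)

lemma isoE:
  assumes "is_iso C f" "f \<in> hom C X Y"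
  obtains g where "g \<in> hom C Y X" "g \<odot> f = Idt C X" "f \<odot> g = Idt C Y"
  using assms by (auto simp: is_iso_def hom_def)

text \<open>The arrow \<open>k\<close> and the identity form a cocone, which gives a retraction
  \<open>h\<close> of \<open>q\<close>; cancelling the epimorphism \<open>e\<close> gives
  \<open>q k = p\<close>, so \<open>q h\<close> fixes both legs and is the identity. Applied in the
  variety, this turns a factorization of \<open>e'\<close> through \<open>e\<close> into an
  isomorphism, which a conservative functor reflects.\<close>

lemma pushout_leg_iso:
  assumes po: "is_pushout C e e' p q" and e: "is_epi C e"
    and k: "k \<in> hom C (Cod C e) (Cod C e')" "k \<odot> e = e'"
  shows "is_iso C q"
proof -
  define X Y Y' Z where "X = Dom C e" "Y = Cod C e" "Y' = Cod C e'" "Z = Cod C p"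
  have hom: "e \<in> hom C X Y" "e' \<in> hom C X Y'" "p \<in> hom C Y Z" "q \<in> hom C Y' Z"
    and eq: "p \<odot> e = q \<odot> e'"
    and univ: "\<And>W a b. a \<in> hom C Y W \<Longrightarrow> b \<in> hom C Y' W \<Longrightarrow> a \<odot> e = b \<odot> e' \<Longrightarrow>
      \<exists>!h. h \<in> hom C Z W \<and> h \<odot> p = a \<and> h \<odot> q = b"
    using po unfolding is_pushout_def X_Y_Y'_Z_def by (simp_all add: hom_def)
  have k_hom: "k \<in> hom C Y Y'" using k(1) by (simp only: X_Y_Y'_Z_def)
  have obj: "Y' \<in> Obj C" "Z \<in> Obj C"
    using hom(4) dom_obj[of q] cod_obj[of q] by (auto simp: hom_def)
  have id: "Idt C Y' \<in> hom C Y' Y'" "Idt C Z \<in> hom C Z Z" using obj idt_hom by auto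
  have "\<exists>!h. h \<in> hom C Z Y' \<and> h \<odot> p = k \<and> h \<odot> q = Idt C Y'"
    by (rule univ[OF k_hom id(1)]) (simp add: k(2) idt_comp[OF hom(2)])
  then obtain h where h: "h \<in> hom C Z Y'" "h \<odot> p = k" "h \<odot> q = Idt C Y'" by blast
  have "(q \<odot> k) \<odot> e = p \<odot> e"
    using comp_assoc[OF hom(1) k_hom hom(4)] k(2) eq by simp
  then have qk: "q \<odot> k = p"
    using e comp_hom[OF k_hom hom(4)] hom(3) unfolding is_epi_def X_Y_Y'_Z_def(2) by blast
  have qh: "q \<odot> h \<in> hom C Z Z" by (rule comp_hom[OF h(1) hom(4)])
  have "(q \<odot> h) \<odot> p = p" using comp_assoc[OF hom(3) h(1) hom(4)] h(2) qk by simp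
  moreover have "(q \<odot> h) \<odot> q = q"
    using comp_assoc[OF hom(4) h(1) hom(4)] h(3) comp_idt[OF hom(4)] by simp
  ultimately have "q \<odot> h = Idt C Z"
    using univ[OF hom(3,4) eq] qh id(2) idt_comp[OF hom(3)] idt_comp[OF hom(4)] by blast
  then show ?thesis
    unfolding is_iso_def using hom(4) h by (auto simp: hom_def)
qed

text \<open>Dual argument: \<open>k\<close> and the identity form a cone, \<open>h\<close> is a
  section of \<open>q\<close>, and cancelling the monomorphism \<open>m\<close> gives
  \<open>k q = p\<close>. It turns a factorization of \<open>m'\<close> through \<open>m\<close>
  into an isomorphism.\<close>

lemma pullback_leg_iso:
  assumes pb: "is_pullback C m m' p q" and m: "is_mono C m"
    and k: "k \<in> hom C (Dom C m') (Dom C m)" "m \<odot> k = m'"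
  shows "is_iso C q"
proof -
  define Y X X' P where "Y = Cod C m" "X = Dom C m" "X' = Dom C m'" "P = Dom C p"
  have hom: "m \<in> hom C X Y" "m' \<in> hom C X' Y" "p \<in> hom C P X" "q \<in> hom C P X'"
    and eq: "m \<odot> p = m' \<odot> q"
    and univ: "\<And>W a b. a \<in> hom C W X \<Longrightarrow> b \<in> hom C W X' \<Longrightarrow> m \<odot> a = m' \<odot> b \<Longrightarrow>
      \<exists>!h. h \<in> hom C W P \<and> p \<odot> h = a \<and> q \<odot> h = b"
    using pb unfolding is_pullback_def Y_X_X'_P_def by (simp_all add: hom_def)
  have k_hom: "k \<in> hom C X' X" using k(1) by (simp only: Y_X_X'_P_def)
  have obj: "X' \<in> Obj C" "P \<in> Obj C"
    using hom(4) dom_obj[of q] cod_obj[of q] by (auto simp: hom_def)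
  have id: "Idt C X' \<in> hom C X' X'" "Idt C P \<in> hom C P P" using obj idt_hom by auto
  have "\<exists>!h. h \<in> hom C X' P \<and> p \<odot> h = k \<and> q \<odot> h = Idt C X'"
    by (rule univ[OF k_hom id(1)]) (simp add: k(2) comp_idt[OF hom(2)])
  then obtain h where h: "h \<in> hom C X' P" "p \<odot> h = k" "q \<odot> h = Idt C X'" by blast
  have "m \<odot> (k \<odot> q) = m \<odot> p"
    using comp_assoc[OF hom(4) k_hom hom(1)] k(2) eq by simp
  then have kq: "k \<odot> q = p"
    using m comp_hom[OF hom(4) k_hom] hom(3) unfolding is_mono_def Y_X_X'_P_def(2) by blast
  have hq: "h \<odot> q \<in> hom C P P" by (rule comp_hom[OF hom(4) h(1)])
  have "p \<odot> (h \<odot> q) = p" using comp_assoc[OF hom(4) h(1) hom(3)] h(2) kq by simp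
  moreover have "q \<odot> (h \<odot> q) = q"
    using comp_assoc[OF hom(4) h(1) hom(4)] h(3) idt_comp[OF hom(4)] by simp
  ultimately have "h \<odot> q = Idt C P"
    using univ[OF hom(3,4) eq] hq id(2) comp_idt[OF hom(3)] comp_idt[OF hom(4)] by blast
  then show ?thesis
    unfolding is_iso_def using hom(4) h by (auto simp: hom_def)
qed

end

context proper_factorization_system
begin

lemma E_cancel:
  assumes "e \<in> E" "e \<in> hom C X Y" "g \<in> hom C Y Z" "h \<in> hom C Y Z" "g \<odot> e = h \<odot> e"
  shows "g = h"
  using E_epi[OF assms(1)] assms(2-) unfolding is_epi_def by (auto simp: hom_def)

lemma M_cancel:
  assumes "m \<in> M" "m \<in> hom C X Y" "g \<in> hom C W X" "h \<in> hom C W X" "m \<odot> g = m \<odot> h"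
  shows "g = h"
  using M_mono[OF assms(1)] assms(2-) unfolding is_mono_def by (auto simp: hom_def)

lemma factorE:
  assumes "f \<in> hom C X Y"
  obtains e m Z where "e \<in> E" "m \<in> M" "e \<in> hom C X Z" "m \<in> hom C Z Y" "f = m \<odot> e"
proof -
  obtain e m where em: "e \<in> E" "m \<in> M" "Cod C e = Dom C m" "f = m \<odot> e"
    using factorization[of f] assms by (auto simp: hom_def)
  have e: "e \<in> hom C (Dom C e) (Dom C m)" and m: "m \<in> hom C (Dom C m) (Cod C m)"
    using em E_arr M_arr by (auto simp: hom_def)
  have "f \<in> hom C (Dom C e) (Cod C m)" using comp_hom[OF e m] em(4) by simp
  then have "Dom C e = X" "Cod C m = Y" using assms by (auto simp: hom_def)
  then show thesis using that em e m by simp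
qed

end

section \<open>Varieties as categories with a factorization system\<close>

text \<open>\<open>is_algebra\<close> asks for the value \<open>undefined\<close> off the domain of
  each operation; building subalgebras, quotients and powers through this constructor settles that
  requirement once.\<close>

definition mk_algebra :: "'f signature \<Rightarrow> 'u set \<Rightarrow> ('f \<Rightarrow> 'u list \<Rightarrow> 'u) \<Rightarrow> ('f, 'u) algebra" where
  "mk_algebra Sg S op =
     \<lparr> carrier = S,
       oper = (\<lambda>s xs. if s \<in> ops Sg \<and> length xs = arity Sg s \<and> set xs \<subseteq> S
                      then op s xs else undefined) \<rparr>"

lemma carrier_mk_algebra [simp]: "carrier (mk_algebra Sg S op) = S"
  by (simp add: mk_algebra_def)

lemma oper_mk_algebra [simp]:
  "s \<in> ops Sg \<Longrightarrow> length xs = arity Sg s \<Longrightarrow> set xs \<subseteq> S \<Longrightarrow> oper (mk_algebra Sg S op) s xs = op s xs"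
  by (simp add: mk_algebra_def)

lemma is_algebra_mk_algebra:
  assumes "\<And>s xs. s \<in> ops Sg \<Longrightarrow> length xs = arity Sg s \<Longrightarrow> set xs \<subseteq> S \<Longrightarrow> op s xs \<in> S"
  shows "is_algebra Sg (mk_algebra Sg S op)"
  using assms by (simp add: is_algebra_def mk_algebra_def)

lemma alg_homsI:
  assumes "\<And>x. x \<in> carrier A \<Longrightarrow> h x \<in> carrier B"
    and "h \<in> extensional (carrier A)"
    and "\<And>s xs. s \<in> ops Sg \<Longrightarrow> length xs = arity Sg s \<Longrightarrow> set xs \<subseteq> carrier A \<Longrightarrow>
           h (oper A s xs) = oper B s (map h xs)"
  shows "h \<in> alg_homs Sg A B"
  using assms by (auto simp: alg_homs_def PiE_def)

lemma alg_homs_closed: "h \<in> alg_homs Sg A B \<Longrightarrow> x \<in> carrier A \<Longrightarrow> h x \<in> carrier B"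
  by (auto simp: alg_homs_def)

lemma alg_homs_extensional: "h \<in> alg_homs Sg A B \<Longrightarrow> h \<in> extensional (carrier A)"
  by (auto simp: alg_homs_def PiE_def)

lemma alg_homs_oper:
  "h \<in> alg_homs Sg A B \<Longrightarrow> s \<in> ops Sg \<Longrightarrow> length xs = arity Sg s \<Longrightarrow> set xs \<subseteq> carrier A \<Longrightarrow>
   h (oper A s xs) = oper B s (map h xs)"
  by (auto simp: alg_homs_def)

lemma map_restrict_id [simp]: "set xs \<subseteq> S \<Longrightarrow> map (\<lambda>x\<in>S. x) xs = xs"
  by (auto intro!: map_idI)

lemma oper_closed:
  "is_algebra Sg A \<Longrightarrow> s \<in> ops Sg \<Longrightarrow> length xs = arity Sg s \<Longrightarrow> set xs \<subseteq> carrier A \<Longrightarrow>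
   oper A s xs \<in> carrier A"
  unfolding is_algebra_def by meson

lemma alg_homs_id: "is_algebra Sg A \<Longrightarrow> (\<lambda>x\<in>carrier A. x) \<in> alg_homs Sg A A"
  by (intro alg_homsI) (auto simp: oper_closed)

lemma alg_homs_eval_trm:
  assumes h: "h \<in> alg_homs Sg A B" and A: "is_algebra Sg A"
    and "wf_trm Sg t" and \<rho>: "range \<rho> \<subseteq> carrier A"
  shows "eval_trm A \<rho> t \<in> carrier A \<and> h (eval_trm A \<rho> t) = eval_trm B (h \<circ> \<rho>) t"
  using assms(3)
proof induction
  case (2 s ts)
  let ?xs = "map (eval_trm A \<rho>) ts"
  have xs: "set ?xs \<subseteq> carrier A" using 2 by auto
  have "map h ?xs = map (eval_trm B (h \<circ> \<rho>)) ts" using 2 by (auto simp: o_def)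
  then show ?case
    using oper_closed[OF A \<open>s \<in> ops Sg\<close> _ xs] alg_homs_oper[OF h \<open>s \<in> ops Sg\<close> _ xs] 2(2)
    by (simp add: o_def del: map_map)
qed (use \<rho> in auto)

abbreviation ap :: "('f, 'u) alg_arrow \<Rightarrow> 'u \<Rightarrow> 'u" where
  "ap f \<equiv> snd (snd f)"

definition kernel_pair :: "('f, 'u) alg_arrow \<Rightarrow> ('u \<times> 'u) set" where
  "kernel_pair f = {(x, y). x \<in> carrier (fst f) \<and> y \<in> carrier (fst f) \<and> ap f x = ap f y}"

section \<open>Closure properties of the variety and factoring of homomorphisms\<close>

locale variety_presentation =
  fixes Sg :: "'f signature" and Eqs :: "'f equations"
  assumes universe: "universe TYPE('u)"
    and presentation: "presentation TYPE('u) Sg Eqs"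
begin

abbreviation V :: "('f, 'u) algebra set" where
  "V \<equiv> variety TYPE('u) Sg Eqs"

abbreviation VC :: "(('f, 'u) algebra, ('f, 'u) alg_arrow) category" where
  "VC \<equiv> variety_cat TYPE('u) Sg Eqs"

lemma V_is_algebra: "A \<in> V \<Longrightarrow> is_algebra Sg A"
  and V_small: "A \<in> V \<Longrightarrow> small TYPE('u) (carrier A)"
  by (auto simp: variety_def)

lemma V_oper_closed:
  "A \<in> V \<Longrightarrow> s \<in> ops Sg \<Longrightarrow> length xs = arity Sg s \<Longrightarrow> set xs \<subseteq> carrier A \<Longrightarrow>
   oper A s xs \<in> carrier A"
  by (rule oper_closed[OF V_is_algebra])

lemma Eqs_wf:
  assumes "eqn \<in> Eqs"
  shows "wf_trm Sg (fst eqn)" "wf_trm Sg (snd eqn)"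
proof -
  have "\<forall>eqn\<in>Eqs. wf_trm Sg (fst eqn) \<and> wf_trm Sg (snd eqn)"
    using presentation unfolding presentation_def case_prod_beta by (elim conjE)
  then show "wf_trm Sg (fst eqn)" "wf_trm Sg (snd eqn)" using assms by simp_all
qed

text \<open>An equation that fails in \<open>A\<close> at some valuation fails in \<open>B\<close>
  after applying a homomorphism that separates the two values. This covers subalgebras, separated by
  an inclusion, and powers, separated by the coordinate projections.\<close>

lemma variety_separated:
  assumes A: "is_algebra Sg A" "small TYPE('u) (carrier A)"
    and sep: "\<And>x y. x \<in> carrier A \<Longrightarrow> y \<in> carrier A \<Longrightarrow> x \<noteq> y \<Longrightarrow>
                \<exists>B\<in>V. \<exists>h\<in>alg_homs Sg A B. h x \<noteq> h y"
  shows "A \<in> V"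
proof -
  have "satisfies A eqn" if eqn: "eqn \<in> Eqs" for eqn
    unfolding satisfies_def
  proof (intro allI impI, rule ccontr)
    fix \<rho> :: "nat \<Rightarrow> 'u"
    assume \<rho>: "range \<rho> \<subseteq> carrier A"
      and neq: "eval_trm A \<rho> (fst eqn) \<noteq> eval_trm A \<rho> (snd eqn)"
    have "eval_trm A \<rho> (fst eqn) \<in> carrier A" "eval_trm A \<rho> (snd eqn) \<in> carrier A"
      using alg_homs_eval_trm[OF alg_homs_id A(1) _ \<rho>] A(1) Eqs_wf[OF eqn] by blast+
    from sep[OF this neq] obtain B h where B: "B \<in> V" "h \<in> alg_homs Sg A B"
      and neq': "h (eval_trm A \<rho> (fst eqn)) \<noteq> h (eval_trm A \<rho> (snd eqn))"
      by blast
    have "range (h \<circ> \<rho>) \<subseteq> carrier B"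
      using \<rho> alg_homs_closed[OF B(2)] by auto
    then have "eval_trm B (h \<circ> \<rho>) (fst eqn) = eval_trm B (h \<circ> \<rho>) (snd eqn)"
      using B(1) eqn unfolding variety_def satisfies_def by blast
    then show False
      using neq' alg_homs_eval_trm[OF B(2) A(1) _ \<rho>] Eqs_wf[OF eqn] by simp
  qed
  then show ?thesis using A by (simp add: variety_def)
qed

text \<open>A valuation in \<open>B\<close> lifts through a set-theoretic section of
  \<open>h\<close>; the equation holds for the lifted valuation and is carried down by
  \<open>h\<close>.\<close>

lemma variety_image:
  assumes A: "A \<in> V" and B: "is_algebra Sg B"
    and h: "h \<in> alg_homs Sg A B" "h ` carrier A = carrier B"
  shows "B \<in> V"
proof -
  have "satisfies B eqn" if eqn: "eqn \<in> Eqs" for eqn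
    unfolding satisfies_def
  proof (intro allI impI)
    fix \<rho> :: "nat \<Rightarrow> 'u"
    assume \<rho>: "range \<rho> \<subseteq> carrier B"
    let ?\<rho> = "inv_into (carrier A) h \<circ> \<rho>"
    have \<rho>': "range ?\<rho> \<subseteq> carrier A"
      using \<rho> h(2) by (auto intro!: inv_into_into)
    have "h \<circ> ?\<rho> = \<rho>"
      using \<rho> h(2) by (auto simp: fun_eq_iff intro!: f_inv_into_f)
    moreover have "eval_trm A ?\<rho> (fst eqn) = eval_trm A ?\<rho> (snd eqn)"
      using A eqn \<rho>' unfolding variety_def satisfies_def by blast
    ultimately show "eval_trm B \<rho> (fst eqn) = eval_trm B \<rho> (snd eqn)"
      using alg_homs_eval_trm[OF h(1) V_is_algebra[OF A] _ \<rho>'] Eqs_wf[OF eqn] by metis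
  qed
  moreover have "small TYPE('u) (carrier B)"
    using small_lepoll[OF image_lepoll V_small[OF A]] h(2) by metis
  ultimately show ?thesis using B by (simp add: variety_def)
qed

lemma Obj_VC [simp]: "Obj VC = V"
  and Dom_VC [simp]: "Dom VC f = fst f"
  and Cod_VC [simp]: "Cod VC f = fst (snd f)"
  and Idt_VC [simp]: "Idt VC A = (A, A, \<lambda>x\<in>carrier A. x)"
  and Comp_VC: "g \<odot>\<^bsub>VC\<^esub> f = (fst f, fst (snd g), compose (carrier (fst f)) (ap g) (ap f))"
  by (cases f; cases g; simp add: variety_cat_def)+

lemma VC_homI: "A \<in> V \<Longrightarrow> B \<in> V \<Longrightarrow> h \<in> alg_homs Sg A B \<Longrightarrow> (A, B, h) \<in> hom VC A B"
  by (auto simp: variety_cat_def hom_def)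

lemma VC_homD:
  assumes "f \<in> hom VC A B"
  shows "A \<in> V" "B \<in> V" "ap f \<in> alg_homs Sg A B" "fst f = A" "fst (snd f) = B"
  using assms by (auto simp: variety_cat_def hom_def)

lemma VC_Arr: "f \<in> Arr VC \<longleftrightarrow> f \<in> hom VC (fst f) (fst (snd f))"
  by (auto simp: hom_def)

lemma hom_Arr: "f \<in> hom VC A B \<Longrightarrow> f \<in> Arr VC"
  by (auto simp: hom_def)

lemma ap_closed: "f \<in> hom VC A B \<Longrightarrow> x \<in> carrier A \<Longrightarrow> ap f x \<in> carrier B"
  by (rule alg_homs_closed[OF VC_homD(3)])

lemma VC_eqI:
  assumes "f \<in> hom VC A B" "g \<in> hom VC A B" "\<And>x. x \<in> carrier A \<Longrightarrow> ap f x = ap g x"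
  shows "f = g"
proof -
  have "ap f = ap g"
    using alg_homs_extensional[OF VC_homD(3)[OF assms(1)]]
      alg_homs_extensional[OF VC_homD(3)[OF assms(2)]] assms(3)
    by (rule extensionalityI)
  then show ?thesis
    using VC_homD(4,5)[OF assms(1)] VC_homD(4,5)[OF assms(2)] by (simp add: prod_eq_iff)
qed

lemma ap_comp: "f \<in> hom VC A B \<Longrightarrow> x \<in> carrier A \<Longrightarrow> ap (g \<odot>\<^bsub>VC\<^esub> f) x = ap g (ap f x)"
  by (simp add: VC_homD(4) Comp_VC compose_def)

lemma VC_comp_hom:
  assumes f: "f \<in> hom VC A B" and g: "g \<in> hom VC B D"
  shows "g \<odot>\<^bsub>VC\<^esub> f \<in> hom VC A D"
proof -
  have "compose (carrier A) (ap g) (ap f) \<in> alg_homs Sg A D"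
  proof (rule alg_homsI)
    fix s xs assume s: "s \<in> ops Sg" "length xs = arity Sg s" "set xs \<subseteq> carrier A"
    have "set (map (ap f) xs) \<subseteq> carrier B" using s(3) ap_closed[OF f] by auto
    moreover have "map (compose (carrier A) (ap g) (ap f)) xs = map (ap g) (map (ap f) xs)"
      using s(3) by (auto simp: compose_def subset_iff)
    moreover have "compose (carrier A) (ap g) (ap f) (oper A s xs) = ap g (oper B s (map (ap f) xs))"
      using V_oper_closed[OF VC_homD(1)[OF f] s] alg_homs_oper[OF VC_homD(3)[OF f] s]
      by (simp add: compose_def)
    ultimately show "compose (carrier A) (ap g) (ap f) (oper A s xs)
        = oper D s (map (compose (carrier A) (ap g) (ap f)) xs)"
      using alg_homs_oper[OF VC_homD(3)[OF g] s(1), of "map (ap f) xs"] s(2) by (simp del: map_map)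
  qed (use ap_closed[OF f] ap_closed[OF g] in \<open>auto simp: compose_def\<close>)
  then show ?thesis
    using VC_homD(4,5)[OF f] VC_homD(4,5)[OF g] VC_homI[OF VC_homD(1)[OF f] VC_homD(2)[OF g]]
    by (simp add: Comp_VC)
qed

lemma VC_idt_hom: "A \<in> V \<Longrightarrow> Idt VC A \<in> hom VC A A"
  unfolding Idt_VC by (intro VC_homI alg_homs_id V_is_algebra)

lemma inclusion_hom:
  assumes "B \<in> V" "S \<subseteq> carrier B"
    and "\<And>s xs. s \<in> ops Sg \<Longrightarrow> length xs = arity Sg s \<Longrightarrow> set xs \<subseteq> S \<Longrightarrow> oper B s xs \<in> S"
  defines "A \<equiv> mk_algebra Sg S (oper B)"
  shows "A \<in> V" "(A, B, \<lambda>x\<in>S. x) \<in> hom VC A B"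
proof -
  have *: "(\<lambda>x\<in>S. x) \<in> alg_homs Sg A B"
    unfolding A_def using assms(2,3)
    by (intro alg_homsI) auto
  show "A \<in> V"
  proof (rule variety_separated)
    show "is_algebra Sg A"
      unfolding A_def using assms(3) by (rule is_algebra_mk_algebra)
    show "small TYPE('u) (carrier A)"
      unfolding A_def using assms(2) V_small[OF assms(1)]
      by (auto intro: small_lepoll[OF subset_imp_lepoll])
    fix x y assume "x \<in> carrier A" "y \<in> carrier A" "x \<noteq> y"
    then show "\<exists>B\<in>V. \<exists>h\<in>alg_homs Sg A B. h x \<noteq> h y"
      using * assms(1) by (intro bexI[of _ B] bexI[of _ "\<lambda>x\<in>S. x"]) (auto simp: A_def)
  qed
  then show "(A, B, \<lambda>x\<in>S. x) \<in> hom VC A B"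
    using assms(1) * by (intro VC_homI)
qed

text \<open>The value at \<open>b\<close> is read off at an arbitrary preimage under
  \<open>e\<close>; \<open>ker\<close> makes the choice irrelevant, and this is also why the
  resulting map respects the operations.\<close>

lemma VC_factor_surj:
  assumes e: "e \<in> hom VC A B" "ap e ` carrier A = carrier B" and f: "f \<in> hom VC A D"
    and ker: "\<And>x y. x \<in> carrier A \<Longrightarrow> y \<in> carrier A \<Longrightarrow> ap e x = ap e y \<Longrightarrow> ap f x = ap f y"
  obtains k where "k \<in> hom VC B D" "k \<odot>\<^bsub>VC\<^esub> e = f"
proof -
  let ?s = "inv_into (carrier A) (ap e)"
  define h where "h = (\<lambda>b\<in>carrier B. ap f (?s b))"
  have s: "?s b \<in> carrier A" "ap e (?s b) = b" if "b \<in> carrier B" for b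
    using that e(2) by (auto intro: inv_into_into f_inv_into_f)
  have he: "h (ap e x) = ap f x" if "x \<in> carrier A" for x
    using that s ap_closed[OF e(1) that] by (auto simp: h_def intro: ker)
  have "h \<in> alg_homs Sg B D"
  proof (rule alg_homsI)
    fix t xs assume t: "t \<in> ops Sg" "length xs = arity Sg t" "set xs \<subseteq> carrier B"
    let ?ys = "map ?s xs"
    have ys: "set ?ys \<subseteq> carrier A" "length ?ys = arity Sg t" using s t by auto
    have xs: "map (ap e) ?ys = xs" using s t(3) by (auto intro!: map_idI)
    have "map h xs = map (ap f) ?ys" using t(3) by (auto simp: h_def)
    then have "oper D t (map h xs) = ap f (oper A t ?ys)"
      using alg_homs_oper[OF VC_homD(3)[OF f] t(1) ys(2,1)] by (simp only:)
    moreover have "h (oper B t xs) = ap f (oper A t ?ys)"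
      using alg_homs_oper[OF VC_homD(3)[OF e(1)] t(1) ys(2,1)] xs
        he[OF V_oper_closed[OF VC_homD(1)[OF e(1)] t(1) ys(2,1)]] by (simp only:)
    ultimately show "h (oper B t xs) = oper D t (map h xs)" by (simp only:)
  qed (use s ap_closed[OF f] in \<open>auto simp: h_def\<close>)
  then have k: "(B, D, h) \<in> hom VC B D"
    using VC_homI[OF VC_homD(2)[OF e(1)] VC_homD(2)[OF f]] by simp
  moreover have "(B, D, h) \<odot>\<^bsub>VC\<^esub> e = f"
    using ap_comp[OF e(1)] he by (intro VC_eqI[OF VC_comp_hom[OF e(1) k] f]) simp
  ultimately show thesis by (rule that)
qed

text \<open>Preimages under \<open>m\<close> are unique, so compatibility with the operations may be
  tested after applying \<open>m\<close>.\<close>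

lemma VC_factor_inj:
  assumes m: "m \<in> hom VC B D" "inj_on (ap m) (carrier B)" and f: "f \<in> hom VC A D"
    and im: "ap f ` carrier A \<subseteq> ap m ` carrier B"
  obtains k where "k \<in> hom VC A B" "m \<odot>\<^bsub>VC\<^esub> k = f"
proof -
  define h where "h = (\<lambda>a\<in>carrier A. inv_into (carrier B) (ap m) (ap f a))"
  have h: "h a \<in> carrier B" "ap m (h a) = ap f a" if "a \<in> carrier A" for a
  proof -
    have "ap f a \<in> ap m ` carrier B" using that im by blast
    then show "h a \<in> carrier B" "ap m (h a) = ap f a"
      using that by (simp_all add: h_def inv_into_into f_inv_into_f)
  qed
  have "h \<in> alg_homs Sg A B"
  proof (rule alg_homsI)
    fix t xs assume t: "t \<in> ops Sg" "length xs = arity Sg t" "set xs \<subseteq> carrier A"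
    have ys: "set (map h xs) \<subseteq> carrier B" "length (map h xs) = arity Sg t" using h t by auto
    have "map (ap m) (map h xs) = map (ap f) xs" using h(2) t(3) by auto
    then have "ap m (h (oper A t xs)) = ap m (oper B t (map h xs))"
      using alg_homs_oper[OF VC_homD(3)[OF f] t] alg_homs_oper[OF VC_homD(3)[OF m(1)] t(1) ys(2,1)]
        h(2)[OF V_oper_closed[OF VC_homD(1)[OF f] t]] by (simp only:)
    then show "h (oper A t xs) = oper B t (map h xs)"
      using inj_onD[OF m(2)] h(1)[OF V_oper_closed[OF VC_homD(1)[OF f] t]]
        V_oper_closed[OF VC_homD(1)[OF m(1)] t(1) ys(2,1)] by blast
  qed (use h in \<open>auto simp: h_def\<close>)
  then have k: "(A, B, h) \<in> hom VC A B"
    using VC_homI[OF VC_homD(1)[OF f] VC_homD(1)[OF m(1)]] by simp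
  moreover have "m \<odot>\<^bsub>VC\<^esub> (A, B, h) = f"
    using ap_comp[OF k] h by (intro VC_eqI[OF VC_comp_hom[OF k m(1)] f]) simp
  ultimately show thesis by (rule that)
qed

lemma VC_surj_cancel:
  assumes e: "e \<in> hom VC A B" "ap e ` carrier A = carrier B"
    and k: "k \<in> hom VC B D" "l \<in> hom VC B D" and eq: "k \<odot>\<^bsub>VC\<^esub> e = l \<odot>\<^bsub>VC\<^esub> e"
  shows "k = l"
proof (rule VC_eqI[OF k])
  fix y assume "y \<in> carrier B"
  then obtain x where "x \<in> carrier A" "y = ap e x" using e(2) by blast
  then show "ap k y = ap l y" using ap_comp[OF e(1), of x] eq by metis
qed

lemma VC_inj_cancel:
  assumes m: "m \<in> hom VC B D" "inj_on (ap m) (carrier B)"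
    and k: "k \<in> hom VC A B" "l \<in> hom VC A B" and eq: "m \<odot>\<^bsub>VC\<^esub> k = m \<odot>\<^bsub>VC\<^esub> l"
  shows "k = l"
proof (rule VC_eqI[OF k])
  fix x assume x: "x \<in> carrier A"
  then have "ap m (ap k x) = ap m (ap l x)"
    using ap_comp[OF k(1) x, of m] ap_comp[OF k(2) x, of m] eq by simp
  then show "ap k x = ap l x"
    using inj_onD[OF m(2)] ap_closed[OF k(1) x] ap_closed[OF k(2) x] by blast
qed

end

section \<open>Isomorphisms, pushouts and pullbacks in the category of algebras\<close>

context variety_presentation
begin

lemma VC_locally_small_category: "locally_small_category TYPE('u) VC"
proof
  fix f assume "f \<in> Arr VC"
  then show "Dom VC f \<in> Obj VC" "Cod VC f \<in> Obj VC"
    using VC_homD(1,2) by (auto simp: VC_Arr)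
next
  fix A B assume "A \<in> Obj VC" "B \<in> Obj VC"
  then have "small TYPE('u) (carrier A \<rightarrow>\<^sub>E carrier B)"
    using small_PiE[OF universe V_small V_small] by simp
  moreover have "hom VC A B \<lesssim> (carrier A \<rightarrow>\<^sub>E carrier B)"
    unfolding lepoll_def
  proof (intro exI conjI)
    show "inj_on ap (hom VC A B)" by (rule inj_onI, rule VC_eqI) simp_all
    show "ap ` hom VC A B \<subseteq> carrier A \<rightarrow>\<^sub>E carrier B"
      using VC_homD(3) by (fastforce simp: alg_homs_def)
  qed
  ultimately show "small TYPE('u) (hom VC A B)" by (rule small_lepoll[rotated])
next
  fix A B f assume f: "f \<in> hom VC A B"
  show "f \<odot>\<^bsub>VC\<^esub> Idt VC A = f"
    using f VC_homD(1)[OF f] ap_comp[OF VC_idt_hom]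
    by (intro VC_eqI[OF VC_comp_hom[OF VC_idt_hom f] f]) auto
  show "Idt VC B \<odot>\<^bsub>VC\<^esub> f = f"
    using f VC_homD(2)[OF f] ap_comp[OF f] ap_closed[OF f]
    by (intro VC_eqI[OF VC_comp_hom[OF f VC_idt_hom] f]) auto
next
  fix A B D D' f g h
  assume f: "f \<in> hom VC A B" and g: "g \<in> hom VC B D" and h: "h \<in> hom VC D D'"
  show "(h \<odot>\<^bsub>VC\<^esub> g) \<odot>\<^bsub>VC\<^esub> f = h \<odot>\<^bsub>VC\<^esub> (g \<odot>\<^bsub>VC\<^esub> f)"
    using f g h
    by (intro VC_eqI[OF VC_comp_hom[OF f VC_comp_hom[OF g h]] VC_comp_hom[OF VC_comp_hom[OF f g] h]])
       (simp add: ap_comp[OF f] ap_comp[OF g] ap_comp[OF VC_comp_hom[OF f g]] ap_closed[OF f])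
qed (use VC_idt_hom VC_comp_hom in auto)

text \<open>For the converse the inverse is obtained by factoring the identity through the
  surjection \<open>f\<close>, which yields a homomorphism at once; the second composite is computed
  by cancelling \<open>f\<close> on the right.\<close>

lemma VC_iso_iff:
  assumes f: "f \<in> hom VC A B"
  shows "is_iso VC f \<longleftrightarrow> bij_betw (ap f) (carrier A) (carrier B)"
proof
  assume "is_iso VC f"
  then obtain g where g: "g \<in> hom VC B A" "g \<odot>\<^bsub>VC\<^esub> f = Idt VC A" "f \<odot>\<^bsub>VC\<^esub> g = Idt VC B"
    unfolding is_iso_def using VC_homD(4,5)[OF f] by auto
  have "ap g (ap f x) = x" if "x \<in> carrier A" for x
    using ap_comp[OF f that, of g] g(2) that by simp
  moreover have "ap f (ap g x) = x" if "x \<in> carrier B" for x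
    using ap_comp[OF g(1) that, of f] g(3) that by simp
  ultimately show "bij_betw (ap f) (carrier A) (carrier B)"
    using ap_closed[OF f] ap_closed[OF g(1)] by (intro bij_betw_byWitness[of _ "ap g"]) auto
next
  assume "bij_betw (ap f) (carrier A) (carrier B)"
  then have bij: "inj_on (ap f) (carrier A)" "ap f ` carrier A = carrier B"
    by (auto simp: bij_betw_def)
  have A: "Idt VC A \<in> hom VC A A" and B: "Idt VC B \<in> hom VC B B"
    using VC_homD[OF f] VC_idt_hom by auto
  obtain g where g: "g \<in> hom VC B A" "g \<odot>\<^bsub>VC\<^esub> f = Idt VC A"
    by (rule VC_factor_surj[OF f bij(2) A]) (use bij(1) in \<open>auto dest: inj_onD\<close>)
  have "f \<odot>\<^bsub>VC\<^esub> g = Idt VC B"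
  proof (rule VC_surj_cancel[OF f bij(2) VC_comp_hom[OF g(1) f] B])
    interpret locally_small_category "TYPE('u)" VC by (rule VC_locally_small_category)
    show "(f \<odot>\<^bsub>VC\<^esub> g) \<odot>\<^bsub>VC\<^esub> f = Idt VC B \<odot>\<^bsub>VC\<^esub> f"
      using comp_assoc[OF f g(1) f] g(2) comp_idt[OF f] idt_comp[OF f] by simp
  qed
  then show "is_iso VC f"
    unfolding is_iso_def using g f VC_homD(4,5)[OF f] hom_Arr[OF f] by auto
qed

abbreviation surjective :: "('f, 'u) alg_arrow set" where
  "surjective \<equiv> surjective_homs TYPE('u) Sg Eqs"

abbreviation injective :: "('f, 'u) alg_arrow set" where
  "injective \<equiv> injective_homs TYPE('u) Sg Eqs"

lemma surjective_iff:
  "f \<in> hom VC A B \<Longrightarrow> f \<in> surjective \<longleftrightarrow> ap f ` carrier A = carrier B"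
  using VC_homD(4,5) hom_Arr by (fastforce simp: surjective_homs_def)

lemma injective_iff:
  "f \<in> hom VC A B \<Longrightarrow> f \<in> injective \<longleftrightarrow> inj_on (ap f) (carrier A)"
  using VC_homD(4,5) hom_Arr by (fastforce simp: injective_homs_def)

lemma surjectiveE:
  assumes "e \<in> surjective"
  shows "e \<in> hom VC (fst e) (fst (snd e))" "ap e ` carrier (fst e) = carrier (fst (snd e))"
  using assms by (auto simp: surjective_homs_def hom_def)

lemma injectiveE:
  assumes "m \<in> injective"
  shows "m \<in> hom VC (fst m) (fst (snd m))" "inj_on (ap m) (carrier (fst m))"
  using assms by (auto simp: injective_homs_def hom_def)

text \<open>The carrier has to lie in \<open>'u\<close>, so the quotient is built on a system of
  representatives instead of classes: \<open>r\<close> picks a representative and every operation is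
  followed by \<open>r\<close>.\<close>

lemma quotient_algebra:
  assumes A: "A \<in> V" and R: "equiv (carrier A) R"
    and cong: "\<And>s xs ys. s \<in> ops Sg \<Longrightarrow> length xs = arity Sg s \<Longrightarrow>
       list_all2 (\<lambda>x y. (x, y) \<in> R) xs ys \<Longrightarrow> (oper A s xs, oper A s ys) \<in> R"
  obtains Q q where "q \<in> hom VC A Q" "ap q ` carrier A = carrier Q"
    "\<And>x y. x \<in> carrier A \<Longrightarrow> y \<in> carrier A \<Longrightarrow> ap q x = ap q y \<longleftrightarrow> (x, y) \<in> R"
proof -
  define r where "r = (\<lambda>x\<in>carrier A. SOME y. (x, y) \<in> R)"
  have r: "(x, r x) \<in> R" if "x \<in> carrier A" for x
    using someI[of "\<lambda>y. (x, y) \<in> R" x] that R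
    by (auto simp: r_def equiv_def refl_on_def)
  have RA: "R \<subseteq> carrier A \<times> carrier A" using R by (rule equiv_type)
  have rA: "r x \<in> carrier A" if "x \<in> carrier A" for x
    using r[OF that] RA by blast
  have r_eq: "r x = r y \<longleftrightarrow> (x, y) \<in> R" if "x \<in> carrier A" "y \<in> carrier A" for x y
  proof
    assume "r x = r y"
    then show "(x, y) \<in> R" using r[OF that(1)] r[OF that(2)] R by (metis equivE symE transE)
  next
    assume "(x, y) \<in> R"
    \<comment> \<open>Related points satisfy the same predicate under \<open>SOME\<close>, hence get
      the same representative.\<close>
    then have "(x, z) \<in> R \<longleftrightarrow> (y, z) \<in> R" for z using R by (metis equivE symE transE)
    then show "r x = r y" using that by (simp add: r_def)
  qed
  let ?Q = "mk_algebra Sg (r ` carrier A) (\<lambda>s xs. r (oper A s xs))"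
  have r_hom: "r \<in> alg_homs Sg A ?Q"
  proof (rule alg_homsI)
    fix s xs assume s: "s \<in> ops Sg" "length xs = arity Sg s" "set xs \<subseteq> carrier A"
    have "list_all2 (\<lambda>x y. (x, y) \<in> R) xs (map r xs)"
      using s(3) r nth_mem by (fastforce simp: list_all2_conv_all_nth)
    then have "(oper A s xs, oper A s (map r xs)) \<in> R" by (rule cong[OF s(1,2)])
    then have "r (oper A s xs) = r (oper A s (map r xs))" using r_eq RA by blast
    moreover have "set (map r xs) \<subseteq> r ` carrier A" using s(3) by auto
    ultimately show "r (oper A s xs) = oper ?Q s (map r xs)" using s by simp
  qed (auto simp: r_def)
  have "is_algebra Sg ?Q"
  proof (rule is_algebra_mk_algebra, rule imageI)
    fix s xs assume s: "s \<in> ops Sg" "length xs = arity Sg s" "set xs \<subseteq> r ` carrier A"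
    have "set xs \<subseteq> carrier A" using s(3) rA by blast
    then show "oper A s xs \<in> carrier A" by (rule V_oper_closed[OF A s(1,2)])
  qed
  then have "?Q \<in> V" by (rule variety_image[OF A _ r_hom]) simp
  then have "(A, ?Q, r) \<in> hom VC A ?Q" using r_hom by (rule VC_homI[OF A])
  then show thesis by (rule that) (use r_eq in auto)
qed

text \<open>The join of the two kernel congruences. The intersection discards the pairs
  \<open>(x, x)\<close> with \<open>x\<close> outside the carrier that the reflexive closure
  adds.\<close>

definition kernel_join :: "('f, 'u) alg_arrow \<Rightarrow> ('f, 'u) alg_arrow \<Rightarrow> ('u \<times> 'u) set" where
  "kernel_join e e' =
     (kernel_pair e \<union> kernel_pair e')\<^sup>* \<inter> carrier (fst e) \<times> carrier (fst e)"

lemma equiv_kernel_join: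
  assumes "fst e' = fst e"
  shows "equiv (carrier (fst e)) (kernel_join e e')"
proof (rule equivI)
  show "kernel_join e e' \<subseteq> carrier (fst e) \<times> carrier (fst e)" by (auto simp: kernel_join_def)
  show "refl_on (carrier (fst e)) (kernel_join e e')"
    by (auto simp: refl_on_def kernel_join_def)
  have "sym (kernel_pair e \<union> kernel_pair e')" by (auto simp: sym_def kernel_pair_def)
  then have "sym ((kernel_pair e \<union> kernel_pair e')\<^sup>*)" by (rule sym_rtrancl)
  then show "sym (kernel_join e e')" unfolding sym_def kernel_join_def by blast
  show "trans (kernel_join e e')"
    unfolding kernel_join_def by (rule transI) (auto intro: rtrancl_trans)
qed

text \<open>Only one argument is moved, since this is the form needed to follow a chain that
  alternates between two kernels, where neither congruence alone relates the ends.\<close>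

lemma kernel_pair_oper:
  assumes f: "f \<in> hom VC A B" and xy: "(x, y) \<in> kernel_pair f"
    and s: "s \<in> ops Sg" "length (us @ x # vs) = arity Sg s"
    and uv: "set us \<subseteq> carrier A" "set vs \<subseteq> carrier A"
  shows "(oper A s (us @ x # vs), oper A s (us @ y # vs)) \<in> kernel_pair f"
proof -
  have xy': "x \<in> carrier A" "y \<in> carrier A" "ap f x = ap f y"
    using xy VC_homD(4)[OF f] by (auto simp: kernel_pair_def)
  have *: "set (us @ x # vs) \<subseteq> carrier A" "set (us @ y # vs) \<subseteq> carrier A"
    "length (us @ y # vs) = arity Sg s"
    using uv xy' s by auto
  have "ap f (oper A s (us @ x # vs)) = ap f (oper A s (us @ y # vs))"
    using alg_homs_oper[OF VC_homD(3)[OF f] s(1)] * s(2) xy'(3) by simp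
  then show ?thesis
    using V_oper_closed[OF VC_homD(1)[OF f] s(1)] * s(2) VC_homD(4)[OF f]
    by (simp add: kernel_pair_def)
qed

text \<open>An operation is finitary, so its arguments can be replaced one at a time.\<close>

lemma kernel_join_oper:
  assumes e: "e \<in> hom VC A B" and e': "e' \<in> hom VC A B'"
    and s: "s \<in> ops Sg" "length xs = arity Sg s"
    and xs: "list_all2 (\<lambda>x y. (x, y) \<in> kernel_join e e') xs ys"
  shows "(oper A s xs, oper A s ys) \<in> kernel_join e e'"
proof -
  let ?K = "kernel_pair e \<union> kernel_pair e'"
  have A: "fst e = A" "fst e' = A" using VC_homD(4) e e' by auto
  have step: "(oper A s (us @ x # vs), oper A s (us @ y # vs)) \<in> ?K\<^sup>*"
    if "(x, y) \<in> ?K\<^sup>*" "x \<in> carrier A" "length (us @ x # vs) = arity Sg s"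
      "set us \<subseteq> carrier A" "set vs \<subseteq> carrier A" for us vs x y
    using that(1)
  proof induction
    case (step y z)
    have "(oper A s (us @ y # vs), oper A s (us @ z # vs)) \<in> ?K"
      using step(2) kernel_pair_oper[OF e _ s(1)] kernel_pair_oper[OF e' _ s(1)] that(3-5) by auto
    then show ?case using step(3) by (rule rtrancl_into_rtrancl[rotated])
  qed simp
  \<comment> \<open>\<open>us\<close> collects the arguments already replaced; it varies in the
    induction, and each step moves the head of \<open>ys\<close> into it.\<close>
  have "(oper A s (us @ xs), oper A s (us @ ys)) \<in> ?K\<^sup>*"
    if "length (us @ xs) = arity Sg s" "set us \<subseteq> carrier A" for us
    using xs that
  proof (induction arbitrary: us rule: list_all2_induct)
    case (Cons x xs y ys)
    have xy: "(x, y) \<in> ?K\<^sup>*" "x \<in> carrier A" "y \<in> carrier A"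
      using Cons(1) A by (auto simp: kernel_join_def)
    have "set xs \<subseteq> carrier A"
      using Cons(2) A by (auto simp: kernel_join_def list_all2_conv_all_nth in_set_conv_nth)
    then have "(oper A s (us @ x # xs), oper A s (us @ y # xs)) \<in> ?K\<^sup>*"
      using step[OF xy(1,2)] Cons by simp
    moreover have "(oper A s ((us @ [y]) @ xs), oper A s ((us @ [y]) @ ys)) \<in> ?K\<^sup>*"
      by (rule Cons.IH) (use Cons xy in auto)
    ultimately show ?case by (auto intro: rtrancl_trans)
  qed simp
  from this[of "[]"] have "(oper A s xs, oper A s ys) \<in> ?K\<^sup>*" using s by simp
  moreover have "set xs \<subseteq> carrier A" "set ys \<subseteq> carrier A" "length ys = arity Sg s"
    using xs s A by (auto simp: kernel_join_def list_all2_conv_all_nth in_set_conv_nth)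
  ultimately show ?thesis
    using V_oper_closed[OF VC_homD(1)[OF e] s(1)] s A by (simp add: kernel_join_def)
qed

text \<open>Since \<open>e\<close> and \<open>e'\<close> are onto, the pushout is a quotient of
  \<open>A\<close> itself, by the join of the two kernels; no coproduct of \<open>B\<close> and
  \<open>B'\<close> has to be formed. The second conclusion keeps the kernel of the diagonal, on
  which the joins of normal clusters depend.\<close>

lemma VC_pushout_construction:
  assumes e: "e \<in> hom VC A B" "ap e ` carrier A = carrier B"
    and e': "e' \<in> hom VC A B'" "ap e' ` carrier A = carrier B'"
  obtains p q where "is_pushout VC e e' p q"
    and "\<And>x y. x \<in> carrier A \<Longrightarrow> y \<in> carrier A \<Longrightarrow>
           ap p (ap e x) = ap p (ap e y) \<longleftrightarrow> (x, y) \<in> kernel_join e e'"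
proof -
  have fst: "fst e = A" "fst e' = A" "fst (snd e) = B" "fst (snd e') = B'"
    using VC_homD(4,5) e(1) e'(1) by auto
  obtain Q r where r: "r \<in> hom VC A Q" "ap r ` carrier A = carrier Q"
    and r_eq: "\<And>x y. x \<in> carrier A \<Longrightarrow> y \<in> carrier A \<Longrightarrow> ap r x = ap r y \<longleftrightarrow> (x, y) \<in> kernel_join e e'"
    using quotient_algebra[OF VC_homD(1)[OF e(1)], of "kernel_join e e'"]
      equiv_kernel_join[of e' e] kernel_join_oper[OF e(1) e'(1)] fst by metis
  have K: "(x, y) \<in> kernel_join e e'"
    if "x \<in> carrier A" "y \<in> carrier A" "ap e x = ap e y \<or> ap e' x = ap e' y" for x y
    using that fst unfolding kernel_join_def
    by (intro IntI r_into_rtrancl) (auto simp: kernel_pair_def)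
  obtain p where p: "p \<in> hom VC B Q" "p \<odot>\<^bsub>VC\<^esub> e = r"
    by (rule VC_factor_surj[OF e r(1)]) (use K r_eq in auto)
  obtain q where q: "q \<in> hom VC B' Q" "q \<odot>\<^bsub>VC\<^esub> e' = r"
    by (rule VC_factor_surj[OF e' r(1)]) (use K r_eq in auto)
  have pe: "ap p (ap e x) = ap r x" if "x \<in> carrier A" for x
    using ap_comp[OF e(1) that, of p] p(2) by simp
  have p_surj: "ap p ` carrier B = carrier Q"
    using pe r(2) e(2)[symmetric] by (simp add: image_image)
  interpret locally_small_category "TYPE('u)" VC by (rule VC_locally_small_category)
  have "\<exists>!h. h \<in> hom VC Q Z \<and> h \<odot>\<^bsub>VC\<^esub> p = a \<and> h \<odot>\<^bsub>VC\<^esub> q = b"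
    if a: "a \<in> hom VC B Z" and b: "b \<in> hom VC B' Z" and eq: "a \<odot>\<^bsub>VC\<^esub> e = b \<odot>\<^bsub>VC\<^esub> e'" for Z a b
  proof -
    let ?f = "a \<odot>\<^bsub>VC\<^esub> e"
    have f: "?f \<in> hom VC A Z" by (rule VC_comp_hom[OF e(1) a])
    have f_e: "ap ?f x = ap a (ap e x)" and f_e': "ap ?f x = ap b (ap e' x)"
      if "x \<in> carrier A" for x
      using ap_comp[OF e(1) that, of a] ap_comp[OF e'(1) that, of b] eq by simp_all
    \<comment> \<open>A cocone is constant along chains of the two kernels, hence factors through
      the quotient \<open>r\<close>.\<close>
    have "ap ?f x = ap ?f y" if "(x, y) \<in> (kernel_pair e \<union> kernel_pair e')\<^sup>*" for x y
      using that
    proof induction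
      case (step y z)
      have "ap ?f y = ap ?f z"
        using step(2)
      proof
        assume "(y, z) \<in> kernel_pair e"
        then show ?thesis using f_e[of y] f_e[of z] fst by (simp add: kernel_pair_def)
      next
        assume "(y, z) \<in> kernel_pair e'"
        then show ?thesis using f_e'[of y] f_e'[of z] fst by (simp add: kernel_pair_def)
      qed
      then show ?case using step(3) by simp
    qed simp
    then obtain h where h: "h \<in> hom VC Q Z" "h \<odot>\<^bsub>VC\<^esub> r = ?f"
      using VC_factor_surj[OF r f] r_eq unfolding kernel_join_def by blast
    have "h \<odot>\<^bsub>VC\<^esub> p = a"
      by (rule VC_surj_cancel[OF e VC_comp_hom[OF p(1) h(1)] a])
         (simp add: comp_assoc[OF e(1) p(1) h(1)] p(2) h(2))
    moreover have "h \<odot>\<^bsub>VC\<^esub> q = b"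
      by (rule VC_surj_cancel[OF e' VC_comp_hom[OF q(1) h(1)] b])
         (simp add: comp_assoc[OF e'(1) q(1) h(1)] q(2) h(2) eq)
    moreover have "h' = h" if "h' \<in> hom VC Q Z" "h' \<odot>\<^bsub>VC\<^esub> p = a" for h'
      using VC_surj_cancel[OF p(1) p_surj that(1) h(1)] that(2) \<open>h \<odot>\<^bsub>VC\<^esub> p = a\<close> by simp
    ultimately show ?thesis using h(1) by blast
  qed
  then have "is_pushout VC e e' p q"
    unfolding is_pushout_def
    using hom_Arr[OF e(1)] hom_Arr[OF e'(1)] fst p q VC_homD(5)[OF p(1)] by simp
  then show thesis by (rule that) (simp add: pe r_eq)
qed

text \<open>An arbitrary pushout maps to the constructed one by a comparison arrow, so whatever its
  diagonal identifies is identified there, and there the kernel is known.\<close>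

lemma VC_pushout_kernel:
  assumes po: "is_pushout VC e e' p q" and e: "e \<in> surjective" "e' \<in> surjective"
    and xy: "x \<in> carrier (fst e)" "y \<in> carrier (fst e)" "ap p (ap e x) = ap p (ap e y)"
  shows "(x, y) \<in> (kernel_pair e \<union> kernel_pair e')\<^sup>*"
proof -
  note e_hom = surjectiveE[OF e(1)] and e'_hom = surjectiveE[OF e(2)]
  have fst: "fst e' = fst e" using po by (simp add: is_pushout_def)
  obtain p' q' where po': "is_pushout VC e e' p' q'"
    and ker: "ap p' (ap e x) = ap p' (ap e y) \<longleftrightarrow> (x, y) \<in> kernel_join e e'"
    using VC_pushout_construction[OF e_hom e'_hom[unfolded fst]] xy(1,2) by metis
  obtain h where h: "h \<odot>\<^bsub>VC\<^esub> p = p'"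
    using po po' unfolding is_pushout_def by metis
  have p: "p \<in> hom VC (fst (snd e)) (fst (snd p))"
    using po by (simp add: is_pushout_def)
  have "ap p' (ap e x) = ap p' (ap e y)"
    using ap_comp[OF p, of _ h] h ap_closed[OF e_hom(1)] xy by metis
  then show ?thesis using ker by (simp add: kernel_join_def)
qed

lemma VC_image_closed:
  assumes f: "f \<in> hom VC A B" and s: "s \<in> ops Sg" "length xs = arity Sg s"
    and xs: "set xs \<subseteq> ap f ` carrier A"
  shows "oper B s xs \<in> ap f ` carrier A"
proof -
  let ?ys = "map (inv_into (carrier A) (ap f)) xs"
  have ys: "set ?ys \<subseteq> carrier A" "length ?ys = arity Sg s"
    using xs s(2) by (auto intro!: inv_into_into)
  have "map (ap f) ?ys = xs"
    by (simp add: map_idI f_inv_into_f[OF subsetD[OF xs]])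
  then have "oper B s xs = ap f (oper A s ?ys)"
    using alg_homs_oper[OF VC_homD(3)[OF f] s(1) ys(2,1)] by (simp only:)
  then show ?thesis
    using V_oper_closed[OF VC_homD(1)[OF f] s(1) ys(2,1)] by (simp only: imageI)
qed

text \<open>The pullback of two injections is realised on the intersection of their images inside
  \<open>B\<close>, with \<open>p\<close> and \<open>q\<close> obtained by factoring the inclusion
  \<open>i\<close>. The second conclusion records that matching points are attained, which the
  universal property expresses only through arrows.\<close>

lemma VC_pullback_construction:
  assumes m: "m \<in> hom VC A B" "inj_on (ap m) (carrier A)"
    and m': "m' \<in> hom VC A' B" "inj_on (ap m') (carrier A')"
  obtains p q where "is_pullback VC m m' p q"
    and "\<And>x x'. x \<in> carrier A \<Longrightarrow> x' \<in> carrier A' \<Longrightarrow> ap m x = ap m' x' \<Longrightarrow>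
           x \<in> ap p ` carrier (fst p)"
proof -
  have fst: "fst m = A" "fst m' = A'" "fst (snd m) = B" "fst (snd m') = B"
    using VC_homD(4,5) m(1) m'(1) by auto
  let ?S = "ap m ` carrier A \<inter> ap m' ` carrier A'"
  define P where "P = mk_algebra Sg ?S (oper B)"
  define i where "i = (P, B, \<lambda>x\<in>?S. x)"
  have i: "i \<in> hom VC P B"
    unfolding i_def P_def using ap_closed[OF m(1)] VC_image_closed[OF m(1)] VC_image_closed[OF m'(1)]
    by (intro inclusion_hom(2)[OF VC_homD(2)[OF m(1)]]) auto
  have P: "carrier P = ?S" and ap_i: "\<And>x. x \<in> carrier P \<Longrightarrow> ap i x = x"
    by (auto simp: P_def i_def)
  have i_inj: "inj_on (ap i) (carrier P)" by (rule inj_onI) (simp add: ap_i)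
  have im_i: "ap i ` carrier P = ?S"
    using image_cong[OF refl ap_i, of "carrier P"] P by simp
  obtain p where p: "p \<in> hom VC P A" "m \<odot>\<^bsub>VC\<^esub> p = i"
    by (rule VC_factor_inj[OF m i]) (use im_i in blast)
  obtain q where q: "q \<in> hom VC P A'" "m' \<odot>\<^bsub>VC\<^esub> q = i"
    by (rule VC_factor_inj[OF m' i]) (use im_i in blast)
  interpret locally_small_category "TYPE('u)" VC by (rule VC_locally_small_category)
  have "\<exists>!h. h \<in> hom VC Z P \<and> p \<odot>\<^bsub>VC\<^esub> h = a \<and> q \<odot>\<^bsub>VC\<^esub> h = b"
    if a: "a \<in> hom VC Z A" and b: "b \<in> hom VC Z A'" and eq: "m \<odot>\<^bsub>VC\<^esub> a = m' \<odot>\<^bsub>VC\<^esub> b" for Z a b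
  proof -
    let ?f = "m \<odot>\<^bsub>VC\<^esub> a"
    have f: "?f \<in> hom VC Z B" by (rule VC_comp_hom[OF a m(1)])
    have "ap ?f x \<in> ?S" if "x \<in> carrier Z" for x
    proof
      show "ap ?f x \<in> ap m ` carrier A"
        using ap_comp[OF a that, of m] ap_closed[OF a that] by simp
      show "ap ?f x \<in> ap m' ` carrier A'"
        using ap_comp[OF b that, of m'] ap_closed[OF b that] eq by simp
    qed
    then have "ap ?f ` carrier Z \<subseteq> ap i ` carrier P" unfolding im_i by blast
    then obtain h where h: "h \<in> hom VC Z P" "i \<odot>\<^bsub>VC\<^esub> h = ?f"
      by (rule VC_factor_inj[OF i i_inj f])
    have "p \<odot>\<^bsub>VC\<^esub> h = a"
      by (rule VC_inj_cancel[OF m VC_comp_hom[OF h(1) p(1)] a])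
         (simp add: comp_assoc[OF h(1) p(1) m(1), symmetric] p(2) h(2))
    moreover have "q \<odot>\<^bsub>VC\<^esub> h = b"
      by (rule VC_inj_cancel[OF m' VC_comp_hom[OF h(1) q(1)] b])
         (simp add: comp_assoc[OF h(1) q(1) m'(1), symmetric] q(2) h(2) eq)
    moreover have "h' = h" if h': "h' \<in> hom VC Z P" "p \<odot>\<^bsub>VC\<^esub> h' = a" for h'
    proof (rule VC_inj_cancel[OF i i_inj h'(1) h(1)])
      show "i \<odot>\<^bsub>VC\<^esub> h' = i \<odot>\<^bsub>VC\<^esub> h"
        using comp_assoc[OF h'(1) p(1) m(1)] p(2) h' h by simp
    qed
    ultimately show ?thesis using h(1) by blast
  qed
  then have "is_pullback VC m m' p q"
    unfolding is_pullback_def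
    using hom_Arr[OF m(1)] hom_Arr[OF m'(1)] fst p q VC_homD(4)[OF p(1)] by simp
  moreover have "x \<in> ap p ` carrier (fst p)"
    if x: "x \<in> carrier A" "x' \<in> carrier A'" "ap m x = ap m' x'" for x x'
  proof -
    have mx: "ap m x \<in> carrier P"
      using P x(3) imageI[OF x(1), of "ap m"] imageI[OF x(2), of "ap m'"] by simp
    have "ap m (ap p (ap m x)) = ap m x"
      using ap_comp[OF p(1) mx, of m] p(2) ap_i[OF mx] by simp
    then have "ap p (ap m x) = x" using inj_onD[OF m(2)] x(1) ap_closed[OF p(1) mx] by blast
    then show ?thesis using mx VC_homD(4)[OF p(1)] by (metis imageI)
  qed
  ultimately show thesis by (rule that)
qed

text \<open>The comparison arrow goes from the constructed pullback into the given one, so points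
  attained by the former are attained by the latter.\<close>

lemma VC_pullback_points:
  assumes pb: "is_pullback VC m m' p q" and m: "m \<in> injective" "m' \<in> injective"
    and x: "x \<in> carrier (fst m)" "x' \<in> carrier (fst m')" "ap m x = ap m' x'"
  shows "x \<in> ap p ` carrier (fst p)"
proof -
  note m_hom = injectiveE[OF m(1)] and m'_hom = injectiveE[OF m(2)]
  have cod: "fst (snd m') = fst (snd m)" using pb by (simp add: is_pullback_def)
  obtain p' q' where pb': "is_pullback VC m m' p' q'" and x': "x \<in> ap p' ` carrier (fst p')"
    using VC_pullback_construction[OF m_hom m'_hom[unfolded cod]] x by metis
  obtain h where h: "h \<in> hom VC (fst p') (fst p)" "p \<odot>\<^bsub>VC\<^esub> h = p'"
    using pb pb' unfolding is_pullback_def Dom_VC by metis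
  from x' obtain z where z: "z \<in> carrier (fst p')" "x = ap p' z" by blast
  have "x = ap p (ap h z)" using ap_comp[OF h(1) z(1), of p] h(2) z(2) by simp
  then show ?thesis using ap_closed[OF h(1) z(1)] by blast
qed

lemma VC_factorized_category: "factorized_category TYPE('u) VC surjective injective"
proof -
  interpret locally_small_category "TYPE('u)" VC by (rule VC_locally_small_category)
  show ?thesis
  proof
    show "surjective \<subseteq> Arr VC" "injective \<subseteq> Arr VC"
      by (auto simp: surjective_homs_def injective_homs_def)
  next
    fix f assume iso: "is_iso VC f"
    then have f: "f \<in> hom VC (fst f) (fst (snd f))" by (simp add: is_iso_def VC_Arr)
    show "f \<in> surjective" "f \<in> injective"
      using iso VC_iso_iff[OF f] surjective_iff[OF f] injective_iff[OF f]
      by (auto simp: bij_betw_def)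
  next
    fix e e' assume *: "e \<in> surjective" "e' \<in> surjective" "Cod VC e = Dom VC e'"
    note e = surjectiveE[OF *(1)] and e' = surjectiveE[OF *(2), folded *(3)[simplified]]
    show "e' \<odot>\<^bsub>VC\<^esub> e \<in> surjective"
      unfolding surjective_iff[OF VC_comp_hom[OF e(1) e'(1)]] e'(2)[symmetric] e(2)[symmetric]
      by (simp add: image_image ap_comp[OF e(1)] cong: image_cong)
  next
    fix m m' assume *: "m \<in> injective" "m' \<in> injective" "Cod VC m = Dom VC m'"
    note m = injectiveE[OF *(1)] and m' = injectiveE[OF *(2), folded *(3)[simplified]]
    show "m' \<odot>\<^bsub>VC\<^esub> m \<in> injective"
      unfolding injective_iff[OF VC_comp_hom[OF m(1) m'(1)]]
    proof (rule inj_onI)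
      fix x y assume xy: "x \<in> carrier (fst m)" "y \<in> carrier (fst m)"
        "ap (m' \<odot>\<^bsub>VC\<^esub> m) x = ap (m' \<odot>\<^bsub>VC\<^esub> m) y"
      have "ap m' (ap m x) = ap m' (ap m y)"
        using xy(3) ap_comp[OF m(1) xy(1), of m'] ap_comp[OF m(1) xy(2), of m'] by simp
      then have "ap m x = ap m y"
        by (rule inj_onD[OF m'(2) _ ap_closed[OF m(1) xy(1)] ap_closed[OF m(1) xy(2)]])
      then show "x = y" by (rule inj_onD[OF m(2) _ xy(1,2)])
    qed
  next
    fix f assume "f \<in> Arr VC"
    then obtain A B where f: "f \<in> hom VC A B" by (auto simp: VC_Arr)
    let ?S = "ap f ` carrier A"
    define I where "I = mk_algebra Sg ?S (oper B)"
    define i where "i = (I, B, \<lambda>x\<in>?S. x)"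
    have i: "i \<in> hom VC I B"
      unfolding i_def I_def using ap_closed[OF f] VC_image_closed[OF f]
      by (intro inclusion_hom(2)[OF VC_homD(2)[OF f]]) auto
    have I: "carrier I = ?S" and ap_i: "\<And>x. x \<in> carrier I \<Longrightarrow> ap i x = x"
      by (auto simp: I_def i_def)
    have i_inj: "inj_on (ap i) (carrier I)" by (rule inj_onI) (simp add: ap_i)
    have im_i: "ap i ` carrier I = ?S"
      using image_cong[OF refl ap_i, of "carrier I"] I by simp
    obtain e where e: "e \<in> hom VC A I" "i \<odot>\<^bsub>VC\<^esub> e = f"
      by (rule VC_factor_inj[OF i i_inj f]) (use im_i in blast)
    have "ap e x = ap f x" if "x \<in> carrier A" for x
      using ap_comp[OF e(1) that, of i] ap_i ap_closed[OF e(1) that] e(2) I by simp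
    then have "e \<in> surjective" using surjective_iff[OF e(1)] I by (simp cong: image_cong)
    moreover have "i \<in> injective" using injective_iff[OF i] i_inj by simp
    ultimately show "\<exists>e\<in>surjective. \<exists>m\<in>injective. Cod VC e = Dom VC m \<and> f = m \<odot>\<^bsub>VC\<^esub> e"
      using e VC_homD(5)[OF e(1)] VC_homD(4)[OF i] by (intro bexI[of _ e] bexI[of _ i]) auto
  next
    fix e m a b
    assume *: "e \<in> surjective" "m \<in> injective" "a \<in> hom VC (Dom VC e) (Dom VC m)"
      "b \<in> hom VC (Cod VC e) (Cod VC m)" and eq: "m \<odot>\<^bsub>VC\<^esub> a = b \<odot>\<^bsub>VC\<^esub> e"
    note e = surjectiveE[OF *(1)] and m = injectiveE[OF *(2)]
      and a = *(3)[simplified] and b = *(4)[simplified]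
    \<comment> \<open>\<open>a\<close> respects the kernel of \<open>e\<close>, because
      \<open>m\<close> is injective and \<open>m a = b e\<close>; so \<open>a\<close> factors
      through \<open>e\<close>, and the factor is the diagonal.\<close>
    have "ap a x = ap a y" if xy: "x \<in> carrier (fst e)" "y \<in> carrier (fst e)" "ap e x = ap e y" for x y
    proof -
      have "ap m (ap a x) = ap m (ap a y)"
        using ap_comp[OF a xy(1), of m] ap_comp[OF a xy(2), of m]
          ap_comp[OF e(1) xy(1), of b] ap_comp[OF e(1) xy(2), of b] xy(3) eq by simp
      then show ?thesis by (rule inj_onD[OF m(2) _ ap_closed[OF a xy(1)] ap_closed[OF a xy(2)]])
    qed
    then obtain d where d: "d \<in> hom VC (fst (snd e)) (fst m)" "d \<odot>\<^bsub>VC\<^esub> e = a"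
      by (rule VC_factor_surj[OF e a])
    have "m \<odot>\<^bsub>VC\<^esub> d = b"
      by (rule VC_surj_cancel[OF e VC_comp_hom[OF d(1) m(1)] b])
        (simp add: comp_assoc[OF e(1) d(1) m(1)] d(2) eq)
    show "\<exists>!d. d \<in> hom VC (Cod VC e) (Dom VC m) \<and> d \<odot>\<^bsub>VC\<^esub> e = a \<and> m \<odot>\<^bsub>VC\<^esub> d = b"
    proof (intro ex1I[of _ d] conjI)
      fix d' assume d': "d' \<in> hom VC (Cod VC e) (Dom VC m) \<and> d' \<odot>\<^bsub>VC\<^esub> e = a \<and> m \<odot>\<^bsub>VC\<^esub> d' = b"
      then have "d' \<in> hom VC (fst (snd e)) (fst m)" "d' \<odot>\<^bsub>VC\<^esub> e = d \<odot>\<^bsub>VC\<^esub> e"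
        using d(2) by simp_all
      then show "d' = d" by (rule VC_surj_cancel[OF e _ d(1)])
    qed (use d \<open>m \<odot>\<^bsub>VC\<^esub> d = b\<close> in simp_all)
  next
    fix e assume "e \<in> surjective"
    note e = surjectiveE[OF this]
    show "is_epi VC e"
      unfolding is_epi_def using hom_Arr[OF e(1)] VC_surj_cancel[OF e] by simp
  next
    fix m assume "m \<in> injective"
    note m = injectiveE[OF this]
    show "is_mono VC m"
      unfolding is_mono_def using hom_Arr[OF m(1)] VC_inj_cancel[OF m] by simp
  next
    fix m m' assume *: "m \<in> injective" "m' \<in> injective" "Cod VC m = Cod VC m'"
    show "\<exists>p q. is_pullback VC m m' p q"
      by (rule VC_pullback_construction[OF injectiveE[OF *(1)]
            injectiveE[OF *(2), folded *(3)[simplified]]]) blast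
  next
    fix e e' assume *: "e \<in> surjective" "e' \<in> surjective" "Dom VC e = Dom VC e'"
    show "\<exists>p q. is_pushout VC e e' p q"
      by (rule VC_pushout_construction[OF surjectiveE[OF *(1)]
            surjectiveE[OF *(2), folded *(3)[simplified]]]) blast
  qed
qed

end

section \<open>Powers of an algebra\<close>

locale power_algebra = variety_presentation Sg Eqs
  for Sg :: "'f signature" and Eqs :: "'f equations" +
  fixes A :: "('f, 'u) algebra"
  assumes A: "A \<in> V"
begin

text \<open>An element of a power is a code in \<open>'u\<close> of a function on \<open>I\<close>;
  \<open>val I\<close> reads its coordinates and \<open>tuple I\<close> writes them.\<close>

definition val :: "'u set \<Rightarrow> 'u \<Rightarrow> 'u \<Rightarrow> 'u" where
  "val I = decode (I \<rightarrow>\<^sub>E carrier A)"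

definition tuple :: "'u set \<Rightarrow> ('u \<Rightarrow> 'u) \<Rightarrow> 'u" where
  "tuple I = code (I \<rightarrow>\<^sub>E carrier A)"

definition direct_power :: "'u set \<Rightarrow> ('f, 'u) algebra" where
  "direct_power I = mk_algebra Sg (tuple I ` (I \<rightarrow>\<^sub>E carrier A))
     (\<lambda>s xs. tuple I (\<lambda>i\<in>I. oper A s (map (\<lambda>x. val I x i) xs)))"

text \<open>Precomposition with \<open>g\<close>, contravariant in \<open>g\<close>: an inverse
  image map from the clusters of \<open>Y\<close> to those of \<open>X\<close> thereby gives a
  homomorphism from the power over the fibre of \<open>X\<close> to the power over the fibre of
  \<open>Y\<close>.\<close>

definition reindex :: "'u set \<Rightarrow> 'u set \<Rightarrow> ('u \<Rightarrow> 'u) \<Rightarrow> ('f, 'u) alg_arrow" where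
  "reindex I J g = (direct_power I, direct_power J, \<lambda>x\<in>carrier (direct_power I). tuple J (\<lambda>j\<in>J. val I x (g j)))"

lemma carrier_direct_power: "carrier (direct_power I) = tuple I ` (I \<rightarrow>\<^sub>E carrier A)"
  by (simp add: direct_power_def)

lemma small_PiE_A: "small TYPE('u) I \<Longrightarrow> small TYPE('u) (I \<rightarrow>\<^sub>E carrier A)"
  by (rule small_PiE[OF universe _ V_small[OF A]])

lemma val_tuple: "small TYPE('u) I \<Longrightarrow> \<phi> \<in> I \<rightarrow>\<^sub>E carrier A \<Longrightarrow> val I (tuple I \<phi>) = \<phi>"
  unfolding val_def tuple_def by (rule decode_code[OF small_PiE_A])

lemma tuple_val: "x \<in> carrier (direct_power I) \<Longrightarrow> tuple I (val I x) = x"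
  unfolding carrier_direct_power val_def tuple_def by (rule code_decode)

lemma val_in: "x \<in> carrier (direct_power I) \<Longrightarrow> val I x \<in> I \<rightarrow>\<^sub>E carrier A"
  unfolding carrier_direct_power val_def tuple_def by (rule decode_in)

lemma val_mem: "x \<in> carrier (direct_power I) \<Longrightarrow> i \<in> I \<Longrightarrow> val I x i \<in> carrier A"
  using val_in by (rule PiE_mem)

lemma power_ext:
  assumes "x \<in> carrier (direct_power I)" "y \<in> carrier (direct_power I)" "\<And>i. i \<in> I \<Longrightarrow> val I x i = val I y i"
  shows "x = y"
proof -
  have "val I x = val I y" by (rule PiE_ext[OF val_in[OF assms(1)] val_in[OF assms(2)] assms(3)])
  then show ?thesis using tuple_val assms(1,2) by metis
qed

lemma power_elem:
  assumes "small TYPE('u) I" "\<phi> \<in> I \<rightarrow> carrier A"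
  obtains x where "x \<in> carrier (direct_power I)" "\<forall>i\<in>I. val I x i = \<phi> i"
proof
  have *: "restrict \<phi> I \<in> I \<rightarrow>\<^sub>E carrier A" using assms(2) by auto
  show "tuple I (restrict \<phi> I) \<in> carrier (direct_power I)"
    unfolding carrier_direct_power using * by (rule imageI)
  show "\<forall>i\<in>I. val I (tuple I (restrict \<phi> I)) i = \<phi> i"
    by (simp add: val_tuple[OF assms(1) *])
qed

lemma oper_power_PiE:
  assumes "s \<in> ops Sg" "length xs = arity Sg s" "set xs \<subseteq> carrier (direct_power I)"
  shows "(\<lambda>i\<in>I. oper A s (map (\<lambda>x. val I x i) xs)) \<in> I \<rightarrow>\<^sub>E carrier A"
  using assms val_mem by (intro restrict_PiE_iff[THEN iffD2] ballI V_oper_closed[OF A]) auto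

lemma oper_power_closed:
  assumes s: "s \<in> ops Sg" "length xs = arity Sg s" "set xs \<subseteq> carrier (direct_power I)"
  shows "oper (direct_power I) s xs \<in> carrier (direct_power I)"
  using s oper_power_PiE[OF s] unfolding carrier_direct_power by (simp add: direct_power_def)

lemma val_oper:
  assumes I: "small TYPE('u) I" and s: "s \<in> ops Sg" "length xs = arity Sg s"
    and xs: "set xs \<subseteq> carrier (direct_power I)" and i: "i \<in> I"
  shows "val I (oper (direct_power I) s xs) i = oper A s (map (\<lambda>x. val I x i) xs)"
  using s xs i val_tuple[OF I oper_power_PiE[OF s xs]] unfolding carrier_direct_power
  by (simp add: direct_power_def)

lemma power_V:
  assumes I: "small TYPE('u) I"
  shows "direct_power I \<in> V"
proof (rule variety_separated)
  show "is_algebra Sg (direct_power I)"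
    using oper_power_PiE unfolding direct_power_def carrier_direct_power
    by (intro is_algebra_mk_algebra) auto
  show "small TYPE('u) (carrier (direct_power I))"
    unfolding carrier_direct_power using small_PiE_A[OF I] by (rule small_lepoll[OF image_lepoll])
  fix x y assume xy: "x \<in> carrier (direct_power I)" "y \<in> carrier (direct_power I)" "x \<noteq> y"
  then obtain i where i: "i \<in> I" "val I x i \<noteq> val I y i" using power_ext by blast
  \<comment> \<open>The projection to a coordinate \<open>i\<close> at which \<open>x\<close> and
    \<open>y\<close> differ.\<close>
  have "(\<lambda>z\<in>carrier (direct_power I). val I z i) \<in> alg_homs Sg (direct_power I) A"
  proof (rule alg_homsI)
    fix s xs assume s: "s \<in> ops Sg" "length xs = arity Sg s" "set xs \<subseteq> carrier (direct_power I)"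
    have *: "map (\<lambda>z\<in>carrier (direct_power I). val I z i) xs = map (\<lambda>z. val I z i) xs"
      using s(3) by auto
    show "(\<lambda>z\<in>carrier (direct_power I). val I z i) (oper (direct_power I) s xs) =
        oper A s (map (\<lambda>z\<in>carrier (direct_power I). val I z i) xs)"
      unfolding * using oper_power_closed[OF s] val_oper[OF I s i(1)] by simp
  qed (use i val_mem in auto)
  then show "\<exists>B\<in>V. \<exists>h\<in>alg_homs Sg (direct_power I) B. h x \<noteq> h y"
    using A xy i by (intro bexI[of _ A] bexI[of _ "\<lambda>z\<in>carrier (direct_power I). val I z i"]) auto
qed

section \<open>Reindexing of coordinates along a map of index sets\<close>

context
  fixes I J :: "'u set" and g :: "'u \<Rightarrow> 'u"
  assumes I: "small TYPE('u) I" and J: "small TYPE('u) J" and g: "g \<in> J \<rightarrow> I"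
begin

lemma reindex_PiE: "x \<in> carrier (direct_power I) \<Longrightarrow> (\<lambda>j\<in>J. val I x (g j)) \<in> J \<rightarrow>\<^sub>E carrier A"
  using val_mem funcset_mem[OF g] by simp

lemma val_reindex:
  assumes "x \<in> carrier (direct_power I)" "j \<in> J"
  shows "val J (ap (reindex I J g) x) j = val I x (g j)"
  using assms val_tuple[OF J reindex_PiE] by (simp add: reindex_def)

lemma reindex_hom: "reindex I J g \<in> hom VC (direct_power I) (direct_power J)"
  unfolding reindex_def
proof (intro VC_homI power_V I J alg_homsI)
  let ?r = "\<lambda>x\<in>carrier (direct_power I). tuple J (\<lambda>j\<in>J. val I x (g j))"
  have closed: "?r x \<in> carrier (direct_power J)" if "x \<in> carrier (direct_power I)" for x
    using that reindex_PiE unfolding carrier_direct_power[of J] by auto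
  then show "\<And>x. x \<in> carrier (direct_power I) \<Longrightarrow> ?r x \<in> carrier (direct_power J)" .
  have val: "val J (?r x) j = val I x (g j)" if "x \<in> carrier (direct_power I)" "j \<in> J" for x j
    using val_reindex[OF that] by (simp add: reindex_def)
  fix s xs assume s: "s \<in> ops Sg" "length xs = arity Sg s" "set xs \<subseteq> carrier (direct_power I)"
  have s': "length (map ?r xs) = arity Sg s" "set (map ?r xs) \<subseteq> carrier (direct_power J)"
    using s closed by auto
  show "?r (oper (direct_power I) s xs) = oper (direct_power J) s (map ?r xs)"
  proof (rule power_ext)
    fix j assume j: "j \<in> J"
    have "map (\<lambda>y. val J y j) (map ?r xs) = map (\<lambda>x. val I x (g j)) xs"
      unfolding map_map by (rule map_cong[OF refl]) (use val j s(3) in auto)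
    then show "val J (?r (oper (direct_power I) s xs)) j = val J (oper (direct_power J) s (map ?r xs)) j"
      using val[OF oper_power_closed[OF s] j] val_oper[OF I s funcset_mem[OF g j]] val_oper[OF J s(1) s' j]
      by (simp only:)
  qed (use closed oper_power_closed[OF s] oper_power_closed[OF s(1) s'] in blast)+
qed auto

lemma reindex_inj:
  assumes "\<And>i. i \<in> I \<Longrightarrow> \<exists>j\<in>J. g j = i"
  shows "inj_on (ap (reindex I J g)) (carrier (direct_power I))"
proof (rule inj_onI, rule power_ext)
  fix x y i
  assume xy: "x \<in> carrier (direct_power I)" "y \<in> carrier (direct_power I)"
    "ap (reindex I J g) x = ap (reindex I J g) y" and "i \<in> I"
  then obtain j where "j \<in> J" "g j = i" using assms by blast
  then show "val I x i = val I y i"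
    using val_reindex[OF xy(1)] val_reindex[OF xy(2)] xy(3) by metis
qed

lemma reindex_surj:
  assumes "inj_on g J" "c \<in> carrier A"
  shows "ap (reindex I J g) ` carrier (direct_power I) = carrier (direct_power J)"
proof
  show "ap (reindex I J g) ` carrier (direct_power I) \<subseteq> carrier (direct_power J)"
    using ap_closed[OF reindex_hom] by blast
  show "carrier (direct_power J) \<subseteq> ap (reindex I J g) ` carrier (direct_power I)"
  proof
    fix y assume y: "y \<in> carrier (direct_power J)"
    \<comment> \<open>Coordinates outside the image of \<open>g\<close> are unconstrained and get
      the default value \<open>c\<close>.\<close>
    have "(\<lambda>i. if i \<in> g ` J then val J y (inv_into J g i) else c) \<in> I \<rightarrow> carrier A"
      using val_mem[OF y inv_into_into[of _ g J]] assms(2) by simp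
    then obtain x where x: "x \<in> carrier (direct_power I)"
      and val: "\<forall>i\<in>I. val I x i = (if i \<in> g ` J then val J y (inv_into J g i) else c)"
      by (rule power_elem[OF I])
    have "y = ap (reindex I J g) x"
      using y ap_closed[OF reindex_hom x]
    proof (rule power_ext)
      fix j assume j: "j \<in> J"
      then show "val J y j = val J (ap (reindex I J g) x) j"
        using val_reindex[OF x j] bspec[OF val funcset_mem[OF g j]] assms(1) by simp
    qed
    then show "y \<in> ap (reindex I J g) ` carrier (direct_power I)" using x by blast
  qed
qed

text \<open>Two distinct values detect each failure. If \<open>g\<close> merges \<open>j\<close> and
  \<open>k\<close>, a tuple separating them is outside the image; if \<open>g\<close> misses
  \<open>i\<close>, two tuples differing only at \<open>i\<close> are identified. Here the
  nontriviality of the variety enters.\<close>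

lemma reindex_iso_bij:
  assumes iso: "is_iso VC (reindex I J g)"
    and c: "c \<in> carrier A" "d \<in> carrier A" "c \<noteq> d"
  shows "bij_betw g J I"
  unfolding bij_betw_def
proof
  have bij: "bij_betw (ap (reindex I J g)) (carrier (direct_power I)) (carrier (direct_power J))"
    using iso VC_iso_iff[OF reindex_hom] by blast
  show "inj_on g J"
  proof (rule inj_onI, rule ccontr)
    fix j k assume jk: "j \<in> J" "k \<in> J" "g j = g k" "j \<noteq> k"
    have "(\<lambda>i. if i = j then c else d) \<in> J \<rightarrow> carrier A" using c by simp
    then obtain y where y: "y \<in> carrier (direct_power J)"
      and val: "\<forall>i\<in>J. val J y i = (if i = j then c else d)"
      by (rule power_elem[OF J])
    obtain x where x: "x \<in> carrier (direct_power I)" "y = ap (reindex I J g) x"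
      using bij y unfolding bij_betw_def by blast
    have "val J y j = val J y k"
      using val_reindex[OF x(1)] x(2) jk by simp
    then show False using val jk c(3) by simp
  qed
  show "g ` J = I"
  proof (rule antisym)
    show "I \<subseteq> g ` J"
    proof (rule subsetI, rule ccontr)
      fix i assume i: "i \<in> I" "i \<notin> g ` J"
      have "(\<lambda>_. c) \<in> I \<rightarrow> carrier A" using c by simp
      then obtain x where x: "x \<in> carrier (direct_power I)" "\<forall>k\<in>I. val I x k = c"
        by (rule power_elem[OF I])
      have "(\<lambda>k. if k = i then d else c) \<in> I \<rightarrow> carrier A" using c by simp
      then obtain y where y: "y \<in> carrier (direct_power I)"
        "\<forall>k\<in>I. val I y k = (if k = i then d else c)"
        by (rule power_elem[OF I])
      have "ap (reindex I J g) x = ap (reindex I J g) y"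
        using ap_closed[OF reindex_hom x(1)] ap_closed[OF reindex_hom y(1)]
      proof (rule power_ext)
        fix j assume j: "j \<in> J"
        then have "g j \<noteq> i" using i by blast
        then show "val J (ap (reindex I J g) x) j = val J (ap (reindex I J g) y) j"
          using val_reindex[OF x(1) j] val_reindex[OF y(1) j] x(2) y(2) funcset_mem[OF g j] by simp
      qed
      then have "x = y" using bij x(1) y(1) unfolding bij_betw_def by (meson inj_onD)
      then show False using x(2) y(2) i c(3) by auto
    qed
  qed (use g in blast)
qed

end

lemma reindex_comp:
  assumes I: "small TYPE('u) I" and J: "small TYPE('u) J" and K: "small TYPE('u) K"
    and g: "g \<in> J \<rightarrow> I" and h: "h \<in> K \<rightarrow> J"
    and l: "\<And>k. k \<in> K \<Longrightarrow> l k = g (h k)"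
  shows "reindex J K h \<odot>\<^bsub>VC\<^esub> reindex I J g = reindex I K l"
proof -
  have li: "l \<in> K \<rightarrow> I" using l g h by fastforce
  note hom1 = reindex_hom[OF I J g] and hom2 = reindex_hom[OF J K h] and hom3 = reindex_hom[OF I K li]
  show ?thesis
  proof (rule VC_eqI[OF VC_comp_hom[OF hom1 hom2] hom3])
    fix x assume x: "x \<in> carrier (direct_power I)"
    note rx = ap_closed[OF hom1 x]
    show "ap (reindex J K h \<odot>\<^bsub>VC\<^esub> reindex I J g) x = ap (reindex I K l) x"
      unfolding ap_comp[OF hom1 x]
    proof (rule power_ext[OF ap_closed[OF hom2 rx] ap_closed[OF hom3 x]])
      fix k assume k: "k \<in> K"
      show "val K (ap (reindex J K h) (ap (reindex I J g) x)) k = val K (ap (reindex I K l) x) k"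
        using val_reindex[OF J K h rx k] val_reindex[OF I J g x funcset_mem[OF h k]] val_reindex[OF I K li x k]
          l[OF k] by simp
    qed
  qed
qed

lemma reindex_id:
  assumes I: "small TYPE('u) I" and g: "\<And>i. i \<in> I \<Longrightarrow> g i = i"
  shows "reindex I I g = Idt VC (direct_power I)"
proof -
  have gi: "g \<in> I \<rightarrow> I" using g by simp
  show ?thesis
  proof (rule VC_eqI[OF reindex_hom[OF I I gi] VC_idt_hom[OF power_V[OF I]]])
    fix x assume x: "x \<in> carrier (direct_power I)"
    have "ap (reindex I I g) x = x"
      by (rule power_ext[OF ap_closed[OF reindex_hom[OF I I gi] x] x])
         (simp_all add: val_reindex[OF I I gi x] g)
    then show "ap (reindex I I g) x = ap (Idt VC (direct_power I)) x" using x by simp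
  qed
qed

text \<open>
  The functor sending an index set \<open>I\<close> to the power \<open>A\<^sup>I\<close> turns pushouts of surjections into
  pullbacks; the hypotheses \<open>zigA\<close>, \<open>zigB\<close>, \<open>link\<close> make \<open>IP\<close> the pushout of \<open>IA\<close> and \<open>IB\<close> under \<open>IY\<close>.
\<close>

lemma reindex_pullback:
  assumes small: "small TYPE('u) IY" "small TYPE('u) IA" "small TYPE('u) IB" "small TYPE('u) IP"
    and gm: "gm \<in> IY \<rightarrow> IA" and gm': "gm' \<in> IY \<rightarrow> IB"
    and gp: "gp \<in> IA \<rightarrow> IP" and gq: "gq \<in> IB \<rightarrow> IP"
    and dp: "dp \<in> IP \<rightarrow> IA" and dq: "dq \<in> IP \<rightarrow> IB"
    and dgp: "\<And>w. w \<in> IP \<Longrightarrow> gp (dp w) = w"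
    and comm: "\<And>v. v \<in> IY \<Longrightarrow> gp (gm v) = gq (gm' v)"
    and zigA: "\<And>a. a \<in> IA \<Longrightarrow>
      \<exists>v\<in>IY. \<exists>w\<in>IY. gm v = a \<and> gm' v = gm' w \<and> gm w = dp (gp a)"
    and zigB: "\<And>b. b \<in> IB \<Longrightarrow>
      \<exists>v\<in>IY. \<exists>w\<in>IY. gm' v = b \<and> gm v = gm w \<and> gm' w = dq (gq b)"
    and link: "\<And>w. w \<in> IP \<Longrightarrow> \<exists>v\<in>IY. gm v = dp w \<and> gm' v = dq w"
  shows "is_pullback VC (reindex IA IY gm) (reindex IB IY gm') (reindex IP IA gp) (reindex IP IB gq)"
proof -
  note m = reindex_hom[OF small(2,1) gm] and m' = reindex_hom[OF small(3,1) gm']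
    and p = reindex_hom[OF small(4,2) gp] and q = reindex_hom[OF small(4,3) gq]
    and d = reindex_hom[OF small(2,4) dp]
  let ?m = "reindex IA IY gm" and ?m' = "reindex IB IY gm'" and ?p = "reindex IP IA gp"
    and ?q = "reindex IP IB gq" and ?d = "reindex IA IP dp"
  have eq: "?m \<odot>\<^bsub>VC\<^esub> ?p = ?m' \<odot>\<^bsub>VC\<^esub> ?q"
    using reindex_comp[OF small(4,2,1) gp gm, of "\<lambda>v. gp (gm v)"]
      reindex_comp[OF small(4,3,1) gq gm', of "\<lambda>v. gp (gm v)"] comm by simp
  have p_inj: "inj_on (ap ?p) (carrier (direct_power IP))"
    by (rule reindex_inj[OF small(4,2) gp]) (use funcset_mem[OF dp] dgp in blast)
  have "\<exists>!h. h \<in> hom VC Z (direct_power IP) \<and> ?p \<odot>\<^bsub>VC\<^esub> h = a \<and> ?q \<odot>\<^bsub>VC\<^esub> h = b"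
    if a: "a \<in> hom VC Z (direct_power IA)" and b: "b \<in> hom VC Z (direct_power IB)"
      and ab: "?m \<odot>\<^bsub>VC\<^esub> a = ?m' \<odot>\<^bsub>VC\<^esub> b" for Z a b
  proof -
    have glue: "val IA (ap a z) (gm v) = val IB (ap b z) (gm' v)" if "z \<in> carrier Z" "v \<in> IY" for z v
      using val_reindex[OF small(2,1) gm ap_closed[OF a that(1)] that(2)]
        val_reindex[OF small(3,1) gm' ap_closed[OF b that(1)] that(2)]
        ap_comp[OF a that(1), of ?m] ap_comp[OF b that(1), of ?m'] ab by simp
    \<comment> \<open>Along the zigzag: \<open>a\<close> at \<open>gm v\<close> equals
      \<open>b\<close> at \<open>gm' v = gm' w\<close>, which equals \<open>a\<close> at
      \<open>gm w\<close>.\<close>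
    have valA: "val IA (ap a z) (dp (gp i)) = val IA (ap a z) i" if z: "z \<in> carrier Z" and i: "i \<in> IA" for z i
    proof -
      obtain v w where "v \<in> IY" "w \<in> IY" "gm v = i" "gm' v = gm' w" "gm w = dp (gp i)"
        using zigA[OF i] by blast
      then show ?thesis using glue[OF z, of v] glue[OF z, of w] by simp
    qed
    have valB: "val IB (ap b z) (dq (gq i)) = val IB (ap b z) i" if z: "z \<in> carrier Z" and i: "i \<in> IB" for z i
    proof -
      obtain v w where "v \<in> IY" "w \<in> IY" "gm' v = i" "gm v = gm w" "gm' w = dq (gq i)"
        using zigB[OF i] by blast
      then show ?thesis using glue[OF z, of v] glue[OF z, of w] by simp
    qed
    \<comment> \<open>\<open>dp\<close> is a section of \<open>gp\<close>, so the only candidate for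
      the mediating arrow reads \<open>a\<close> at the coordinates \<open>dp w\<close>.\<close>
    let ?h = "?d \<odot>\<^bsub>VC\<^esub> a"
    have h: "?h \<in> hom VC Z (direct_power IP)" by (rule VC_comp_hom[OF a d])
    have val_h: "val IP (ap ?h z) w = val IA (ap a z) (dp w)" if "z \<in> carrier Z" "w \<in> IP" for z w
      using ap_comp[OF a that(1), of ?d] val_reindex[OF small(2,4) dp ap_closed[OF a that(1)] that(2)]
      by simp
    have "?p \<odot>\<^bsub>VC\<^esub> ?h = a"
    proof (rule VC_eqI[OF VC_comp_hom[OF h p] a])
      fix z assume z: "z \<in> carrier Z"
      show "ap (?p \<odot>\<^bsub>VC\<^esub> ?h) z = ap a z"
        unfolding ap_comp[OF h z]
      proof (rule power_ext[OF ap_closed[OF p ap_closed[OF h z]] ap_closed[OF a z]])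
        fix i assume i: "i \<in> IA"
        show "val IA (ap ?p (ap ?h z)) i = val IA (ap a z) i"
          using val_reindex[OF small(4,2) gp ap_closed[OF h z] i] val_h[OF z funcset_mem[OF gp i]] valA[OF z i]
          by simp
      qed
    qed
    moreover have "?q \<odot>\<^bsub>VC\<^esub> ?h = b"
    proof (rule VC_eqI[OF VC_comp_hom[OF h q] b])
      fix z assume z: "z \<in> carrier Z"
      show "ap (?q \<odot>\<^bsub>VC\<^esub> ?h) z = ap b z"
        unfolding ap_comp[OF h z]
      proof (rule power_ext[OF ap_closed[OF q ap_closed[OF h z]] ap_closed[OF b z]])
        fix i assume i: "i \<in> IB"
        obtain v where "v \<in> IY" "gm v = dp (gq i)" "gm' v = dq (gq i)" using link[OF funcset_mem[OF gq i]] by blast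
        then have "val IA (ap a z) (dp (gq i)) = val IB (ap b z) (dq (gq i))"
          using glue[OF z, of v] by simp
        then show "val IB (ap ?q (ap ?h z)) i = val IB (ap b z) i"
          using val_reindex[OF small(4,3) gq ap_closed[OF h z] i] val_h[OF z funcset_mem[OF gq i]] valB[OF z i]
          by simp
      qed
    qed
    moreover have "h' = ?h" if "h' \<in> hom VC Z (direct_power IP)" "?p \<odot>\<^bsub>VC\<^esub> h' = a" for h'
      using VC_inj_cancel[OF p p_inj that(1) h] that(2) \<open>?p \<odot>\<^bsub>VC\<^esub> ?h = a\<close> by simp
    ultimately show ?thesis using h by blast
  qed
  then show ?thesis
    unfolding is_pullback_def
    using hom_Arr[OF m] hom_Arr[OF m'] p q eq VC_homD(4,5)[OF m] VC_homD(4,5)[OF m'] VC_homD(4)[OF p]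
    by simp
qed

text \<open>
  Dually, pullbacks of injections become pushouts: the hypothesis \<open>inter\<close> makes \<open>IZ\<close> the intersection
  of \<open>I1\<close> and \<open>I2\<close> inside \<open>IX\<close>.  Two tuples over \<open>I1\<close> that agree on \<open>IZ\<close> are
  restrictions of two tuples over \<open>IX\<close> which agree on \<open>I2\<close>.
\<close>

lemma reindex_pushout:
  assumes small: "small TYPE('u) IX" "small TYPE('u) I1" "small TYPE('u) I2" "small TYPE('u) IZ"
    and ge: "ge \<in> I1 \<rightarrow> IX" and ge': "ge' \<in> I2 \<rightarrow> IX"
    and gp: "gp \<in> IZ \<rightarrow> I1" and gq: "gq \<in> IZ \<rightarrow> I2"
    and de: "de \<in> IX \<rightarrow> I1" and dp: "dp \<in> I1 \<rightarrow> IZ"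
    and dge: "\<And>t. t \<in> I1 \<Longrightarrow> de (ge t) = t" and inj_e': "inj_on ge' I2"
    and dgp: "\<And>w. w \<in> IZ \<Longrightarrow> dp (gp w) = w"
    and comm: "\<And>w. w \<in> IZ \<Longrightarrow> ge (gp w) = ge' (gq w)"
    and inter: "\<And>t t'. t \<in> I1 \<Longrightarrow> t' \<in> I2 \<Longrightarrow> ge t = ge' t' \<Longrightarrow> \<exists>w\<in>IZ. t = gp w"
    and c: "c \<in> carrier A"
  shows "is_pushout VC (reindex IX I1 ge) (reindex IX I2 ge') (reindex I1 IZ gp) (reindex I2 IZ gq)"
proof -
  note e = reindex_hom[OF small(1,2) ge] and e' = reindex_hom[OF small(1,3) ge']
    and p = reindex_hom[OF small(2,4) gp] and q = reindex_hom[OF small(3,4) gq]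
    and d = reindex_hom[OF small(4,2) dp]
  let ?e = "reindex IX I1 ge" and ?e' = "reindex IX I2 ge'" and ?p = "reindex I1 IZ gp"
    and ?q = "reindex I2 IZ gq" and ?d = "reindex IZ I1 dp"
  interpret locally_small_category "TYPE('u)" VC by (rule VC_locally_small_category)
  have eq: "?p \<odot>\<^bsub>VC\<^esub> ?e = ?q \<odot>\<^bsub>VC\<^esub> ?e'"
    using reindex_comp[OF small(1,2,4) ge gp, of "\<lambda>w. ge (gp w)"]
      reindex_comp[OF small(1,3,4) ge' gq, of "\<lambda>w. ge (gp w)"] comm by simp
  have e_surj: "ap ?e ` carrier (direct_power IX) = carrier (direct_power I1)"
    by (rule reindex_surj[OF small(1,2) ge _ c]) (metis inj_on_inverseI dge)
  have e'_surj: "ap ?e' ` carrier (direct_power IX) = carrier (direct_power I2)"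
    by (rule reindex_surj[OF small(1,3) ge' inj_e' c])
  have p_surj: "ap ?p ` carrier (direct_power I1) = carrier (direct_power IZ)"
    by (rule reindex_surj[OF small(2,4) gp _ c]) (metis inj_on_inverseI dgp)
  have "\<exists>!h. h \<in> hom VC (direct_power IZ) Z \<and> h \<odot>\<^bsub>VC\<^esub> ?p = a \<and> h \<odot>\<^bsub>VC\<^esub> ?q = b"
    if a: "a \<in> hom VC (direct_power I1) Z" and b: "b \<in> hom VC (direct_power I2) Z"
      and ab: "a \<odot>\<^bsub>VC\<^esub> ?e = b \<odot>\<^bsub>VC\<^esub> ?e'" for Z a b
  proof -
    have glue: "ap a (ap ?e x) = ap b (ap ?e' x)" if "x \<in> carrier (direct_power IX)" for x
      using ap_comp[OF e that, of a] ap_comp[OF e' that, of b] ab by simp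
    have ker: "ap a x = ap a y"
      if xy: "x \<in> carrier (direct_power I1)" "y \<in> carrier (direct_power I1)" "ap ?p x = ap ?p y" for x y
    proof -
      obtain y' where y': "y' \<in> carrier (direct_power IX)" "y = ap ?e y'"
        using e_surj xy(2) by blast
      \<comment> \<open>\<open>z\<close> takes its coordinates from \<open>x\<close> on the image of
        \<open>I1\<close> and from \<open>y'\<close> elsewhere. It restricts to \<open>x\<close>
        over \<open>I1\<close>; over \<open>I2\<close> it agrees with \<open>y'\<close>, since by
        \<open>inter\<close> a shared coordinate comes from \<open>IZ\<close>, where
        \<open>x\<close> and \<open>y\<close> agree.\<close>
      let ?\<chi> = "\<lambda>s. if s \<in> ge ` I1 then val I1 x (de s) else val IX y' s"
      have "?\<chi> \<in> IX \<rightarrow> carrier A"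
        using val_mem[OF xy(1) funcset_mem[OF de]] val_mem[OF y'(1)] by simp
      then obtain z where z: "z \<in> carrier (direct_power IX)" "\<forall>s\<in>IX. val IX z s = ?\<chi> s"
        by (rule power_elem[OF small(1)])
      have "ap ?e z = x"
        using ap_closed[OF e z(1)] xy(1)
      proof (rule power_ext)
        fix t assume t: "t \<in> I1"
        then show "val I1 (ap ?e z) t = val I1 x t"
          using val_reindex[OF small(1,2) ge z(1) t] bspec[OF z(2) funcset_mem[OF ge t]] dge[OF t] by simp
      qed
      moreover have "ap ?e' z = ap ?e' y'"
        using ap_closed[OF e' z(1)] ap_closed[OF e' y'(1)]
      proof (rule power_ext)
        fix t' assume t': "t' \<in> I2"
        have "val IX z (ge' t') = val IX y' (ge' t')"
        proof (cases "ge' t' \<in> ge ` I1")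
          case True
          then obtain t where t: "t \<in> I1" "ge' t' = ge t" by blast
          obtain w where w: "w \<in> IZ" "t = gp w" using inter[OF t(1) t'] t(2) by auto
          have "val I1 x t = val I1 y t"
            using val_reindex[OF small(2,4) gp xy(1) w(1)] val_reindex[OF small(2,4) gp xy(2) w(1)]
              xy(3) w(2) by simp
          also have "val I1 y t = val IX y' (ge t)"
            using val_reindex[OF small(1,2) ge y'(1) t(1)] y'(2) by simp
          finally show ?thesis using bspec[OF z(2) funcset_mem[OF ge t(1)]] t dge by simp
        next
          case False
          then show ?thesis using bspec[OF z(2) funcset_mem[OF ge' t']] by simp
        qed
        then show "val I2 (ap ?e' z) t' = val I2 (ap ?e' y') t'"
          using val_reindex[OF small(1,3) ge' z(1) t'] val_reindex[OF small(1,3) ge' y'(1) t'] by simp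
      qed
      ultimately show ?thesis using glue[OF z(1)] glue[OF y'(1)] y'(2) by simp
    qed
    obtain h where h: "h \<in> hom VC (direct_power IZ) Z" "h \<odot>\<^bsub>VC\<^esub> ?p = a"
      by (rule VC_factor_surj[OF p p_surj a ker])
    have "h \<odot>\<^bsub>VC\<^esub> ?q = b"
      by (rule VC_surj_cancel[OF e' e'_surj VC_comp_hom[OF q h(1)] b])
         (simp add: comp_assoc[OF e' q h(1)] eq[symmetric] comp_assoc[OF e p h(1), symmetric] h(2) ab)
    moreover have "h' = h" if "h' \<in> hom VC (direct_power IZ) Z" "h' \<odot>\<^bsub>VC\<^esub> ?p = a" for h'
      using VC_surj_cancel[OF p p_surj that(1) h(1)] that(2) h(2) by simp
    ultimately show ?thesis using h by blast
  qed
  then show ?thesis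
    unfolding is_pushout_def
    using hom_Arr[OF e] hom_Arr[OF e'] p q eq VC_homD(4,5)[OF e] VC_homD(4,5)[OF e'] VC_homD(5)[OF p]
    by simp
qed

end

section \<open>From a noetherian form to a transfer functor\<close>

locale inducing_form = noetherian_form u C F + factorized_category u C E M
  for u :: "'u itself" and C :: "('o, 'm) category" (structure) and F :: "('o, 'm, 'u) form"
    and E M :: "'m set" +
  assumes quotients_eq: "quotients C F = E" and embeddings_eq: "embeddings C F = M"
begin

section \<open>Order calculus of clusters\<close>

abbreviation fibre :: "'o \<Rightarrow> 'u set" where
  "fibre X \<equiv> carrier (fib F X)"

lemma dir_in: "f \<in> hom C X Y \<Longrightarrow> S \<in> fibre X \<Longrightarrow> dir_img F f S \<in> fibre Y"
  using dir_closed by (rule funcset_mem)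

lemma inv_in: "f \<in> hom C X Y \<Longrightarrow> T \<in> fibre Y \<Longrightarrow> inv_img F f T \<in> fibre X"
  using inv_closed by (rule funcset_mem)

lemma fib_antisym:
  assumes "X \<in> Obj C" "S \<in> fibre X" "T \<in> fibre X" "S \<sqsubseteq>\<^bsub>fib F X\<^esub> T" "T \<sqsubseteq>\<^bsub>fib F X\<^esub> S"
  shows "S = T"
proof -
  interpret bounded_lattice "fib F X" by (rule fib_lattice[OF assms(1)])
  show ?thesis by (rule le_antisym[OF assms(4,5,2,3)])
qed

lemma fib_refl: "X \<in> Obj C \<Longrightarrow> S \<in> fibre X \<Longrightarrow> S \<sqsubseteq>\<^bsub>fib F X\<^esub> S"
proof -
  assume "X \<in> Obj C" "S \<in> fibre X"
  then interpret bounded_lattice "fib F X" using fib_lattice by blast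
  show ?thesis by (rule le_refl) fact
qed

lemma fib_trans:
  assumes "X \<in> Obj C" "R \<in> fibre X" "S \<in> fibre X" "T \<in> fibre X"
    "R \<sqsubseteq>\<^bsub>fib F X\<^esub> S" "S \<sqsubseteq>\<^bsub>fib F X\<^esub> T"
  shows "R \<sqsubseteq>\<^bsub>fib F X\<^esub> T"
proof -
  interpret bounded_lattice "fib F X" by (rule fib_lattice[OF assms(1)])
  show ?thesis by (rule le_trans[OF assms(5,6,2-4)])
qed

lemma fib_bounds:
  assumes "X \<in> Obj C"
  shows "\<top>\<^bsub>fib F X\<^esub> \<in> fibre X" "\<bottom>\<^bsub>fib F X\<^esub> \<in> fibre X"
    and "S \<in> fibre X \<Longrightarrow> S \<sqsubseteq>\<^bsub>fib F X\<^esub> \<top>\<^bsub>fib F X\<^esub>" "S \<in> fibre X \<Longrightarrow> \<bottom>\<^bsub>fib F X\<^esub> \<sqsubseteq>\<^bsub>fib F X\<^esub> S"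
proof -
  interpret bounded_lattice "fib F X" by (rule fib_lattice[OF assms])
  show "\<top>\<^bsub>fib F X\<^esub> \<in> fibre X" "\<bottom>\<^bsub>fib F X\<^esub> \<in> fibre X"
    "S \<in> fibre X \<Longrightarrow> S \<sqsubseteq>\<^bsub>fib F X\<^esub> \<top>\<^bsub>fib F X\<^esub>" "S \<in> fibre X \<Longrightarrow> \<bottom>\<^bsub>fib F X\<^esub> \<sqsubseteq>\<^bsub>fib F X\<^esub> S"
    by (rule top_closed, rule bottom_closed, erule top_higher, erule bottom_lower)
qed

lemma fib_meet:
  assumes "X \<in> Obj C" "S \<in> fibre X" "T \<in> fibre X"
  shows "S \<sqinter>\<^bsub>fib F X\<^esub> T \<in> fibre X" "S \<sqinter>\<^bsub>fib F X\<^esub> T \<sqsubseteq>\<^bsub>fib F X\<^esub> S" "S \<sqinter>\<^bsub>fib F X\<^esub> T \<sqsubseteq>\<^bsub>fib F X\<^esub> T"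
    and "R \<in> fibre X \<Longrightarrow> R \<sqsubseteq>\<^bsub>fib F X\<^esub> S \<Longrightarrow> R \<sqsubseteq>\<^bsub>fib F X\<^esub> T \<Longrightarrow> R \<sqsubseteq>\<^bsub>fib F X\<^esub> S \<sqinter>\<^bsub>fib F X\<^esub> T"
proof -
  interpret bounded_lattice "fib F X" by (rule fib_lattice[OF assms(1)])
  show "S \<sqinter>\<^bsub>fib F X\<^esub> T \<in> fibre X" "S \<sqinter>\<^bsub>fib F X\<^esub> T \<sqsubseteq>\<^bsub>fib F X\<^esub> S" "S \<sqinter>\<^bsub>fib F X\<^esub> T \<sqsubseteq>\<^bsub>fib F X\<^esub> T"
    using assms meet_closed meet_left meet_right by blast+
  show "R \<in> fibre X \<Longrightarrow> R \<sqsubseteq>\<^bsub>fib F X\<^esub> S \<Longrightarrow> R \<sqsubseteq>\<^bsub>fib F X\<^esub> T \<Longrightarrow> R \<sqsubseteq>\<^bsub>fib F X\<^esub> S \<sqinter>\<^bsub>fib F X\<^esub> T"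
    using assms meet_le by blast
qed

lemma fib_join:
  assumes "X \<in> Obj C" "S \<in> fibre X" "T \<in> fibre X"
  shows "S \<squnion>\<^bsub>fib F X\<^esub> T \<in> fibre X" "S \<sqsubseteq>\<^bsub>fib F X\<^esub> S \<squnion>\<^bsub>fib F X\<^esub> T" "T \<sqsubseteq>\<^bsub>fib F X\<^esub> S \<squnion>\<^bsub>fib F X\<^esub> T"
    and "R \<in> fibre X \<Longrightarrow> S \<sqsubseteq>\<^bsub>fib F X\<^esub> R \<Longrightarrow> T \<sqsubseteq>\<^bsub>fib F X\<^esub> R \<Longrightarrow> S \<squnion>\<^bsub>fib F X\<^esub> T \<sqsubseteq>\<^bsub>fib F X\<^esub> R"
proof -
  interpret bounded_lattice "fib F X" by (rule fib_lattice[OF assms(1)])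
  show "S \<squnion>\<^bsub>fib F X\<^esub> T \<in> fibre X" "S \<sqsubseteq>\<^bsub>fib F X\<^esub> S \<squnion>\<^bsub>fib F X\<^esub> T" "T \<sqsubseteq>\<^bsub>fib F X\<^esub> S \<squnion>\<^bsub>fib F X\<^esub> T"
    using assms join_closed join_left join_right by blast+
  show "R \<in> fibre X \<Longrightarrow> S \<sqsubseteq>\<^bsub>fib F X\<^esub> R \<Longrightarrow> T \<sqsubseteq>\<^bsub>fib F X\<^esub> R \<Longrightarrow> S \<squnion>\<^bsub>fib F X\<^esub> T \<sqsubseteq>\<^bsub>fib F X\<^esub> R"
    using assms join_le by blast
qed

lemma fib_join_absorb:
  assumes "X \<in> Obj C" "S \<in> fibre X" "T \<in> fibre X" "T \<sqsubseteq>\<^bsub>fib F X\<^esub> S"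
  shows "S \<squnion>\<^bsub>fib F X\<^esub> T = S"
  by (rule fib_antisym[OF assms(1) fib_join(1)[OF assms(1-3)] assms(2)
        fib_join(4)[OF assms(1-3) assms(2) fib_refl[OF assms(1,2)] assms(4)]
        fib_join(2)[OF assms(1-3)]])

lemma fib_meet_absorb:
  assumes "X \<in> Obj C" "S \<in> fibre X" "T \<in> fibre X" "S \<sqsubseteq>\<^bsub>fib F X\<^esub> T"
  shows "S \<sqinter>\<^bsub>fib F X\<^esub> T = S"
  by (rule fib_antisym[OF assms(1) fib_meet(1)[OF assms(1-3)] assms(2)
        fib_meet(2)[OF assms(1-3)]
        fib_meet(4)[OF assms(1-3) assms(2) fib_refl[OF assms(1,2)] assms(4)]])

lemma dir_le:
  assumes "f \<in> hom C X Y" "S \<in> fibre X" "T \<in> fibre X" "S \<sqsubseteq>\<^bsub>fib F X\<^esub> T"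
  shows "dir_img F f S \<sqsubseteq>\<^bsub>fib F Y\<^esub> dir_img F f T"
  using dir_mono[OF assms(1)] assms(2-) unfolding isotone_def by blast

lemma inv_le:
  assumes "f \<in> hom C X Y" "S \<in> fibre Y" "T \<in> fibre Y" "S \<sqsubseteq>\<^bsub>fib F Y\<^esub> T"
  shows "inv_img F f S \<sqsubseteq>\<^bsub>fib F X\<^esub> inv_img F f T"
  using inv_mono[OF assms(1)] assms(2-) unfolding isotone_def by blast

lemma unit_le:
  assumes f: "f \<in> hom C X Y" and S: "S \<in> fibre X"
  shows "S \<sqsubseteq>\<^bsub>fib F X\<^esub> inv_img F f (dir_img F f S)"
  using adjunction[OF f S dir_in[OF f S]] fib_refl[OF hom_objs(2)[OF f] dir_in[OF f S]] by blast

lemma counit_le: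
  assumes f: "f \<in> hom C X Y" and T: "T \<in> fibre Y"
  shows "dir_img F f (inv_img F f T) \<sqsubseteq>\<^bsub>fib F Y\<^esub> T"
  using adjunction[OF f inv_in[OF f T] T] fib_refl[OF hom_objs(1)[OF f] inv_in[OF f T]] by blast

lemma inv_dir_inv:
  assumes f: "f \<in> hom C X Y" and T: "T \<in> fibre Y"
  shows "inv_img F f (dir_img F f (inv_img F f T)) = inv_img F f T"
  by (rule fib_antisym[OF hom_objs(1)[OF f]])
     (use f T in \<open>auto intro: inv_in dir_in inv_le counit_le unit_le\<close>)

lemma Im_eq: "f \<in> hom C X Y \<Longrightarrow> Im C F f = dir_img F f \<top>\<^bsub>fib F X\<^esub>"
  by (simp add: Im_def homD)

lemma Ker_eq: "f \<in> hom C X Y \<Longrightarrow> Ker C F f = inv_img F f \<bottom>\<^bsub>fib F Y\<^esub>"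
  by (simp add: Ker_def homD)

lemma Im_in: "f \<in> hom C X Y \<Longrightarrow> Im C F f \<in> fibre Y"
  using dir_in fib_bounds(1) hom_objs by (simp add: Im_eq)

lemma Ker_in: "f \<in> hom C X Y \<Longrightarrow> Ker C F f \<in> fibre X"
  using inv_in fib_bounds(2) hom_objs by (simp add: Ker_eq)

lemma Im_comp_le:
  assumes f: "f \<in> hom C X Y" and g: "g \<in> hom C Y Z"
  shows "Im C F (g \<odot> f) \<sqsubseteq>\<^bsub>fib F Z\<^esub> Im C F g"
proof -
  have "Im C F (g \<odot> f) = dir_img F g (Im C F f)"
    using Im_eq[OF f] Im_eq[OF comp_hom[OF f g]] dir_comp[OF f g] fib_bounds(1) hom_objs(1)[OF f]
    by simp
  then show ?thesis
    using Im_in[OF f] fib_bounds[OF hom_objs(1)[OF g]] dir_le[OF g] Im_eq[OF g] by simp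
qed

lemma Ker_comp_ge:
  assumes f: "f \<in> hom C X Y" and g: "g \<in> hom C Y Z"
  shows "Ker C F f \<sqsubseteq>\<^bsub>fib F X\<^esub> Ker C F (g \<odot> f)"
proof -
  have "Ker C F (g \<odot> f) = inv_img F f (Ker C F g)"
    using Ker_eq[OF g] Ker_eq[OF comp_hom[OF f g]] inv_comp[OF f g] fib_bounds(2) hom_objs(2)[OF g]
    by simp
  then show ?thesis
    using Ker_in[OF g] fib_bounds[OF hom_objs(1)[OF g]] inv_le[OF f] Ker_eq[OF f] by simp
qed

lemma quotient_ofD:
  assumes "quotient_of C F X K e" "X \<in> Obj C"
  shows "e \<in> E" "e \<in> hom C X (Cod C e)" "Ker C F e = K"
  using assms by (auto simp: quotient_of_def quotients_eq[symmetric] quotients_def hom_def)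

lemma embedding_ofD:
  assumes "embedding_of C F Y S m" "Y \<in> Obj C"
  shows "m \<in> M" "m \<in> hom C (Dom C m) Y" "Im C F m = S"
  using assms by (auto simp: embedding_of_def embeddings_eq[symmetric] embeddings_def hom_def)

lemma quotient_factor:
  assumes "quotient_of C F X K e" "g \<in> hom C X Z" "K \<sqsubseteq>\<^bsub>fib F X\<^esub> Ker C F g"
  obtains h where "h \<in> hom C (Cod C e) Z" "g = h \<odot> e"
proof -
  have "\<exists>!h. h \<in> hom C (Cod C e) (Cod C g) \<and> g = h \<odot> e"
    using assms(1,3) homD[OF assms(2)] unfolding quotient_of_def by blast
  then show thesis using that homD(3)[OF assms(2)] by blast
qed

lemma embedding_factor:
  assumes "embedding_of C F Y S m" "f \<in> hom C Z Y" "Im C F f \<sqsubseteq>\<^bsub>fib F Y\<^esub> S"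
  obtains h where "h \<in> hom C Z (Dom C m)" "f = m \<odot> h"
proof -
  have "\<exists>!h. h \<in> hom C (Dom C f) (Dom C m) \<and> f = m \<odot> h"
    using assms(1,3) homD[OF assms(2)] unfolding embedding_of_def by blast
  then show thesis using that homD(2)[OF assms(2)] by blast
qed

section \<open>Arrows of the two classes as quotients and embeddings\<close>

lemma E_quotient:
  assumes "e \<in> E" "e \<in> hom C X Y"
  shows "quotient_of C F X (Ker C F e) e"
  using assms by (auto simp: quotients_eq[symmetric] quotients_def quotient_of_def hom_def)

lemma M_embedding:
  assumes "m \<in> M" "m \<in> hom C X Y"
  shows "embedding_of C F Y (Im C F m) m"
  using assms by (auto simp: embeddings_eq[symmetric] embeddings_def embedding_of_def hom_def)

lemma factor_normal:
  assumes f: "f \<in> hom C X Y"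
  obtains e m Z where "quotient_of C F X (Ker C F f) e" "embedding_of C F Y (Im C F f) m"
    "e \<in> hom C X Z" "m \<in> hom C Z Y" "e \<in> E" "m \<in> M" "f = m \<odot> e"
proof -
  obtain e m where em: "quotient_of C F X (Ker C F f) e" "embedding_of C F Y (Im C F f) m"
    "Cod C e = Dom C m" "f = m \<odot> e"
    using N2[OF f] by blast
  show thesis
    using that[OF em(1,2)] quotient_ofD[OF em(1) hom_objs(1)[OF f]]
      embedding_ofD[OF em(2) hom_objs(2)[OF f]] em(3,4) by simp
qed

text \<open>By (N1) it suffices that the image of \<open>e\<close> is the top. In the factorization
  \<open>e = m e'\<close> from (N2), \<open>e'\<close> has the kernel of \<open>e\<close>, so it
  factors as \<open>h e\<close>; cancelling \<open>e\<close> gives \<open>m h = Idt C Y\<close>,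
  hence the image of \<open>m\<close>, which is that of \<open>e\<close>, is everything.\<close>

lemma E_dir_inv:
  assumes e: "e \<in> E" "e \<in> hom C X Y" and T: "T \<in> fibre Y"
  shows "dir_img F e (inv_img F e T) = T"
proof -
  have Y: "Y \<in> Obj C" by (rule hom_objs(2)[OF e(2)])
  obtain e' m Z where em: "quotient_of C F X (Ker C F e) e'" "embedding_of C F Y (Im C F e) m"
    "e' \<in> hom C X Z" "m \<in> hom C Z Y" "e = m \<odot> e'"
    using factor_normal[OF e(2)] by metis
  have "Ker C F e' = Ker C F e" using quotient_ofD[OF em(1) hom_objs(1)[OF e(2)]] by simp
  then obtain h where h: "h \<in> hom C Y Z" "e' = h \<odot> e"
    using quotient_factor[OF E_quotient[OF e] em(3)] homD(3)[OF e(2)]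
      fib_refl[OF hom_objs(1)[OF e(2)] Ker_in[OF e(2)]] by metis
  have "m \<odot> h = Idt C Y"
    by (rule E_cancel[OF e comp_hom[OF h(1) em(4)] idt_hom[OF Y]])
       (simp only: comp_assoc[OF e(2) h(1) em(4)] h(2)[symmetric] em(5)[symmetric] idt_comp[OF e(2)])
  then have "\<top>\<^bsub>fib F Y\<^esub> = dir_img F m (dir_img F h \<top>\<^bsub>fib F Y\<^esub>)"
    using dir_comp[OF h(1) em(4) fib_bounds(1)[OF Y]] dir_idt[OF Y fib_bounds(1)[OF Y]] by simp
  also have "\<dots> \<sqsubseteq>\<^bsub>fib F Y\<^esub> Im C F m"
    unfolding Im_eq[OF em(4)]
    by (rule dir_le[OF em(4)]) (use dir_in[OF h(1) fib_bounds(1)[OF Y]]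
        fib_bounds[OF hom_objs(2)[OF h(1)]] in auto)
  finally have "\<top>\<^bsub>fib F Y\<^esub> \<sqsubseteq>\<^bsub>fib F Y\<^esub> Im C F e"
    using embedding_ofD(3)[OF em(2) Y] by simp
  then have "Im C F e = \<top>\<^bsub>fib F Y\<^esub>"
    using fib_antisym[OF Y Im_in[OF e(2)] fib_bounds(1)[OF Y]] fib_bounds(3)[OF Y Im_in[OF e(2)]]
    by blast
  then show ?thesis
    using N1_dir_inv[OF e(2) T] fib_meet_absorb[OF Y T fib_bounds(1)[OF Y] fib_bounds(3)[OF Y T]]
    by simp
qed

text \<open>By (N1) it suffices that the kernel of \<open>m\<close> is the bottom. In
  \<open>m = m' e\<close> from (N2), \<open>m'\<close> has the image of \<open>m\<close>, so
  \<open>m' = m h\<close>, and cancelling \<open>m\<close> gives \<open>h e = Idt C X\<close>; thus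
  \<open>e\<close> is a split monomorphism with bottom kernel, and its kernel is that of
  \<open>m\<close>.\<close>

lemma M_inv_dir:
  assumes m: "m \<in> M" "m \<in> hom C X Y" and S: "S \<in> fibre X"
  shows "inv_img F m (dir_img F m S) = S"
proof -
  have X: "X \<in> Obj C" by (rule hom_objs(1)[OF m(2)])
  obtain e m' Z where em: "quotient_of C F X (Ker C F m) e" "embedding_of C F Y (Im C F m) m'"
    "e \<in> hom C X Z" "m' \<in> hom C Z Y" "m = m' \<odot> e"
    using factor_normal[OF m(2)] by metis
  have "Im C F m' = Im C F m" using embedding_ofD[OF em(2) hom_objs(2)[OF m(2)]] by simp
  then obtain h where h: "h \<in> hom C Z X" "m' = m \<odot> h"
    using embedding_factor[OF M_embedding[OF m] em(4)] homD(2)[OF m(2)]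
      fib_refl[OF hom_objs(2)[OF m(2)] Im_in[OF m(2)]] by metis
  have he: "h \<odot> e = Idt C X"
    by (rule M_cancel[OF m comp_hom[OF em(3) h(1)] idt_hom[OF X]])
       (simp only: comp_assoc[OF em(3) h(1) m(2), symmetric] h(2)[symmetric] em(5)[symmetric] comp_idt[OF m(2)])
  have bZ: "\<bottom>\<^bsub>fib F Z\<^esub> \<in> fibre Z" using fib_bounds(2) hom_objs(1)[OF h(1)] by blast
  have bX: "\<bottom>\<^bsub>fib F X\<^esub> \<in> fibre X" using fib_bounds(2) X by blast
  have "Ker C F m = Ker C F e" using quotient_ofD(3)[OF em(1) X] by simp
  also have "\<dots> \<sqsubseteq>\<^bsub>fib F X\<^esub> inv_img F e (inv_img F h \<bottom>\<^bsub>fib F X\<^esub>)"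
    unfolding Ker_eq[OF em(3)]
    by (rule inv_le[OF em(3) bZ]) (use inv_in[OF h(1) bX] fib_bounds(4)[OF hom_objs(1)[OF h(1)]] in auto)
  also have "inv_img F e (inv_img F h \<bottom>\<^bsub>fib F X\<^esub>) = \<bottom>\<^bsub>fib F X\<^esub>"
    using inv_comp[OF em(3) h(1) bX] inv_idt[OF X bX] he by simp
  finally have "Ker C F m \<sqsubseteq>\<^bsub>fib F X\<^esub> S"
    using fib_bounds(4)[OF X S] fib_trans[OF X Ker_in[OF m(2)] bX S] by blast
  then show ?thesis
    using N1_inv_dir[OF m(2) S] fib_join_absorb[OF X S Ker_in[OF m(2)]] by simp
qed

text \<open>Surjectivity of the inverse image map brings the kernel down to the bottom, so the
  identity of \<open>X\<close> factors through the quotient \<open>e\<close>. Injectivity forces the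
  image up to the top, since the image and the top have the same inverse image, so the identity of
  \<open>Y\<close> factors through the embedding \<open>m\<close>. Thus both factors of
  \<open>f\<close> are invertible.\<close>

lemma iso_if_bij_inv:
  assumes f: "f \<in> hom C X Y" and bij: "bij_betw (inv_img F f) (fibre Y) (fibre X)"
  shows "is_iso C f"
proof -
  have X: "X \<in> Obj C" and Y: "Y \<in> Obj C" using hom_objs[OF f] by auto
  obtain e m Z where em: "quotient_of C F X (Ker C F f) e" "embedding_of C F Y (Im C F f) m"
    "e \<in> hom C X Z" "m \<in> hom C Z Y" "e \<in> E" "m \<in> M" "f = m \<odot> e"
    using factor_normal[OF f] by metis
  have bX: "\<bottom>\<^bsub>fib F X\<^esub> \<in> fibre X" and bY: "\<bottom>\<^bsub>fib F Y\<^esub> \<in> fibre Y"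
    and tX: "\<top>\<^bsub>fib F X\<^esub> \<in> fibre X" and tY: "\<top>\<^bsub>fib F Y\<^esub> \<in> fibre Y"
    using fib_bounds X Y by auto
  obtain T where T: "T \<in> fibre Y" "inv_img F f T = \<bottom>\<^bsub>fib F X\<^esub>"
    using bij bX unfolding bij_betw_def by (metis imageE)
  have "Ker C F f \<sqsubseteq>\<^bsub>fib F X\<^esub> \<bottom>\<^bsub>fib F X\<^esub>"
    using inv_le[OF f bY T(1) fib_bounds(4)[OF Y T(1)]] T(2) Ker_eq[OF f] by simp
  then have "Ker C F f \<sqsubseteq>\<^bsub>fib F X\<^esub> Ker C F (Idt C X)"
    using fib_trans[OF X Ker_in[OF f] bX Ker_in[OF idt_hom[OF X]]]
      fib_bounds(4)[OF X Ker_in[OF idt_hom[OF X]]] by blast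
  then obtain h where h: "h \<in> hom C Z X" "Idt C X = h \<odot> e"
    using quotient_factor[OF em(1) idt_hom[OF X]] homD(3)[OF em(3)] by metis
  have eh: "e \<odot> h = Idt C Z"
    by (rule E_cancel[OF em(5,3) comp_hom[OF h(1) em(3)] idt_hom[OF hom_objs(2)[OF em(3)]]])
       (simp only: comp_assoc[OF em(3) h(1) em(3)] h(2)[symmetric] idt_comp[OF em(3)] comp_idt[OF em(3)])
  have "\<top>\<^bsub>fib F X\<^esub> \<sqsubseteq>\<^bsub>fib F X\<^esub> inv_img F f (Im C F f)"
    unfolding Im_eq[OF f] by (rule unit_le[OF f tX])
  then have "inv_img F f (Im C F f) = inv_img F f \<top>\<^bsub>fib F Y\<^esub>"
    using inv_le[OF f Im_in[OF f] tY fib_bounds(3)[OF Y Im_in[OF f]]]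
      fib_bounds(3)[OF X inv_in[OF f tY]] inv_in[OF f tY] inv_in[OF f Im_in[OF f]] tX
    by (metis X fib_antisym fib_trans)
  then have "Im C F f = \<top>\<^bsub>fib F Y\<^esub>"
    using bij Im_in[OF f] tY unfolding bij_betw_def by (meson inj_onD)
  then have "Im C F (Idt C Y) \<sqsubseteq>\<^bsub>fib F Y\<^esub> Im C F f"
    using fib_bounds(3)[OF Y Im_in[OF idt_hom[OF Y]]] by simp
  then obtain k where k: "k \<in> hom C Y Z" "Idt C Y = m \<odot> k"
    using embedding_factor[OF em(2) idt_hom[OF Y]] homD(2)[OF em(4)] by metis
  have km: "k \<odot> m = Idt C Z"
    by (rule M_cancel[OF em(6,4) comp_hom[OF em(4) k(1)] idt_hom[OF hom_objs(1)[OF em(4)]]])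
       (simp only: comp_assoc[OF em(4) k(1) em(4), symmetric] k(2)[symmetric] idt_comp[OF em(4)] comp_idt[OF em(4)])
  have hk: "h \<odot> k \<in> hom C Y X" by (rule comp_hom[OF k(1) h(1)])
  have "(h \<odot> k) \<odot> f = h \<odot> ((k \<odot> m) \<odot> e)"
    using comp_assoc[OF f k(1) h(1)] comp_assoc[OF em(3,4) k(1)] em(7) by simp
  then have "(h \<odot> k) \<odot> f = Idt C X" using km idt_comp[OF em(3)] h(2) by simp
  moreover have "f \<odot> (h \<odot> k) = m \<odot> ((e \<odot> h) \<odot> k)"
    using comp_assoc[OF hk em(3,4)] comp_assoc[OF k(1) h(1) em(3)] em(7) by simp
  then have "f \<odot> (h \<odot> k) = Idt C Y" using eh idt_comp[OF k(1)] k(2) by simp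
  ultimately show ?thesis
    unfolding is_iso_def homD[OF f] using homD(1)[OF f] hk by blast
qed

text \<open>By (N3) the meet of the two images has an embedding \<open>n\<close>. The universal
  properties give \<open>h\<close> from its domain to the pullback and \<open>k\<close> back, with
  \<open>h k = Idt C P\<close>. Since \<open>n = m p h\<close>, the image of \<open>m p\<close> is
  at least the meet. Both \<open>k\<close>, being split, and \<open>n\<close>, being an embedding,
  have surjective inverse image maps, hence so has \<open>m p = n k\<close>, and therefore
  \<open>p\<close>.\<close>

lemma pullback_inv_surj:
  assumes pb: "is_pullback C m m' p q" and mM: "m \<in> M" "m' \<in> M"
    and hom: "m \<in> hom C A Y" "m' \<in> hom C A' Y" "p \<in> hom C P A" "q \<in> hom C P A'"
  shows "Im C F m \<sqinter>\<^bsub>fib F Y\<^esub> Im C F m' \<sqsubseteq>\<^bsub>fib F Y\<^esub> Im C F (m \<odot> p)"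
    and "\<And>S. S \<in> fibre P \<Longrightarrow> inv_img F p (dir_img F p S) = S"
proof -
  note m = hom(1) and m' = hom(2) and p = hom(3) and q = hom(4)
  let ?I = "Im C F m \<sqinter>\<^bsub>fib F Y\<^esub> Im C F m'"
  have Y: "Y \<in> Obj C" by (rule hom_objs(2)[OF m])
  note meet = fib_meet[OF Y Im_in[OF m] Im_in[OF m']]
  have "conormal C F Y ?I"
    by (rule N3_conormal[OF Y]) (use homD(1,3)[OF m] homD(1,3)[OF m'] in \<open>auto simp: conormal_def\<close>)
  then obtain f where f: "f \<in> hom C (Dom C f) Y" "Im C F f = ?I"
    unfolding conormal_def by (auto simp: hom_def)
  obtain n N where n: "embedding_of C F Y ?I n" "n \<in> hom C N Y" "n \<in> M"
    using factor_normal[OF f(1)] f(2) by metis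
  have Im_n: "Im C F n = ?I" using embedding_ofD(3)[OF n(1) Y] .
  obtain a where a: "a \<in> hom C N A" "n = m \<odot> a"
    using embedding_factor[OF M_embedding[OF mM(1) m] n(2)] Im_n meet homD(2)[OF m] by metis
  obtain b where b: "b \<in> hom C N A'" "n = m' \<odot> b"
    using embedding_factor[OF M_embedding[OF mM(2) m'] n(2)] Im_n meet homD(2)[OF m'] by metis
  note dom = homD(2)[OF m] homD(2)[OF m'] homD(2)[OF p]
  have eq: "m \<odot> p = m' \<odot> q" using pb unfolding is_pullback_def by blast
  have univ: "\<exists>!h. h \<in> hom C Z P \<and> p \<odot> h = a \<and> q \<odot> h = b"
    if "a \<in> hom C Z A" "b \<in> hom C Z A'" "m \<odot> a = m' \<odot> b" for Z a b
    using pb that unfolding is_pullback_def dom by blast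
  have "\<exists>!h. h \<in> hom C N P \<and> p \<odot> h = a \<and> q \<odot> h = b"
    by (rule univ[OF a(1) b(1)]) (use a(2) b(2) in simp)
  then obtain h where h: "h \<in> hom C N P" "p \<odot> h = a" "q \<odot> h = b" by blast
  have mp: "m \<odot> p \<in> hom C P Y" by (rule comp_hom[OF p m])
  have nh: "n = (m \<odot> p) \<odot> h" using comp_assoc[OF h(1) p m] h(2) a(2) by simp
  show "?I \<sqsubseteq>\<^bsub>fib F Y\<^esub> Im C F (m \<odot> p)"
    using Im_comp_le[OF h(1) mp] nh Im_n by simp
  have "Im C F (m \<odot> p) \<sqsubseteq>\<^bsub>fib F Y\<^esub> ?I"
    using meet(4)[OF Im_in[OF mp]] Im_comp_le[OF p m] Im_comp_le[OF q m'] eq by simp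
  then obtain k where k: "k \<in> hom C P N" "m \<odot> p = n \<odot> k"
    using embedding_factor[OF n(1) mp] homD(2)[OF n(2)] by metis
  have hk: "h \<odot> k \<in> hom C P P" by (rule comp_hom[OF k(1) h(1)])
  have "p \<odot> (h \<odot> k) = p"
  proof (rule M_cancel[OF mM(1) m comp_hom[OF hk p] p])
    have "m \<odot> (p \<odot> (h \<odot> k)) = ((m \<odot> p) \<odot> h) \<odot> k"
      using comp_assoc[OF hk p m] comp_assoc[OF k(1) h(1) mp] by simp
    then show "m \<odot> (p \<odot> (h \<odot> k)) = m \<odot> p" by (simp only: nh[symmetric] k(2)[symmetric])
  qed
  moreover have "q \<odot> (h \<odot> k) = q"
  proof (rule M_cancel[OF mM(2) m' comp_hom[OF hk q] q])
    have "m' \<odot> (q \<odot> (h \<odot> k)) = ((m' \<odot> q) \<odot> h) \<odot> k"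
      using comp_assoc[OF hk q m'] comp_assoc[OF k(1) h(1) comp_hom[OF q m']] by simp
    then show "m' \<odot> (q \<odot> (h \<odot> k)) = m' \<odot> q" by (simp only: eq[symmetric] nh[symmetric] k(2)[symmetric])
  qed
  moreover have P: "P \<in> Obj C" by (rule hom_objs(1)[OF p])
  ultimately have hk_id: "h \<odot> k = Idt C P"
    using univ[OF p q eq] hk idt_hom[OF P] comp_idt[OF p] comp_idt[OF q] by blast
  fix S assume S: "S \<in> fibre P"
  let ?S = "inv_img F h S"
  have hS: "?S \<in> fibre N" by (rule inv_in[OF h(1) S])
  have "S = inv_img F k ?S"
    using inv_comp[OF k(1) h(1) S] hk_id inv_idt[OF P S] by simp
  also have "\<dots> = inv_img F k (inv_img F n (dir_img F n ?S))"
    using M_inv_dir[OF n(3,2) hS] by simp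
  also have "\<dots> = inv_img F p (inv_img F m (dir_img F n ?S))"
    using inv_comp[OF k(1) n(2) dir_in[OF n(2) hS]] k(2) inv_comp[OF p m dir_in[OF n(2) hS]] by simp
  finally have "S = inv_img F p (inv_img F m (dir_img F n ?S))" .
  then show "inv_img F p (dir_img F p S) = S"
    using inv_dir_inv[OF p inv_in[OF m dir_in[OF n(2) hS]]] by metis
qed

lemma pullback_commute: "is_pullback C f g p q \<Longrightarrow> is_pullback C g f q p"
  unfolding is_pullback_def by (auto simp: hom_def) (metis (no_types, lifting))+

text \<open>The inverse image of \<open>dir_img F m S\<close> along \<open>m p\<close> is that of
  \<open>S\<close> along \<open>p\<close>, so the left side is what (N1) for \<open>m p\<close>
  turns into a meet with the image of \<open>m p\<close>. Below the image of \<open>m\<close> this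
  is the same as a meet with the image of \<open>m'\<close>.\<close>

lemma pullback_dir_inv:
  assumes pb: "is_pullback C m m' p q" and mM: "m \<in> M" "m' \<in> M"
    and hom: "m \<in> hom C A Y" "m' \<in> hom C A' Y" "p \<in> hom C P A" "q \<in> hom C P A'"
    and S: "S \<in> fibre A"
  shows "dir_img F m (dir_img F p (inv_img F p S)) = dir_img F m S \<sqinter>\<^bsub>fib F Y\<^esub> Im C F m'"
proof -
  note m = hom(1) and m' = hom(2) and p = hom(3) and q = hom(4)
  have eq: "m \<odot> p = m' \<odot> q" using pb unfolding is_pullback_def by blast
  have Y: "Y \<in> Obj C" by (rule hom_objs(2)[OF m])
  let ?c = "m \<odot> p" and ?V = "dir_img F m S"
  have c: "?c \<in> hom C P Y" by (rule comp_hom[OF p m])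
  have V: "?V \<in> fibre Y" by (rule dir_in[OF m S])
  have "inv_img F ?c ?V = inv_img F p S"
    using inv_comp[OF p m V] M_inv_dir[OF mM(1) m S] by simp
  then have "dir_img F m (dir_img F p (inv_img F p S)) = ?V \<sqinter>\<^bsub>fib F Y\<^esub> Im C F ?c"
    using N1_dir_inv[OF c V] dir_comp[OF p m inv_in[OF p S]] by simp
  also have "\<dots> = ?V \<sqinter>\<^bsub>fib F Y\<^esub> Im C F m'"
  proof (rule fib_antisym[OF Y])
    note meet_c = fib_meet[OF Y V Im_in[OF c]] and meet = fib_meet[OF Y V Im_in[OF m']]
    show "?V \<sqinter>\<^bsub>fib F Y\<^esub> Im C F ?c \<in> fibre Y" "?V \<sqinter>\<^bsub>fib F Y\<^esub> Im C F m' \<in> fibre Y"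
      by (fact meet_c(1) meet(1))+
    have "Im C F ?c \<sqsubseteq>\<^bsub>fib F Y\<^esub> Im C F m'" using Im_comp_le[OF q m'] eq by simp
    then show "?V \<sqinter>\<^bsub>fib F Y\<^esub> Im C F ?c \<sqsubseteq>\<^bsub>fib F Y\<^esub> ?V \<sqinter>\<^bsub>fib F Y\<^esub> Im C F m'"
      using meet(4)[OF meet_c(1,2)] fib_trans[OF Y meet_c(1) Im_in[OF c] Im_in[OF m'] meet_c(3)]
      by blast
    have "?V \<sqsubseteq>\<^bsub>fib F Y\<^esub> Im C F m"
      unfolding Im_eq[OF m] using fib_bounds[OF hom_objs(1)[OF m]] S by (intro dir_le[OF m]) auto
    then have "?V \<sqinter>\<^bsub>fib F Y\<^esub> Im C F m' \<sqsubseteq>\<^bsub>fib F Y\<^esub> Im C F m"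
      using fib_trans[OF Y meet(1) V Im_in[OF m] meet(2)] by blast
    then have "?V \<sqinter>\<^bsub>fib F Y\<^esub> Im C F m' \<sqsubseteq>\<^bsub>fib F Y\<^esub> Im C F m \<sqinter>\<^bsub>fib F Y\<^esub> Im C F m'"
      using fib_meet(4)[OF Y Im_in[OF m] Im_in[OF m'] meet(1)] meet(3) by blast
    then have "?V \<sqinter>\<^bsub>fib F Y\<^esub> Im C F m' \<sqsubseteq>\<^bsub>fib F Y\<^esub> Im C F ?c"
      using fib_trans[OF Y meet(1) fib_meet(1)[OF Y Im_in[OF m] Im_in[OF m']] Im_in[OF c]]
        pullback_inv_surj(1)[OF pb mM hom] by blast
    then show "?V \<sqinter>\<^bsub>fib F Y\<^esub> Im C F m' \<sqsubseteq>\<^bsub>fib F Y\<^esub> ?V \<sqinter>\<^bsub>fib F Y\<^esub> Im C F ?c"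
      using meet_c(4)[OF meet(1,2)] by blast
  qed
  finally show ?thesis .
qed

text \<open>Supplies \<open>zigA\<close> and \<open>zigB\<close> for the powers. Here
  \<open>v\<close> is the direct image of \<open>S\<close> and \<open>w\<close> its meet with the
  image of \<open>m'\<close>; by (N1) \<open>w\<close> is also the direct image along
  \<open>m'\<close> of the inverse image of \<open>v\<close>, so the inverse image along
  \<open>m'\<close> does not distinguish \<open>v\<close> from \<open>w\<close>.\<close>

lemma pullback_zigzag:
  assumes pb: "is_pullback C m m' p q" and mM: "m \<in> M" "m' \<in> M"
    and hom: "m \<in> hom C A Y" "m' \<in> hom C A' Y" "p \<in> hom C P A" "q \<in> hom C P A'"
    and S: "S \<in> fibre A"
  shows "\<exists>v\<in>fibre Y. \<exists>w\<in>fibre Y. inv_img F m v = S \<and> inv_img F m' v = inv_img F m' w \<and>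
           inv_img F m w = dir_img F p (inv_img F p S)"
proof -
  note m = hom(1) and m' = hom(2) and p = hom(3) and q = hom(4)
  let ?v = "dir_img F m S" and ?w = "dir_img F m (dir_img F p (inv_img F p S))"
  have v: "?v \<in> fibre Y" by (rule dir_in[OF m S])
  have pS: "dir_img F p (inv_img F p S) \<in> fibre A" by (rule dir_in[OF p inv_in[OF p S]])
  have "?w = dir_img F m' (inv_img F m' ?v)"
    using pullback_dir_inv[OF assms] N1_dir_inv[OF m' v] by simp
  then have "inv_img F m' ?v = inv_img F m' ?w"
    using inv_dir_inv[OF m' v] by simp
  then show ?thesis
    using v dir_in[OF m pS] M_inv_dir[OF mM(1) m S] M_inv_dir[OF mM(1) m pS] by blast
qed

text \<open>Dual use of (N3): the join of the kernels has a quotient \<open>d\<close>, with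
  comparison arrows satisfying \<open>k h = Idt C Z\<close>. From \<open>p e = k d\<close> and
  \<open>E_dir_inv\<close> for \<open>d\<close>, the inverse image along \<open>p\<close> determines
  the one along \<open>k\<close>, which is injective because \<open>k\<close> is split. So
  \<open>W\<close> and the direct image of its inverse image coincide once their inverse images
  along \<open>p\<close> do.\<close>

lemma pushout_dir_inj:
  assumes po: "is_pushout C e e' p q" and eE: "e \<in> E" "e' \<in> E"
    and hom: "e \<in> hom C X Y" "e' \<in> hom C X Y'" "p \<in> hom C Y Z" "q \<in> hom C Y' Z"
  shows "Ker C F (p \<odot> e) \<sqsubseteq>\<^bsub>fib F X\<^esub> Ker C F e \<squnion>\<^bsub>fib F X\<^esub> Ker C F e'"
    and "\<And>W. W \<in> fibre Z \<Longrightarrow> dir_img F p (inv_img F p W) = W"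
proof -
  note e = hom(1) and e' = hom(2) and p = hom(3) and q = hom(4)
  let ?K = "Ker C F e \<squnion>\<^bsub>fib F X\<^esub> Ker C F e'"
  have X: "X \<in> Obj C" by (rule hom_objs(1)[OF e])
  note join = fib_join[OF X Ker_in[OF e] Ker_in[OF e']]
  have "normal C F X ?K"
    by (rule N3_normal[OF X]) (use homD(1,2)[OF e] homD(1,2)[OF e'] in \<open>auto simp: normal_def\<close>)
  then obtain f where f: "f \<in> hom C X (Cod C f)" "Ker C F f = ?K"
    unfolding normal_def by (auto simp: hom_def)
  obtain d D where d: "quotient_of C F X ?K d" "d \<in> hom C X D" "d \<in> E"
    using factor_normal[OF f(1)] f(2) by metis
  have Ker_d: "Ker C F d = ?K" using quotient_ofD(3)[OF d(1) X] .
  obtain a where a: "a \<in> hom C Y D" "d = a \<odot> e"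
    using quotient_factor[OF E_quotient[OF eE(1) e] d(2)] Ker_d join homD(3)[OF e] by metis
  obtain b where b: "b \<in> hom C Y' D" "d = b \<odot> e'"
    using quotient_factor[OF E_quotient[OF eE(2) e'] d(2)] Ker_d join homD(3)[OF e'] by metis
  note cod = homD(3)[OF e] homD(3)[OF e'] homD(3)[OF p]
  have eq: "p \<odot> e = q \<odot> e'" using po unfolding is_pushout_def by blast
  have univ: "\<exists>!h. h \<in> hom C Z V \<and> h \<odot> p = a \<and> h \<odot> q = b"
    if "a \<in> hom C Y V" "b \<in> hom C Y' V" "a \<odot> e = b \<odot> e'" for V a b
    using po that unfolding is_pushout_def cod by blast
  have "\<exists>!h. h \<in> hom C Z D \<and> h \<odot> p = a \<and> h \<odot> q = b"
    by (rule univ[OF a(1) b(1)]) (use a(2) b(2) in simp)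
  then obtain h where h: "h \<in> hom C Z D" "h \<odot> p = a" "h \<odot> q = b" by blast
  have pe: "p \<odot> e \<in> hom C X Z" by (rule comp_hom[OF e p])
  have dh: "d = h \<odot> (p \<odot> e)" using comp_assoc[OF e p h(1)] h(2) a(2) by simp
  show "Ker C F (p \<odot> e) \<sqsubseteq>\<^bsub>fib F X\<^esub> ?K"
    using Ker_comp_ge[OF pe h(1)] dh Ker_d by simp
  have "?K \<sqsubseteq>\<^bsub>fib F X\<^esub> Ker C F (p \<odot> e)"
    using join(4)[OF Ker_in[OF pe]] Ker_comp_ge[OF e p] Ker_comp_ge[OF e' q] eq by simp
  then obtain k where k: "k \<in> hom C D Z" "p \<odot> e = k \<odot> d"
    using quotient_factor[OF d(1) pe] homD(3)[OF d(2)] by metis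
  have kh: "k \<odot> h \<in> hom C Z Z" by (rule comp_hom[OF h(1) k(1)])
  have "(k \<odot> h) \<odot> p = p"
  proof (rule E_cancel[OF eE(1) e comp_hom[OF p kh] p])
    have "((k \<odot> h) \<odot> p) \<odot> e = k \<odot> (h \<odot> (p \<odot> e))"
      using comp_assoc[OF e p kh] comp_assoc[OF pe h(1) k(1)] by simp
    then show "((k \<odot> h) \<odot> p) \<odot> e = p \<odot> e" by (simp only: dh[symmetric] k(2)[symmetric])
  qed
  moreover have "(k \<odot> h) \<odot> q = q"
  proof (rule E_cancel[OF eE(2) e' comp_hom[OF q kh] q])
    have "((k \<odot> h) \<odot> q) \<odot> e' = k \<odot> (h \<odot> (q \<odot> e'))"
      using comp_assoc[OF e' q kh] comp_assoc[OF comp_hom[OF e' q] h(1) k(1)] by simp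
    then show "((k \<odot> h) \<odot> q) \<odot> e' = q \<odot> e'" by (simp only: eq[symmetric] dh[symmetric] k(2)[symmetric])
  qed
  moreover have Z: "Z \<in> Obj C" by (rule hom_objs(2)[OF p])
  ultimately have kh_id: "k \<odot> h = Idt C Z"
    using univ[OF p q eq] kh idt_hom[OF Z] idt_comp[OF p] idt_comp[OF q] by blast
  fix W assume W: "W \<in> fibre Z"
  let ?W = "dir_img F p (inv_img F p W)"
  have W': "?W \<in> fibre Z" by (rule dir_in[OF p inv_in[OF p W]])
  have kW: "inv_img F k W = inv_img F k ?W"
  proof -
    have *: "dir_img F d (inv_img F e (inv_img F p U)) = inv_img F k U" if "U \<in> fibre Z" for U
      using inv_comp[OF e p that] inv_comp[OF d(2) k(1) that] k(2)
        E_dir_inv[OF d(3,2) inv_in[OF k(1) that]] by simp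
    have "inv_img F p ?W = inv_img F p W" by (rule inv_dir_inv[OF p W])
    then show ?thesis using *[OF W] *[OF W'] by simp
  qed
  have **: "inv_img F h (inv_img F k U) = U" if "U \<in> fibre Z" for U
    using inv_comp[OF h(1) k(1) that] kh_id inv_idt[OF Z that] by simp
  have "?W = inv_img F h (inv_img F k ?W)" by (rule **[OF W', symmetric])
  also have "\<dots> = inv_img F h (inv_img F k W)" by (rule arg_cong[OF kW[symmetric]])
  also have "\<dots> = W" by (rule **[OF W])
  finally show "?W = W" .
qed

text \<open>The common inverse image contains both kernels, hence the kernel of \<open>p e\<close>,
  so (N1) presents it as an inverse image along \<open>p e\<close>; the inverse image along
  \<open>e\<close> is injective and can be cancelled. This is the intersection property
  \<open>inter\<close> behind the pushout of powers.\<close>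

lemma pushout_inter:
  assumes po: "is_pushout C e e' p q" and eE: "e \<in> E" "e' \<in> E"
    and hom: "e \<in> hom C X Y" "e' \<in> hom C X Y'" "p \<in> hom C Y Z" "q \<in> hom C Y' Z"
    and T: "T \<in> fibre Y" "T' \<in> fibre Y'" "inv_img F e T = inv_img F e' T'"
  shows "\<exists>W\<in>fibre Z. T = inv_img F p W"
proof -
  note e = hom(1) and e' = hom(2) and p = hom(3) and q = hom(4)
  have X: "X \<in> Obj C" by (rule hom_objs(1)[OF e])
  let ?S = "inv_img F e T" and ?c = "p \<odot> e"
  have c: "?c \<in> hom C X Z" by (rule comp_hom[OF e p])
  have S: "?S \<in> fibre X" by (rule inv_in[OF e T(1)])
  have "Ker C F e \<sqsubseteq>\<^bsub>fib F X\<^esub> ?S"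
    unfolding Ker_eq[OF e] using fib_bounds[OF hom_objs(2)[OF e]] T(1) by (intro inv_le[OF e]) auto
  moreover have "Ker C F e' \<sqsubseteq>\<^bsub>fib F X\<^esub> ?S"
    unfolding Ker_eq[OF e'] T(3) using fib_bounds[OF hom_objs(2)[OF e']] T(2)
    by (intro inv_le[OF e']) auto
  ultimately have "Ker C F e \<squnion>\<^bsub>fib F X\<^esub> Ker C F e' \<sqsubseteq>\<^bsub>fib F X\<^esub> ?S"
    by (rule fib_join(4)[OF X Ker_in[OF e] Ker_in[OF e'] S])
  then have "Ker C F ?c \<sqsubseteq>\<^bsub>fib F X\<^esub> ?S"
    using fib_trans[OF X Ker_in[OF c] fib_join(1)[OF X Ker_in[OF e] Ker_in[OF e']] S]
      pushout_dir_inj(1)[OF po eE hom] by blast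
  then have "inv_img F ?c (dir_img F ?c ?S) = ?S"
    using N1_inv_dir[OF c S] fib_join_absorb[OF X S Ker_in[OF c]] by simp
  then have "inv_img F e (inv_img F p (dir_img F ?c ?S)) = inv_img F e T"
    using inv_comp[OF e p dir_in[OF c S]] by simp
  then have "inv_img F p (dir_img F ?c ?S) = T"
    using E_dir_inv[OF eE(1) e inv_in[OF p dir_in[OF c S]]] E_dir_inv[OF eE(1) e T(1)] by simp
  then show ?thesis
    using dir_in[OF c S] by (intro bexI[of _ "dir_img F ?c ?S"]) simp_all
qed

end

lemma transfer_functor_of_form:
  fixes C :: "('o, 'm) category" and F :: "('o, 'm, 'u) form" and A :: "('f, 'u) algebra"
  assumes "power_algebra Sg Eqs A" "inducing_form TYPE('u) C F E M"
    and c: "c \<in> carrier A" "d \<in> carrier A" "c \<noteq> d"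
  defines "Ta \<equiv> \<lambda>f. power_algebra.reindex Sg A (carrier (fib F (Dom C f))) (carrier (fib F (Cod C f)))
                     (inv_img F f)"
  shows "transfer_functor TYPE('u) C E M
    (variety_cat TYPE('u) Sg Eqs) (surjective_homs TYPE('u) Sg Eqs) (injective_homs TYPE('u) Sg Eqs)
    (\<lambda>X. power_algebra.direct_power Sg A (carrier (fib F X))) Ta"
proof -
  interpret P: power_algebra Sg Eqs A by fact
  interpret I: inducing_form "TYPE('u)" C F E M by fact
  interpret C: factorized_category "TYPE('u)" C E M ..
  interpret D: factorized_category "TYPE('u)" P.VC P.surjective P.injective
    by (rule P.VC_factorized_category)
  have Ta: "Ta f = P.reindex (I.fibre X) (I.fibre Y) (inv_img F f)" if "f \<in> hom C X Y" for f X Y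
    using that by (simp add: Ta_def I.homD)
  have inv: "inv_img F f \<in> I.fibre Y \<rightarrow> I.fibre X" if "f \<in> hom C X Y" for f X Y
    using that by (rule I.inv_closed)
  have dir: "dir_img F f \<in> I.fibre X \<rightarrow> I.fibre Y" if "f \<in> hom C X Y" for f X Y
    using that by (rule I.dir_closed)
  have small: "small TYPE('u) (I.fibre X)" "small TYPE('u) (I.fibre Y)" if "f \<in> hom C X Y" for f X Y
    using I.fib_small I.hom_objs[OF that] by simp_all
  show ?thesis
  proof
    fix X assume X: "X \<in> Obj C"
    show "P.direct_power (I.fibre X) \<in> Obj P.VC" using P.power_V[OF I.fib_small[OF X]] by simp
    show "Ta (Idt C X) = Idt P.VC (P.direct_power (I.fibre X))"
      unfolding Ta[OF I.idt_hom[OF X]]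
      by (rule P.reindex_id[OF I.fib_small[OF X]]) (rule I.inv_idt[OF X])
  next
    fix f X Y assume f: "f \<in> hom C X Y"
    show "Ta f \<in> hom P.VC (P.direct_power (I.fibre X)) (P.direct_power (I.fibre Y))"
      unfolding Ta[OF f] by (rule P.reindex_hom[OF small[OF f] inv[OF f]])
  next
    fix f g X Y Z assume f: "f \<in> hom C X Y" and g: "g \<in> hom C Y Z"
    show "Ta (g \<odot>\<^bsub>C\<^esub> f) = Ta g \<odot>\<^bsub>P.VC\<^esub> Ta f"
      unfolding Ta[OF f] Ta[OF g] Ta[OF I.comp_hom[OF f g]]
      by (rule P.reindex_comp[symmetric, OF small[OF f] small(2)[OF g] inv[OF f] inv[OF g]])
         (rule I.inv_comp[OF f g])
  next
    fix f assume f: "f \<in> Arr C" and iso: "is_iso P.VC (Ta f)"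
    note f = I.arr_hom[OF f]
    have "bij_betw (inv_img F f) (I.fibre (Cod C f)) (I.fibre (Dom C f))"
      using iso unfolding Ta[OF f] by (rule P.reindex_iso_bij[OF small[OF f] inv[OF f] _ c])
    then show "is_iso C f" by (rule I.iso_if_bij_inv[OF f])
  next
    show "Ta ` E \<subseteq> P.surjective"
    proof (rule image_subsetI)
      fix e assume e: "e \<in> E"
      then have "e \<in> Arr C" using I.E_arr by blast
      note hom = I.arr_hom[OF this]
      have "inj_on (inv_img F e) (I.fibre (Cod C e))"
        by (rule inj_on_inverseI) (rule I.E_dir_inv[OF e hom])
      then show "Ta e \<in> P.surjective"
        unfolding Ta[OF hom] P.surjective_iff[OF P.reindex_hom[OF small[OF hom] inv[OF hom]]]
        by (rule P.reindex_surj[OF small[OF hom] inv[OF hom] _ c(1)])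
    qed
    show "Ta ` M \<subseteq> P.injective"
    proof (rule image_subsetI)
      fix m assume m: "m \<in> M"
      then have "m \<in> Arr C" using I.M_arr by blast
      note hom = I.arr_hom[OF this]
      show "Ta m \<in> P.injective"
        unfolding Ta[OF hom] P.injective_iff[OF P.reindex_hom[OF small[OF hom] inv[OF hom]]]
      proof (rule P.reindex_inj[OF small[OF hom] inv[OF hom]])
        fix S assume "S \<in> I.fibre (Dom C m)"
        then show "\<exists>T\<in>I.fibre (Cod C m). inv_img F m T = S"
          using I.M_inv_dir[OF m hom] I.dir_in[OF hom] by blast
      qed
    qed
  next
    fix m m' p q assume mM: "m \<in> M" "m' \<in> M" and pb: "is_pullback C m m' p q"
    define X X' Y P where "X = Dom C m" "X' = Dom C m'" "Y = Cod C m" "P = Dom C p"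
    have hom: "m \<in> hom C X Y" "m' \<in> hom C X' Y" "p \<in> hom C P X" "q \<in> hom C P X'"
      and eq: "m \<odot>\<^bsub>C\<^esub> p = m' \<odot>\<^bsub>C\<^esub> q"
      using pb unfolding is_pullback_def X_X'_Y_P_def by (auto simp: hom_def)
    note m = hom(1) and m' = hom(2) and p = hom(3) and q = hom(4)
    note pb' = I.pullback_commute[OF pb]
    show "is_pullback P.VC (Ta m) (Ta m') (Ta p) (Ta q)"
      unfolding Ta[OF m] Ta[OF m'] Ta[OF p] Ta[OF q]
    \<comment> \<open>The maps \<open>dp\<close> and \<open>dq\<close> are the direct images along
      \<open>p\<close> and \<open>q\<close>.\<close>
    proof (rule P.reindex_pullback[OF small(2)[OF m] small(1)[OF m] small(1)[OF m'] small(1)[OF p]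
          inv[OF m] inv[OF m'] inv[OF p] inv[OF q] dir[OF p] dir[OF q]])
      show "\<And>w. w \<in> I.fibre P \<Longrightarrow> inv_img F p (dir_img F p w) = w"
        by (rule I.pullback_inv_surj(2)[OF pb mM hom])
      show "inv_img F p (inv_img F m v) = inv_img F q (inv_img F m' v)" if "v \<in> I.fibre Y" for v
        using I.inv_comp[OF p m that] I.inv_comp[OF q m' that] eq by simp
      show "\<And>S. S \<in> I.fibre X \<Longrightarrow> \<exists>v\<in>I.fibre Y. \<exists>w\<in>I.fibre Y. inv_img F m v = S \<and>
          inv_img F m' v = inv_img F m' w \<and> inv_img F m w = dir_img F p (inv_img F p S)"
        by (rule I.pullback_zigzag[OF pb mM hom])
      show "\<And>S. S \<in> I.fibre X' \<Longrightarrow> \<exists>v\<in>I.fibre Y. \<exists>w\<in>I.fibre Y. inv_img F m' v = S \<and>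
          inv_img F m v = inv_img F m w \<and> inv_img F m' w = dir_img F q (inv_img F q S)"
        by (rule I.pullback_zigzag[OF pb' mM(2,1) m' m q p])
      fix w assume w: "w \<in> I.fibre P"
      \<comment> \<open>Both ways around the square give the same cluster over \<open>Y\<close>; it
        is the witness for \<open>link\<close>, as the inverse images along \<open>m\<close> and
        \<open>m'\<close> undo the direct ones.\<close>
      have "dir_img F m (dir_img F p w) = dir_img F m' (dir_img F q w)"
        using I.dir_comp[OF p m w] I.dir_comp[OF q m' w] eq by simp
      then show "\<exists>v\<in>I.fibre Y. inv_img F m v = dir_img F p w \<and> inv_img F m' v = dir_img F q w"
        using I.M_inv_dir[OF mM(1) m I.dir_in[OF p w]] I.M_inv_dir[OF mM(2) m' I.dir_in[OF q w]]
          I.dir_in[OF m I.dir_in[OF p w]] by (intro bexI[of _ "dir_img F m (dir_img F p w)"]) auto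
    qed
  next
    fix e e' p q assume eE: "e \<in> E" "e' \<in> E" and po: "is_pushout C e e' p q"
    define X Y Y' Z where "X = Dom C e" "Y = Cod C e" "Y' = Cod C e'" "Z = Cod C p"
    have hom: "e \<in> hom C X Y" "e' \<in> hom C X Y'" "p \<in> hom C Y Z" "q \<in> hom C Y' Z"
      and eq: "p \<odot>\<^bsub>C\<^esub> e = q \<odot>\<^bsub>C\<^esub> e'"
      using po unfolding is_pushout_def X_Y_Y'_Z_def by (auto simp: hom_def)
    note e = hom(1) and e' = hom(2) and p = hom(3) and q = hom(4)
    show "is_pushout P.VC (Ta e) (Ta e') (Ta p) (Ta q)"
      unfolding Ta[OF e] Ta[OF e'] Ta[OF p] Ta[OF q]
    proof (rule P.reindex_pushout[OF small(1)[OF e] small(2)[OF e] small(2)[OF e'] small(2)[OF p]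
          inv[OF e] inv[OF e'] inv[OF p] inv[OF q] dir[OF e] dir[OF p] _ _ _ _ _ c(1)])
      show "\<And>T. T \<in> I.fibre Y \<Longrightarrow> dir_img F e (inv_img F e T) = T"
        by (rule I.E_dir_inv[OF eE(1) e])
      show "inj_on (inv_img F e') (I.fibre Y')"
        by (rule inj_on_inverseI) (rule I.E_dir_inv[OF eE(2) e'])
      show "\<And>W. W \<in> I.fibre Z \<Longrightarrow> dir_img F p (inv_img F p W) = W"
        by (rule I.pushout_dir_inj(2)[OF po eE hom])
      show "inv_img F e (inv_img F p W) = inv_img F e' (inv_img F q W)" if "W \<in> I.fibre Z" for W
        using I.inv_comp[OF e p that] I.inv_comp[OF e' q that] eq by simp
      show "\<And>T T'. T \<in> I.fibre Y \<Longrightarrow> T' \<in> I.fibre Y' \<Longrightarrow> inv_img F e T = inv_img F e' T' \<Longrightarrow>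
          \<exists>W\<in>I.fibre Z. T = inv_img F p W"
        by (rule I.pushout_inter[OF po eE hom])
    qed
  qed
qed

section \<open>Subgroups of free abelian groups\<close>

text \<open>The type \<open>'a \<Rightarrow>\<^sub>0 int\<close> is the free abelian group on the
  whole type \<open>'a\<close>; the part supported on \<open>X\<close> is the free abelian group on
  \<open>X\<close>.\<close>

definition frags :: "'a set \<Rightarrow> ('a \<Rightarrow>\<^sub>0 int) set" where
  "frags X = {c. Poly_Mapping.keys c \<subseteq> X}"

definition subgroups :: "'a set \<Rightarrow> ('a \<Rightarrow>\<^sub>0 int) set set" where
  "subgroups X = {H. H \<subseteq> frags X \<and> 0 \<in> H \<and> (\<forall>a\<in>H. \<forall>b\<in>H. a - b \<in> H)}"

text \<open>\<open>h\<close> is a total function, while an arrow acts only on a carrier; by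
  \<open>linear_map_cong\<close> the values outside \<open>X\<close> do not affect chains in
  \<open>frags X\<close>.\<close>

definition linear_map :: "('a \<Rightarrow> 'b) \<Rightarrow> ('a \<Rightarrow>\<^sub>0 int) \<Rightarrow> ('b \<Rightarrow>\<^sub>0 int)" where
  "linear_map h = frag_extend (\<lambda>x. frag_of (h x))"

definition frag_kernel :: "'a set \<Rightarrow> ('a \<Rightarrow> 'b) \<Rightarrow> ('a \<Rightarrow>\<^sub>0 int) set" where
  "frag_kernel X h = {c \<in> frags X. linear_map h c = 0}"

definition group_sum :: "('a \<Rightarrow>\<^sub>0 int) set \<Rightarrow> ('a \<Rightarrow>\<^sub>0 int) set \<Rightarrow> ('a \<Rightarrow>\<^sub>0 int) set" where
  "group_sum H K = {a + b |a b. a \<in> H \<and> b \<in> K}"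

lemma frag_of_in_frags [simp]: "frag_of x \<in> frags X \<longleftrightarrow> x \<in> X"
  by (simp add: frags_def)

lemma linear_map_0 [simp]: "linear_map h 0 = 0"
  and linear_map_diff: "linear_map h (a - b) = linear_map h a - linear_map h b"
  and linear_map_add: "linear_map h (a + b) = linear_map h a + linear_map h b"
  and linear_map_of [simp]: "linear_map h (frag_of x) = frag_of (h x)"
  by (simp_all add: linear_map_def frag_extend_diff frag_extend_add)

lemma frags_0 [simp]: "0 \<in> frags X"
  by (simp add: frags_def)

lemma frags_diff: "a \<in> frags X \<Longrightarrow> b \<in> frags X \<Longrightarrow> a - b \<in> frags X"
  using keys_diff[of a b] by (auto simp: frags_def)

lemma frags_induct [consumes 1, case_names zero of diff]:
  assumes "c \<in> frags X" "P 0" "\<And>x. x \<in> X \<Longrightarrow> P (frag_of x)"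
    "\<And>a b. P a \<Longrightarrow> P b \<Longrightarrow> P (a - b)"
  shows "P c"
  using assms by (intro frag_induction[of c X P]) (auto simp: frags_def)

lemma frags_mono: "X \<subseteq> Y \<Longrightarrow> frags X \<subseteq> frags Y"
  by (auto simp: frags_def)

lemma frags_subset_iff: "frags X \<subseteq> frags Y \<longleftrightarrow> X \<subseteq> Y"
  using frags_mono frag_of_in_frags by (metis subsetD subsetI)

lemma frags_Int: "frags X \<inter> frags Y = frags (X \<inter> Y)"
  by (auto simp: frags_def)

lemma linear_map_frags:
  assumes "h ` X \<subseteq> Y" "c \<in> frags X"
  shows "linear_map h c \<in> frags Y"
  using assms(2) by (induction rule: frags_induct) (use assms(1) in \<open>auto simp: linear_map_diff frags_diff\<close>)

lemma linear_map_cong: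
  assumes "\<And>x. x \<in> X \<Longrightarrow> h x = k x" "c \<in> frags X"
  shows "linear_map h c = linear_map k c"
  using assms(2) by (induction rule: frags_induct) (use assms(1) in \<open>auto simp: linear_map_diff\<close>)

lemma linear_map_comp: "linear_map g (linear_map h c) = linear_map (\<lambda>x. g (h x)) c"
proof -
  have "c \<in> frags UNIV" by (simp add: frags_def)
  then show ?thesis by (induction rule: frags_induct) (auto simp: linear_map_diff)
qed

lemma linear_map_ident:
  assumes "\<And>x. x \<in> X \<Longrightarrow> h x = x" "c \<in> frags X"
  shows "linear_map h c = c"
  using assms(2) by (induction rule: frags_induct) (use assms(1) in \<open>auto simp: linear_map_diff\<close>)

lemma linear_map_image_frags: "linear_map h ` frags X = frags (h ` X)"
proof
  show "linear_map h ` frags X \<subseteq> frags (h ` X)" using linear_map_frags by blast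
  show "frags (h ` X) \<subseteq> linear_map h ` frags X"
  proof
    fix c assume c: "c \<in> frags (h ` X)"
    let ?d = "linear_map (inv_into X h) c"
    have "?d \<in> frags X" by (rule linear_map_frags[OF _ c]) (auto intro: inv_into_into)
    moreover have "linear_map h ?d = c"
      unfolding linear_map_comp by (rule linear_map_ident[OF _ c]) (rule f_inv_into_f)
    ultimately show "c \<in> linear_map h ` frags X" by (metis imageI)
  qed
qed

text \<open>A left inverse of \<open>m\<close> on \<open>X\<close> induces one of the linear
  map.\<close>

lemma linear_map_inj:
  assumes "inj_on m X" "c \<in> frags X" "linear_map m c = 0"
  shows "c = 0"
proof -
  have "linear_map (inv_into X m) (linear_map m c) = c"
    unfolding linear_map_comp by (rule linear_map_ident[OF _ assms(2)]) (simp add: assms(1))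
  then show ?thesis using assms(3) by simp
qed

section \<open>Subgroups, their images, preimages and sums\<close>

lemma subgroupsD:
  assumes "H \<in> subgroups X"
  shows "H \<subseteq> frags X" "0 \<in> H" "a \<in> H \<Longrightarrow> b \<in> H \<Longrightarrow> a - b \<in> H" "a \<in> H \<Longrightarrow> b \<in> H \<Longrightarrow> a + b \<in> H"
proof -
  have *: "a - b \<in> H" if "a \<in> H" "b \<in> H" for a b
    using assms that by (auto simp: subgroups_def)
  then show "a \<in> H \<Longrightarrow> b \<in> H \<Longrightarrow> a - b \<in> H" .
  show "H \<subseteq> frags X" "0 \<in> H" using assms by (auto simp: subgroups_def)
  assume ab: "a \<in> H" "b \<in> H"
  have "0 - b \<in> H" by (rule *) (use assms ab in \<open>auto simp: subgroups_def\<close>)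
  then have "a - (0 - b) \<in> H" by (rule *[OF ab(1)])
  then show "a + b \<in> H" by simp
qed

lemma frags_subgroup: "frags X \<in> subgroups X"
  and zero_subgroup: "{0} \<in> subgroups X"
  by (auto simp: subgroups_def frags_diff)

lemma image_subgroup:
  assumes "h ` X \<subseteq> Y" "H \<in> subgroups X"
  shows "linear_map h ` H \<in> subgroups Y"
proof -
  have "linear_map h a - linear_map h b \<in> linear_map h ` H" if "a \<in> H" "b \<in> H" for a b
    using subgroupsD(3)[OF assms(2) that] by (metis imageI linear_map_diff)
  moreover have "0 \<in> linear_map h ` H"
    using subgroupsD(2)[OF assms(2)] by (metis imageI linear_map_0)
  ultimately show ?thesis
    using linear_map_frags[OF assms(1)] subgroupsD(1)[OF assms(2)] by (auto simp: subgroups_def)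
qed

lemma vimage_subgroup:
  assumes "K \<in> subgroups Y"
  shows "{c \<in> frags X. linear_map h c \<in> K} \<in> subgroups X"
  using subgroupsD[OF assms] by (auto simp: subgroups_def frags_diff linear_map_diff)

lemma frag_kernel_subgroup: "frag_kernel X h \<in> subgroups X"
  using vimage_subgroup[OF zero_subgroup, of X h] by (simp add: frag_kernel_def)

lemma Int_subgroup: "H \<in> subgroups X \<Longrightarrow> K \<in> subgroups X \<Longrightarrow> H \<inter> K \<in> subgroups X"
  by (auto simp: subgroups_def)

lemma group_sum_subgroup:
  assumes "H \<in> subgroups X" "K \<in> subgroups X"
  shows "group_sum H K \<in> subgroups X"
  unfolding subgroups_def
proof (intro CollectI conjI ballI)
  note H = subgroupsD[OF assms(1)] and K = subgroupsD[OF assms(2)]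
  show "0 \<in> group_sum H K"
    unfolding group_sum_def using H(2) K(2) by (intro CollectI exI[of _ 0]) simp
  show "group_sum H K \<subseteq> frags X"
    unfolding group_sum_def
    by (auto intro: subgroupsD(4)[OF frags_subgroup subsetD[OF H(1)] subsetD[OF K(1)]])
  fix c d assume "c \<in> group_sum H K" "d \<in> group_sum H K"
  then obtain a b a' b' where ab: "a \<in> H" "b \<in> K" "a' \<in> H" "b' \<in> K" "c = a + b" "d = a' + b'"
    unfolding group_sum_def by blast
  have "c - d = (a - a') + (b - b')" using ab by simp
  then show "c - d \<in> group_sum H K"
    unfolding group_sum_def using H(3)[OF ab(1,3)] K(3)[OF ab(2,4)] by blast
qed

lemma group_sum_upper:
  assumes "H \<in> subgroups X" "K \<in> subgroups X"
  shows "H \<subseteq> group_sum H K" "K \<subseteq> group_sum H K"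
proof -
  show "H \<subseteq> group_sum H K"
    unfolding group_sum_def using subgroupsD(2)[OF assms(2)] by (metis (mono_tags, lifting) CollectI add.right_neutral subsetI)
  show "K \<subseteq> group_sum H K"
    unfolding group_sum_def using subgroupsD(2)[OF assms(1)] by (metis (mono_tags, lifting) CollectI add.left_neutral subsetI)
qed

lemma group_sum_least:
  assumes "L \<in> subgroups X" "H \<subseteq> L" "K \<subseteq> L"
  shows "group_sum H K \<subseteq> L"
  using subgroupsD(4)[OF assms(1)] assms(2,3) by (auto simp: group_sum_def)

text \<open>The first law of (N1): chains with the same image differ by an element of the
  kernel.\<close>

lemma vimage_image_subgroup:
  assumes "H \<in> subgroups X"
  shows "{c \<in> frags X. linear_map h c \<in> linear_map h ` H} = group_sum H (frag_kernel X h)"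
proof
  note H = subgroupsD[OF assms]
  show "{c \<in> frags X. linear_map h c \<in> linear_map h ` H} \<subseteq> group_sum H (frag_kernel X h)"
  proof
    fix c assume "c \<in> {c \<in> frags X. linear_map h c \<in> linear_map h ` H}"
    then obtain a where a: "c \<in> frags X" "a \<in> H" "linear_map h c = linear_map h a" by blast
    have "c - a \<in> frag_kernel X h"
      using a frags_diff H(1) by (auto simp: frag_kernel_def linear_map_diff)
    moreover have "c = a + (c - a)" by simp
    ultimately show "c \<in> group_sum H (frag_kernel X h)" unfolding group_sum_def using a(2) by blast
  qed
  show "group_sum H (frag_kernel X h) \<subseteq> {c \<in> frags X. linear_map h c \<in> linear_map h ` H}"
    by (auto simp: group_sum_def frag_kernel_def linear_map_add
        intro: subgroupsD(4)[OF frags_subgroup subsetD[OF H(1)]])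
qed

text \<open>The second law of (N1), with the image of the full group written as the chains supported
  on the image set.\<close>

lemma image_vimage_subgroup:
  "linear_map h ` {c \<in> frags X. linear_map h c \<in> K} = K \<inter> frags (h ` X)"
  unfolding linear_map_image_frags[symmetric] by blast

text \<open>The linear kernel remembers the kernel pair: two points are identified exactly when the
  difference of their generators is killed. Comparing kernels in the fibre therefore compares kernel
  pairs.\<close>

lemma frag_kernel_subset_imp:
  assumes "frag_kernel X e \<subseteq> frag_kernel X g" "x \<in> X" "y \<in> X" "e x = e y"
  shows "g x = g y"
proof -
  have "frag_of x - frag_of y \<in> frag_kernel X e"
    using assms(2-4) by (auto simp: frag_kernel_def frags_diff linear_map_diff)
  then have "frag_of x - frag_of y \<in> frag_kernel X g" using assms(1) by blast
  then have "frag_of (g x) = frag_of (g y)" by (simp add: frag_kernel_def linear_map_diff)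
  then show ?thesis by (simp only: frag_of_eq)
qed

lemma frag_kernel_inj_comp:
  assumes "inj_on m Y" "e ` X \<subseteq> Y"
  shows "frag_kernel X (\<lambda>x. m (e x)) = frag_kernel X e"
  using linear_map_inj[OF assms(1)] linear_map_frags[OF assms(2)]
  by (auto simp: frag_kernel_def linear_map_comp[symmetric])

lemma frag_kernel_cong: "(\<And>x. x \<in> X \<Longrightarrow> h x = k x) \<Longrightarrow> frag_kernel X h = frag_kernel X k"
  using linear_map_cong[of X h k] by (auto simp: frag_kernel_def)

lemma frag_kernel_comp: "frag_kernel X h \<subseteq> frag_kernel X (\<lambda>x. k (h x))"
  by (auto simp: frag_kernel_def linear_map_comp[symmetric])

text \<open>
  With a section \<open>s\<close> of \<open>r\<close>, a chain \<open>c\<close> killed by \<open>r\<close> equals \<open>c - s r c\<close>, a combination of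
  differences of points identified by \<open>r\<close>.
\<close>

lemma frag_kernel_join_eq:
  assumes r: "\<And>x y. x \<in> X \<Longrightarrow> y \<in> X \<Longrightarrow> r x = r y \<Longrightarrow>
      (x, y) \<in> ({(x, y). x \<in> X \<and> y \<in> X \<and> e x = e y} \<union> {(x, y). x \<in> X \<and> y \<in> X \<and> e' x = e' y})\<^sup>*"
    and le: "frag_kernel X e \<subseteq> frag_kernel X r" "frag_kernel X e' \<subseteq> frag_kernel X r"
  shows "group_sum (frag_kernel X e) (frag_kernel X e') = frag_kernel X r"
proof
  let ?W = "group_sum (frag_kernel X e) (frag_kernel X e')"
  have W: "?W \<in> subgroups X" by (rule group_sum_subgroup[OF frag_kernel_subgroup frag_kernel_subgroup])
  show "?W \<subseteq> frag_kernel X r" by (rule group_sum_least[OF frag_kernel_subgroup le])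
  \<comment> \<open>Differences telescope along the chain, each link lying in one of the two
    kernels.\<close>
  have step: "frag_of x - frag_of y \<in> ?W"
    if "(x, y) \<in> ({(x, y). x \<in> X \<and> y \<in> X \<and> e x = e y} \<union> {(x, y). x \<in> X \<and> y \<in> X \<and> e' x = e' y})\<^sup>*" for x y
    using that
  proof induction
    case (step y z)
    have "frag_of y - frag_of z \<in> frag_kernel X e \<or> frag_of y - frag_of z \<in> frag_kernel X e'"
      using step(2) by (auto simp: frag_kernel_def frags_diff linear_map_diff)
    then have "frag_of y - frag_of z \<in> ?W" using group_sum_upper[OF frag_kernel_subgroup frag_kernel_subgroup] by blast
    then have "(frag_of x - frag_of y) + (frag_of y - frag_of z) \<in> ?W"
      by (rule subgroupsD(4)[OF W step(3)])
    then show ?case by simp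
  qed (use subgroupsD(2)[OF W] in simp)
  let ?s = "\<lambda>x. inv_into X r (r x)"
  have diff: "c - linear_map ?s c \<in> ?W" if "c \<in> frags X" for c
    using that
  proof (induction rule: frags_induct)
    case zero
    show ?case using subgroupsD(2)[OF W] by simp
  next
    case (of x)
    then have "(x, ?s x) \<in> ({(x, y). x \<in> X \<and> y \<in> X \<and> e x = e y} \<union> {(x, y). x \<in> X \<and> y \<in> X \<and> e' x = e' y})\<^sup>*"
      by (intro r) (auto intro: inv_into_into simp: f_inv_into_f)
    then show ?case using step by simp
  next
    case (diff a b)
    have "(a - linear_map ?s a) - (b - linear_map ?s b) \<in> ?W"
      by (rule subgroupsD(3)[OF W diff])
    moreover have "(a - b) - linear_map ?s (a - b) = (a - linear_map ?s a) - (b - linear_map ?s b)"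
      by (simp add: linear_map_diff)
    ultimately show ?case by (simp only:)
  qed
  show "frag_kernel X r \<subseteq> ?W"
  proof
    fix c assume c: "c \<in> frag_kernel X r"
    have "linear_map ?s c = linear_map (inv_into X r) (linear_map r c)" by (simp add: linear_map_comp)
    then show "c \<in> ?W" using diff[of c] c by (simp add: frag_kernel_def)
  qed
qed

text \<open>A chain on \<open>X\<close> is determined by its coefficients on \<open>X\<close>, so
  \<open>frags X\<close> embeds into a small function space and its subgroups lie in a small power
  set.\<close>

lemma small_subgroups:
  assumes U: "universe TYPE('u)" and X: "small TYPE('u) X"
  shows "small TYPE('u) (subgroups X)"
proof -
  have "inj_on (\<lambda>c. \<lambda>x\<in>X. Poly_Mapping.lookup c x) (frags X)"
  proof (rule inj_onI, rule poly_mapping_eqI)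
    fix c d x assume cd: "c \<in> frags X" "d \<in> frags X"
      "(\<lambda>x\<in>X. Poly_Mapping.lookup c x) = (\<lambda>x\<in>X. Poly_Mapping.lookup d x)"
    show "Poly_Mapping.lookup c x = Poly_Mapping.lookup d x"
    proof (cases "x \<in> X")
      case True
      then show ?thesis using fun_cong[OF cd(3), of x] by simp
    next
      case False
      then have "x \<notin> Poly_Mapping.keys c" "x \<notin> Poly_Mapping.keys d"
        using cd(1,2) by (auto simp: frags_def)
      then show ?thesis by (simp add: in_keys_iff)
    qed
  qed
  moreover have "(\<lambda>c. \<lambda>x\<in>X. Poly_Mapping.lookup c x) ` frags X \<subseteq> (X \<rightarrow>\<^sub>E (UNIV :: int set))"
    by auto
  ultimately have "frags X \<lesssim> (X \<rightarrow>\<^sub>E (UNIV :: int set))" unfolding lepoll_def by blast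
  then have "small TYPE('u) (frags X)"
    by (rule small_lepoll[OF _ small_PiE[OF U X small_int[OF U]]])
  then have "small TYPE('u) (Pow (frags X))" by (rule small_Pow[OF U])
  moreover have "subgroups X \<lesssim> Pow (frags X)"
    by (rule subset_imp_lepoll) (auto simp: subgroups_def)
  ultimately show ?thesis by (rule small_lepoll[rotated])
qed

subsection \<open>The lattice of subgroups\<close>

text \<open>Clusters have to be elements of \<open>'u\<close>, so a subgroup is stored by its code;
  \<open>dec\<close> recovers it when \<open>X\<close> is small.\<close>

definition enc :: "'u set \<Rightarrow> ('u \<Rightarrow>\<^sub>0 int) set \<Rightarrow> 'u" where
  "enc X = code (subgroups X)"

definition dec :: "'u set \<Rightarrow> 'u \<Rightarrow> ('u \<Rightarrow>\<^sub>0 int) set" where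
  "dec X = decode (subgroups X)"

definition subgroup_lattice :: "'u set \<Rightarrow> 'u gorder" where
  "subgroup_lattice X =
     \<lparr> carrier = enc X ` subgroups X, eq = (=), le = (\<lambda>a b. dec X a \<subseteq> dec X b) \<rparr>"

lemma le_subgroup_lattice [simp]: "a \<sqsubseteq>\<^bsub>subgroup_lattice X\<^esub> b \<longleftrightarrow> dec X a \<subseteq> dec X b"
  and eq_subgroup_lattice [simp]: "a .=\<^bsub>subgroup_lattice X\<^esub> b \<longleftrightarrow> a = b"
  by (simp_all add: subgroup_lattice_def)

lemma dec_subgroup: "a \<in> carrier (subgroup_lattice X) \<Longrightarrow> dec X a \<in> subgroups X"
  unfolding dec_def by (rule decode_in) (simp add: subgroup_lattice_def enc_def)

lemma enc_dec: "a \<in> carrier (subgroup_lattice X) \<Longrightarrow> enc X (dec X a) = a"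
  unfolding dec_def enc_def by (rule code_decode) (simp add: subgroup_lattice_def enc_def)

lemma enc_carrier: "H \<in> subgroups X \<Longrightarrow> enc X H \<in> carrier (subgroup_lattice X)"
  by (simp add: subgroup_lattice_def)

lemma subgroup_lattice_eqI:
  assumes "a \<in> carrier (subgroup_lattice X)" "b \<in> carrier (subgroup_lattice X)" "dec X a = dec X b"
  shows "a = b"
  using enc_dec[OF assms(1)] enc_dec[OF assms(2)] assms(3) by metis

locale small_subgroup_lattice =
  fixes X :: "'u set"
  assumes U: "universe TYPE('u)" and X: "small TYPE('u) X"
begin

abbreviation L :: "'u gorder" where
  "L \<equiv> subgroup_lattice X"

lemma dec_enc: "H \<in> subgroups X \<Longrightarrow> dec X (enc X H) = H"
  unfolding dec_def enc_def by (rule decode_code[OF small_subgroups[OF U X]])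

lemma small_carrier: "small TYPE('u) (carrier L)"
  unfolding subgroup_lattice_def enc_def using small_code_image[OF small_subgroups[OF U X]] by simp

lemma least_sum:
  assumes "a \<in> carrier L" "b \<in> carrier L"
  shows "least L (enc X (group_sum (dec X a) (dec X b))) (Upper L {a, b})"
proof -
  let ?H = "dec X a" and ?K = "dec X b"
  have HK: "?H \<in> subgroups X" "?K \<in> subgroups X" using assms by (auto intro: dec_subgroup)
  note sum = group_sum_subgroup[OF HK]
  have "group_sum ?H ?K \<subseteq> dec X c"
    if "c \<in> carrier L" "?H \<subseteq> dec X c" "?K \<subseteq> dec X c" for c
    by (rule group_sum_least[OF dec_subgroup[OF that(1)] that(2,3)])
  then show ?thesis
    using assms enc_carrier[OF sum] dec_enc[OF sum] group_sum_upper[OF HK]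
    by (auto simp: least_def Upper_def)
qed

lemma greatest_Int:
  assumes "a \<in> carrier L" "b \<in> carrier L"
  shows "greatest L (enc X (dec X a \<inter> dec X b)) (Lower L {a, b})"
proof -
  have "dec X a \<inter> dec X b \<in> subgroups X"
    using assms by (intro Int_subgroup dec_subgroup)
  then show ?thesis
    using assms by (auto simp: greatest_def Lower_def enc_carrier dec_enc)
qed

lemma greatest_frags: "greatest L (enc X (frags X)) (carrier L)"
  by (auto simp: greatest_def enc_carrier frags_subgroup dec_enc
      dest: subsetD[OF subgroupsD(1)[OF dec_subgroup]])

lemma least_zero: "least L (enc X {0}) (carrier L)"
  by (auto simp: least_def enc_carrier zero_subgroup dec_enc subgroupsD(2)[OF dec_subgroup])

lemma L_bounded_lattice: "bounded_lattice L"
proof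
  show "a .=\<^bsub>L\<^esub> b" if "a \<sqsubseteq>\<^bsub>L\<^esub> b" "b \<sqsubseteq>\<^bsub>L\<^esub> a" "a \<in> carrier L" "b \<in> carrier L" for a b
    using that by (auto intro: subgroup_lattice_eqI)
  show "(.=\<^bsub>L\<^esub>) = (=)" by (simp add: subgroup_lattice_def)
  show "\<exists>s. least L s (Upper L {a, b})" if "a \<in> carrier L" "b \<in> carrier L" for a b
    using least_sum[OF that] by blast
  show "\<exists>s. greatest L s (Lower L {a, b})" if "a \<in> carrier L" "b \<in> carrier L" for a b
    using greatest_Int[OF that] by blast
  show "\<exists>t. greatest L t (carrier L)" using greatest_frags by blast
  show "\<exists>b. least L b (carrier L)" using least_zero by blast
qed auto

text \<open>Joins, meets and bounds of a \<open>gorder\<close> are picked by \<open>SOME\<close>, so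
  they are known only through their universal property. Uniqueness, here and in
  \<open>greatest_eqI\<close>, identifies the chosen element with the explicit subgroup.\<close>

lemma least_eqI:
  assumes "least L a A" "least L b A"
  shows "dec X a = dec X b"
  using assms by (auto simp: least_def)

lemma greatest_eqI:
  assumes "greatest L a A" "greatest L b A"
  shows "dec X a = dec X b"
  using assms by (auto simp: greatest_def)

lemma dec_join:
  assumes "a \<in> carrier L" "b \<in> carrier L"
  shows "dec X (a \<squnion>\<^bsub>L\<^esub> b) = group_sum (dec X a) (dec X b)"
proof -
  have "least L (a \<squnion>\<^bsub>L\<^esub> b) (Upper L {a, b})"
    unfolding join_def sup_def using least_sum[OF assms] by (rule someI)
  from least_eqI[OF this least_sum[OF assms]] show ?thesis
    using assms by (simp add: dec_enc group_sum_subgroup dec_subgroup)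
qed

lemma dec_meet:
  assumes "a \<in> carrier L" "b \<in> carrier L"
  shows "dec X (a \<sqinter>\<^bsub>L\<^esub> b) = dec X a \<inter> dec X b"
proof -
  have "greatest L (a \<sqinter>\<^bsub>L\<^esub> b) (Lower L {a, b})"
    unfolding meet_def inf_def using greatest_Int[OF assms] by (rule someI)
  from greatest_eqI[OF this greatest_Int[OF assms]] show ?thesis
    using assms by (simp add: dec_enc Int_subgroup dec_subgroup)
qed

lemma dec_top: "dec X \<top>\<^bsub>L\<^esub> = frags X"
proof -
  have "greatest L \<top>\<^bsub>L\<^esub> (carrier L)"
    unfolding top_def using greatest_frags by (rule someI)
  from greatest_eqI[OF this greatest_frags] show ?thesis by (simp add: dec_enc frags_subgroup)
qed

lemma dec_bot: "dec X \<bottom>\<^bsub>L\<^esub> = {0}"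
proof -
  have "least L \<bottom>\<^bsub>L\<^esub> (carrier L)"
    unfolding bottom_def using least_zero by (rule someI)
  from least_eqI[OF this least_zero] show ?thesis by (simp add: dec_enc zero_subgroup)
qed

end

section \<open>From a transfer functor to a noetherian form\<close>

locale variety_transfer = variety_presentation Sg Eqs +
  transfer_functor "TYPE('u)" C E M "variety_cat TYPE('u) Sg Eqs"
    "surjective_homs TYPE('u) Sg Eqs" "injective_homs TYPE('u) Sg Eqs" To Ta
  for Sg :: "'f signature" and Eqs :: "'f equations"
    and C :: "('o, 'm) category" and E M :: "'m set"
    and To :: "'o \<Rightarrow> ('f, 'u) algebra" and Ta :: "'m \<Rightarrow> ('f, 'u) alg_arrow"
begin

abbreviation pts :: "'o \<Rightarrow> 'u set" where
  "pts X \<equiv> carrier (To X)"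

abbreviation fn :: "'m \<Rightarrow> 'u \<Rightarrow> 'u" where
  "fn f \<equiv> ap (Ta f)"

text \<open>The form of subgroups of abelian groups, pulled back along the transfer functor, the
  underlying set functor and the free abelian group functor. The operations of the algebras do not
  appear in it; they enter through the pushouts and pullbacks that the transfer functor
  preserves.\<close>

definition F :: "('o, 'm, 'u) form" where
  "F = \<lparr> fib = (\<lambda>X. subgroup_lattice (pts X)),
         dir_img = (\<lambda>f a. enc (pts (Cod C f)) (linear_map (fn f) ` dec (pts (Dom C f)) a)),
         inv_img = (\<lambda>f b. enc (pts (Dom C f))
           {c \<in> frags (pts (Dom C f)). linear_map (fn f) c \<in> dec (pts (Cod C f)) b}) \<rparr>"

lemma fib_F [simp]: "fib F X = subgroup_lattice (pts X)"
  by (simp add: F_def)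

section \<open>Action of arrows on points, and factorizations lifted back to
  \<open>C\<close>\<close>

lemma fn_image: "f \<in> hom C X Y \<Longrightarrow> fn f ` pts X \<subseteq> pts Y"
  using ap_closed[OF map_hom] by blast

lemma fn_comp:
  "f \<in> hom C X Y \<Longrightarrow> g \<in> hom C Y Z \<Longrightarrow> x \<in> pts X \<Longrightarrow> fn (g \<odot>\<^bsub>C\<^esub> f) x = fn g (fn f x)"
  using ap_comp[OF map_hom] by (simp add: map_comp)

lemma fn_idt: "X \<in> Obj C \<Longrightarrow> x \<in> pts X \<Longrightarrow> fn (Idt C X) x = x"
  by (simp add: map_idt)

lemma fn_surj: "e \<in> E \<Longrightarrow> e \<in> hom C X Y \<Longrightarrow> fn e ` pts X = pts Y"
  using surjective_iff[OF map_hom] map_E by blast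

lemma fn_inj: "m \<in> M \<Longrightarrow> m \<in> hom C X Y \<Longrightarrow> inj_on (fn m) (pts X)"
  using injective_iff[OF map_hom] map_M by blast

lemma lattice_pts: "X \<in> Obj C \<Longrightarrow> small_subgroup_lattice (pts X)"
  using universe V_small map_obj by (simp add: small_subgroup_lattice_def)

text \<open>Write \<open>g = m e'\<close>. As \<open>m\<close> acts injectively, \<open>e'\<close>
  identifies all points that \<open>e\<close> does, so in the variety \<open>Ta e'\<close> factors
  through \<open>Ta e\<close> and the leg \<open>q\<close> of the pushout of \<open>e\<close> and
  \<open>e'\<close> is sent to an isomorphism. By conservativity \<open>q\<close> is invertible in
  \<open>C\<close>; composing \<open>p\<close> with the inverse of \<open>q\<close> carries
  \<open>e\<close> to \<open>e'\<close>.\<close>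

lemma E_factor:
  assumes e: "e \<in> E" "e \<in> hom C X Y" and g: "g \<in> hom C X Z"
    and ker: "\<And>x y. x \<in> pts X \<Longrightarrow> y \<in> pts X \<Longrightarrow> fn e x = fn e y \<Longrightarrow> fn g x = fn g y"
  shows "\<exists>!h. h \<in> hom C Y Z \<and> g = h \<odot>\<^bsub>C\<^esub> e"
proof -
  obtain e' m W where em: "e' \<in> E" "m \<in> M" "e' \<in> hom C X W" "m \<in> hom C W Z" "g = m \<odot>\<^bsub>C\<^esub> e'"
    using C.factorE[OF g] .
  obtain p q where po: "is_pushout C e e' p q"
    using C.pushout_exists[OF e(1) em(1)] C.homD(2)[OF e(2)] C.homD(2)[OF em(3)] by auto
  have p: "p \<in> hom C Y (Cod C p)" and q: "q \<in> hom C W (Cod C p)" and eq: "p \<odot>\<^bsub>C\<^esub> e = q \<odot>\<^bsub>C\<^esub> e'"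
    using po C.homD(3)[OF e(2)] C.homD(3)[OF em(3)] unfolding is_pushout_def by auto
  note Te = map_hom[OF e(2)] and Te' = map_hom[OF em(3)]
  have "fn e' x = fn e' y" if xy: "x \<in> pts X" "y \<in> pts X" "fn e x = fn e y" for x y
  proof (rule inj_onD[OF fn_inj[OF em(2,4)]])
    show "fn m (fn e' x) = fn m (fn e' y)"
      using ker[OF xy] fn_comp[OF em(3,4)] xy(1,2) em(5) by simp
  qed (use fn_image[OF em(3)] xy in auto)
  then obtain k where k: "k \<in> hom VC (To Y) (To W)" "k \<odot>\<^bsub>VC\<^esub> Ta e = Ta e'"
    using VC_factor_surj[OF Te fn_surj[OF e] Te'] by metis
  have "is_iso VC (Ta q)"
  proof (rule D.pushout_leg_iso[OF preserves_pushout[OF e(1) em(1) po] D.E_epi])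
    show "Ta e \<in> surjective" using e(1) map_E by blast
    show "k \<in> hom VC (Cod VC (Ta e)) (Cod VC (Ta e'))"
      using k(1) VC_homD(5)[OF Te] VC_homD(5)[OF Te'] by simp
  qed (rule k(2))
  then obtain r where r: "r \<in> hom C (Cod C p) W" "r \<odot>\<^bsub>C\<^esub> q = Idt C W"
    using C.isoE[OF conservative[OF C.homD(1)[OF q]] q] by blast
  have e'_eq: "(r \<odot>\<^bsub>C\<^esub> p) \<odot>\<^bsub>C\<^esub> e = e'"
    using C.comp_assoc[OF e(2) p r(1)] C.comp_assoc[OF em(3) q r(1)] eq r(2) C.idt_comp[OF em(3)]
    by simp
  have rp: "r \<odot>\<^bsub>C\<^esub> p \<in> hom C Y W" by (rule C.comp_hom[OF p r(1)])
  let ?h = "m \<odot>\<^bsub>C\<^esub> (r \<odot>\<^bsub>C\<^esub> p)"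
  have h: "?h \<in> hom C Y Z" by (rule C.comp_hom[OF rp em(4)])
  have "g = ?h \<odot>\<^bsub>C\<^esub> e" using C.comp_assoc[OF e(2) rp em(4)] e'_eq em(5) by simp
  then show ?thesis using h C.E_cancel[OF e _ h] by metis
qed

text \<open>Dual: with \<open>f = m' e\<close>, the image of \<open>m'\<close> is that of
  \<open>f\<close>, since \<open>e\<close> acts surjectively, so \<open>Ta m'\<close> factors
  through \<open>Ta m\<close>. The leg \<open>q\<close> of the pullback is then invertible in
  \<open>C\<close>, and its inverse followed by \<open>p\<close> factors \<open>m'\<close> through
  \<open>m\<close>.\<close>

lemma M_factor:
  assumes m: "m \<in> M" "m \<in> hom C X Y" and f: "f \<in> hom C Z Y"
    and im: "fn f ` pts Z \<subseteq> fn m ` pts X"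
  shows "\<exists>!h. h \<in> hom C Z X \<and> f = m \<odot>\<^bsub>C\<^esub> h"
proof -
  obtain e m' W where em: "e \<in> E" "m' \<in> M" "e \<in> hom C Z W" "m' \<in> hom C W Y" "f = m' \<odot>\<^bsub>C\<^esub> e"
    using C.factorE[OF f] .
  obtain p q where pb: "is_pullback C m m' p q"
    using C.pullback_exists[OF m(1) em(2)] C.homD(3)[OF m(2)] C.homD(3)[OF em(4)] by auto
  have p: "p \<in> hom C (Dom C p) X" and q: "q \<in> hom C (Dom C p) W" and eq: "m \<odot>\<^bsub>C\<^esub> p = m' \<odot>\<^bsub>C\<^esub> q"
    using pb C.homD(2)[OF m(2)] C.homD(2)[OF em(4)] unfolding is_pullback_def by auto
  note Tm = map_hom[OF m(2)] and Tm' = map_hom[OF em(4)]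
  have "fn m' ` pts W = fn f ` pts Z"
    unfolding fn_surj[OF em(1,3), symmetric] em(5)
    using fn_comp[OF em(3,4)] by (simp add: image_image)
  then obtain k where k: "k \<in> hom VC (To W) (To X)" "Ta m \<odot>\<^bsub>VC\<^esub> k = Ta m'"
    using VC_factor_inj[OF Tm fn_inj[OF m] Tm'] im by metis
  have "is_iso VC (Ta q)"
  proof (rule D.pullback_leg_iso[OF preserves_pullback[OF m(1) em(2) pb] D.M_mono])
    show "Ta m \<in> injective" using m(1) map_M by blast
    show "k \<in> hom VC (Dom VC (Ta m')) (Dom VC (Ta m))"
      using k(1) VC_homD(4)[OF Tm] VC_homD(4)[OF Tm'] by simp
  qed (rule k(2))
  then obtain r where r: "r \<in> hom C W (Dom C p)" "q \<odot>\<^bsub>C\<^esub> r = Idt C W"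
    using C.isoE[OF conservative[OF C.homD(1)[OF q]] q] by blast
  have pr: "p \<odot>\<^bsub>C\<^esub> r \<in> hom C W X" by (rule C.comp_hom[OF r(1) p])
  have m'_eq: "m \<odot>\<^bsub>C\<^esub> (p \<odot>\<^bsub>C\<^esub> r) = m'"
    using C.comp_assoc[OF r(1) p m(2)] C.comp_assoc[OF r(1) q em(4)] eq r(2) C.comp_idt[OF em(4)]
    by simp
  let ?h = "(p \<odot>\<^bsub>C\<^esub> r) \<odot>\<^bsub>C\<^esub> e"
  have h: "?h \<in> hom C Z X" by (rule C.comp_hom[OF em(3) pr])
  have "f = m \<odot>\<^bsub>C\<^esub> ?h" using C.comp_assoc[OF em(3) pr m(2)] m'_eq em(5) by simp
  then show ?thesis using h C.M_cancel[OF m _ h] by metis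
qed

section \<open>Images and kernels in the subgroup form\<close>

lemma dir_img_F:
  "f \<in> hom C X Y \<Longrightarrow> dir_img F f a = enc (pts Y) (linear_map (fn f) ` dec (pts X) a)"
  by (simp add: F_def C.homD)

lemma inv_img_F:
  "f \<in> hom C X Y \<Longrightarrow>
   inv_img F f b = enc (pts X) {c \<in> frags (pts X). linear_map (fn f) c \<in> dec (pts Y) b}"
  by (simp add: F_def C.homD)

lemma dir_subgroup:
  assumes f: "f \<in> hom C X Y" and a: "a \<in> carrier (subgroup_lattice (pts X))"
  shows "dir_img F f a \<in> carrier (subgroup_lattice (pts Y))"
    and "dec (pts Y) (dir_img F f a) = linear_map (fn f) ` dec (pts X) a"
  unfolding dir_img_F[OF f]
  using image_subgroup[OF fn_image[OF f] dec_subgroup[OF a]]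
  by (rule enc_carrier, rule small_subgroup_lattice.dec_enc[OF lattice_pts[OF C.hom_objs(2)[OF f]]])

lemma inv_subgroup:
  assumes f: "f \<in> hom C X Y" and b: "b \<in> carrier (subgroup_lattice (pts Y))"
  shows "inv_img F f b \<in> carrier (subgroup_lattice (pts X))"
    and "dec (pts X) (inv_img F f b) = {c \<in> frags (pts X). linear_map (fn f) c \<in> dec (pts Y) b}"
  unfolding inv_img_F[OF f]
  using vimage_subgroup[OF dec_subgroup[OF b], of "pts X" "fn f"]
  by (rule enc_carrier, rule small_subgroup_lattice.dec_enc[OF lattice_pts[OF C.hom_objs(1)[OF f]]])

lemma top_bot_pts:
  assumes "X \<in> Obj C"
  shows "\<top>\<^bsub>subgroup_lattice (pts X)\<^esub> \<in> carrier (subgroup_lattice (pts X))"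
    and "\<bottom>\<^bsub>subgroup_lattice (pts X)\<^esub> \<in> carrier (subgroup_lattice (pts X))"
proof -
  interpret small_subgroup_lattice "pts X" by (rule lattice_pts[OF assms])
  interpret bounded_lattice L by (rule L_bounded_lattice)
  show "\<top>\<^bsub>L\<^esub> \<in> carrier L" "\<bottom>\<^bsub>L\<^esub> \<in> carrier L" by (rule top_closed, rule bottom_closed)
qed

lemma Im_F:
  assumes f: "f \<in> hom C X Y"
  shows "Im C F f \<in> carrier (subgroup_lattice (pts Y))"
    and "dec (pts Y) (Im C F f) = frags (fn f ` pts X)"
proof -
  note top = top_bot_pts(1)[OF C.hom_objs(1)[OF f]]
  show "Im C F f \<in> carrier (subgroup_lattice (pts Y))"
    using dir_subgroup(1)[OF f top] by (simp add: Im_def C.homD[OF f])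
  show "dec (pts Y) (Im C F f) = frags (fn f ` pts X)"
    using dir_subgroup(2)[OF f top] small_subgroup_lattice.dec_top[OF lattice_pts[OF C.hom_objs(1)[OF f]]]
    by (simp add: Im_def C.homD[OF f] linear_map_image_frags)
qed

lemma Ker_F:
  assumes f: "f \<in> hom C X Y"
  shows "Ker C F f \<in> carrier (subgroup_lattice (pts X))"
    and "dec (pts X) (Ker C F f) = frag_kernel (pts X) (fn f)"
proof -
  note bot = top_bot_pts(2)[OF C.hom_objs(2)[OF f]]
  show "Ker C F f \<in> carrier (subgroup_lattice (pts X))"
    using inv_subgroup(1)[OF f bot] by (simp add: Ker_def C.homD[OF f])
  show "dec (pts X) (Ker C F f) = frag_kernel (pts X) (fn f)"
    using inv_subgroup(2)[OF f bot] small_subgroup_lattice.dec_bot[OF lattice_pts[OF C.hom_objs(2)[OF f]]]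
    by (simp add: Ker_def C.homD[OF f] frag_kernel_def)
qed

text \<open>An injective map induces an injective linear map, so \<open>m\<close> adds nothing to
  the kernel. Together with \<open>Im_factor\<close> this reduces all kernels and images to those of
  arrows in \<open>E\<close> and \<open>M\<close>, for which pushouts and pullbacks exist.\<close>

lemma Ker_factor:
  assumes "e \<in> hom C X Z" "m \<in> M" "m \<in> hom C Z Y"
  shows "Ker C F (m \<odot>\<^bsub>C\<^esub> e) = Ker C F e"
proof (rule subgroup_lattice_eqI)
  note f = C.comp_hom[OF assms(1,3)]
  show "Ker C F (m \<odot>\<^bsub>C\<^esub> e) \<in> carrier (subgroup_lattice (pts X))" by (rule Ker_F(1)[OF f])
  show "Ker C F e \<in> carrier (subgroup_lattice (pts X))" by (rule Ker_F(1)[OF assms(1)])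
  show "dec (pts X) (Ker C F (m \<odot>\<^bsub>C\<^esub> e)) = dec (pts X) (Ker C F e)"
    unfolding Ker_F(2)[OF f] Ker_F(2)[OF assms(1)]
    using frag_kernel_cong[of "pts X" "fn (m \<odot>\<^bsub>C\<^esub> e)" "\<lambda>x. fn m (fn e x)"] fn_comp[OF assms(1,3)]
      frag_kernel_inj_comp[OF fn_inj[OF assms(2,3)] fn_image[OF assms(1)]] by simp
qed

lemma Im_factor:
  assumes "e \<in> E" "e \<in> hom C X Z" "m \<in> hom C Z Y"
  shows "Im C F (m \<odot>\<^bsub>C\<^esub> e) = Im C F m"
proof (rule subgroup_lattice_eqI)
  note f = C.comp_hom[OF assms(2,3)]
  show "Im C F (m \<odot>\<^bsub>C\<^esub> e) \<in> carrier (subgroup_lattice (pts Y))" by (rule Im_F(1)[OF f])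
  show "Im C F m \<in> carrier (subgroup_lattice (pts Y))" by (rule Im_F(1)[OF assms(3)])
  show "dec (pts Y) (Im C F (m \<odot>\<^bsub>C\<^esub> e)) = dec (pts Y) (Im C F m)"
    unfolding Im_F(2)[OF f] Im_F(2)[OF assms(3)] fn_surj[OF assms(1,2), symmetric]
    using fn_comp[OF assms(2,3)] by (simp add: image_image)
qed

text \<open>An inclusion of linear kernels, tested on differences of generators, is the pointwise
  hypothesis of \<open>E_factor\<close>.\<close>

lemma E_quotient_of:
  assumes e: "e \<in> E" "e \<in> hom C X Y"
  shows "quotient_of C F X (Ker C F e) e"
  unfolding quotient_of_def C.homD[OF e(2)]
proof (intro conjI ballI impI)
  show "normal C F X (Ker C F e)" using C.homD[OF e(2)] by (auto simp: normal_def)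
  fix g assume "g \<in> Arr C" and g: "Dom C g = X \<and> Ker C F e \<sqsubseteq>\<^bsub>fib F X\<^esub> Ker C F g"
  then have g_hom: "g \<in> hom C X (Cod C g)" by (simp add: hom_def)
  have "frag_kernel (pts X) (fn e) \<subseteq> frag_kernel (pts X) (fn g)"
    using g Ker_F(2)[OF e(2)] Ker_F(2)[OF g_hom] by simp
  from frag_kernel_subset_imp[OF this]
  show "\<exists>!h. h \<in> hom C Y (Cod C g) \<and> g = h \<odot>\<^bsub>C\<^esub> e" by (rule E_factor[OF e g_hom])
qed (use C.homD[OF e(2)] in simp_all)

text \<open>Chains supported on a set determine the set, so the order of images in the fibre is
  inclusion of point sets, as \<open>M_factor\<close> asks.\<close>

lemma M_embedding_of:
  assumes m: "m \<in> M" "m \<in> hom C X Y"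
  shows "embedding_of C F Y (Im C F m) m"
  unfolding embedding_of_def C.homD[OF m(2)]
proof (intro conjI ballI impI)
  show "conormal C F Y (Im C F m)" using C.homD[OF m(2)] by (auto simp: conormal_def)
  fix f assume "f \<in> Arr C" and f: "Cod C f = Y \<and> Im C F f \<sqsubseteq>\<^bsub>fib F Y\<^esub> Im C F m"
  then have f_hom: "f \<in> hom C (Dom C f) Y" by (simp add: hom_def)
  have "fn f ` pts (Dom C f) \<subseteq> fn m ` pts X"
    using f Im_F(2)[OF m(2)] Im_F(2)[OF f_hom] by (simp add: frags_subset_iff)
  then show "\<exists>!h. h \<in> hom C (Dom C f) X \<and> f = m \<odot>\<^bsub>C\<^esub> h" by (rule M_factor[OF m f_hom])
qed (use C.homD[OF m(2)] in simp_all)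

text \<open>The functor laws hold for the underlying maps only on carriers, so the equations are
  checked on chains supported there.\<close>

lemma F_orean_form: "orean_form TYPE('u) C F"
proof (intro orean_form.intro orean_form_axioms.intro)
  show "locally_small_category TYPE('u) C" by unfold_locales
next
  fix X assume X: "X \<in> Obj C"
  show "bounded_lattice (fib F X)"
    using small_subgroup_lattice.L_bounded_lattice[OF lattice_pts[OF X]] by simp
  show "small TYPE('u) (carrier (fib F X))"
    using small_subgroup_lattice.small_carrier[OF lattice_pts[OF X]] by simp
  fix S assume "S \<in> carrier (fib F X)"
  then have S: "S \<in> carrier (subgroup_lattice (pts X))" by simp
  note id = C.idt_hom[OF X] and SX = subgroupsD(1)[OF dec_subgroup[OF S]]
  have lin: "linear_map (fn (Idt C X)) c = c" if "c \<in> frags (pts X)" for c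
    using linear_map_ident[OF _ that] fn_idt[OF X] by blast
  have "linear_map (fn (Idt C X)) ` dec (pts X) S = (\<lambda>c. c) ` dec (pts X) S"
    by (rule image_cong[OF refl]) (use lin SX in blast)
  then have dir: "linear_map (fn (Idt C X)) ` dec (pts X) S = dec (pts X) S" by simp
  show "dir_img F (Idt C X) S = S"
    by (rule subgroup_lattice_eqI[OF dir_subgroup(1)[OF id S] S]) (simp add: dir_subgroup(2)[OF id S] dir)
  have inv: "{c \<in> frags (pts X). linear_map (fn (Idt C X)) c \<in> dec (pts X) S} = dec (pts X) S"
    using lin SX by auto
  show "inv_img F (Idt C X) S = S"
    by (rule subgroup_lattice_eqI[OF inv_subgroup(1)[OF id S] S]) (simp add: inv_subgroup(2)[OF id S] inv)
next
  fix f X Y assume f: "f \<in> hom C X Y"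
  show "dir_img F f \<in> carrier (fib F X) \<rightarrow> carrier (fib F Y)"
    using dir_subgroup(1)[OF f] by simp
  show "inv_img F f \<in> carrier (fib F Y) \<rightarrow> carrier (fib F X)"
    using inv_subgroup(1)[OF f] by simp
  have wpo: "weak_partial_order (fib F Z)" if "Z \<in> Obj C" for Z
  proof -
    interpret bounded_lattice "fib F Z"
      using small_subgroup_lattice.L_bounded_lattice[OF lattice_pts[OF that]] by simp
    show ?thesis ..
  qed
  show "isotone (fib F X) (fib F Y) (dir_img F f)"
    using dir_subgroup(2)[OF f] by (intro isotoneI wpo C.hom_objs[OF f]) auto
  show "isotone (fib F Y) (fib F X) (inv_img F f)"
    using inv_subgroup(2)[OF f] by (intro isotoneI wpo C.hom_objs[OF f]) auto
  fix S T assume "S \<in> carrier (fib F X)" "T \<in> carrier (fib F Y)"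
  then have S: "S \<in> carrier (subgroup_lattice (pts X))" and T: "T \<in> carrier (subgroup_lattice (pts Y))"
    by simp_all
  show "dir_img F f S \<sqsubseteq>\<^bsub>fib F Y\<^esub> T \<longleftrightarrow> S \<sqsubseteq>\<^bsub>fib F X\<^esub> inv_img F f T"
    using subgroupsD(1)[OF dec_subgroup[OF S]]
    by (auto simp: dir_subgroup(2)[OF f S] inv_subgroup(2)[OF f T])
next
  fix f g X Y Z assume f: "f \<in> hom C X Y" and g: "g \<in> hom C Y Z"
  note gf = C.comp_hom[OF f g]
  have lin: "linear_map (fn (g \<odot>\<^bsub>C\<^esub> f)) c = linear_map (fn g) (linear_map (fn f) c)"
    if "c \<in> frags (pts X)" for c
    unfolding linear_map_comp by (rule linear_map_cong[OF fn_comp[OF f g] that])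
  fix S assume "S \<in> carrier (fib F X)"
  then have S: "S \<in> carrier (subgroup_lattice (pts X))" by simp
  show "dir_img F (g \<odot>\<^bsub>C\<^esub> f) S = dir_img F g (dir_img F f S)"
  proof (rule subgroup_lattice_eqI[OF dir_subgroup(1)[OF gf S]])
    show "dir_img F g (dir_img F f S) \<in> carrier (subgroup_lattice (pts Z))"
      by (rule dir_subgroup(1)[OF g dir_subgroup(1)[OF f S]])
    have "linear_map (fn (g \<odot>\<^bsub>C\<^esub> f)) ` dec (pts X) S =
        (\<lambda>c. linear_map (fn g) (linear_map (fn f) c)) ` dec (pts X) S"
      by (rule image_cong[OF refl]) (use lin subgroupsD(1)[OF dec_subgroup[OF S]] in blast)
    then show "dec (pts Z) (dir_img F (g \<odot>\<^bsub>C\<^esub> f) S) = dec (pts Z) (dir_img F g (dir_img F f S))"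
      by (simp add: dir_subgroup(2)[OF gf S] dir_subgroup(2)[OF g dir_subgroup(1)[OF f S]]
          dir_subgroup(2)[OF f S] image_image)
  qed
next
  fix f g X Y Z assume f: "f \<in> hom C X Y" and g: "g \<in> hom C Y Z"
  note gf = C.comp_hom[OF f g]
  have lin: "linear_map (fn (g \<odot>\<^bsub>C\<^esub> f)) c = linear_map (fn g) (linear_map (fn f) c)"
    if "c \<in> frags (pts X)" for c
    unfolding linear_map_comp by (rule linear_map_cong[OF fn_comp[OF f g] that])
  fix T assume "T \<in> carrier (fib F Z)"
  then have T: "T \<in> carrier (subgroup_lattice (pts Z))" by simp
  show "inv_img F (g \<odot>\<^bsub>C\<^esub> f) T = inv_img F f (inv_img F g T)"
  proof (rule subgroup_lattice_eqI[OF inv_subgroup(1)[OF gf T]])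
    show "inv_img F f (inv_img F g T) \<in> carrier (subgroup_lattice (pts X))"
      by (rule inv_subgroup(1)[OF f inv_subgroup(1)[OF g T]])
    show "dec (pts X) (inv_img F (g \<odot>\<^bsub>C\<^esub> f) T) = dec (pts X) (inv_img F f (inv_img F g T))"
      using lin linear_map_frags[OF fn_image[OF f]]
      by (auto simp: inv_subgroup(2)[OF gf T] inv_subgroup(2)[OF f inv_subgroup(1)[OF g T]]
          inv_subgroup(2)[OF g T])
  qed
qed

section \<open>Normal and conormal clusters\<close>

lemma conormal_iff_M:
  assumes "Y \<in> Obj C"
  shows "conormal C F Y S \<longleftrightarrow> (\<exists>m X. m \<in> M \<and> m \<in> hom C X Y \<and> S = Im C F m)"
proof
  assume "conormal C F Y S"
  then obtain f where f: "f \<in> hom C (Dom C f) Y" "S = Im C F f"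
    unfolding conormal_def by (auto simp: hom_def)
  obtain e m Z where "e \<in> E" "m \<in> M" "e \<in> hom C (Dom C f) Z" "m \<in> hom C Z Y" "f = m \<odot>\<^bsub>C\<^esub> e"
    using C.factorE[OF f(1)] .
  then show "\<exists>m X. m \<in> M \<and> m \<in> hom C X Y \<and> S = Im C F m" using Im_factor f(2) by blast
next
  assume "\<exists>m X. m \<in> M \<and> m \<in> hom C X Y \<and> S = Im C F m"
  then show "conormal C F Y S" using C.homD by (metis conormal_def)
qed

lemma normal_iff_E:
  assumes "X \<in> Obj C"
  shows "normal C F X K \<longleftrightarrow> (\<exists>e Y. e \<in> E \<and> e \<in> hom C X Y \<and> K = Ker C F e)"
proof
  assume "normal C F X K"
  then obtain f where f: "f \<in> hom C X (Cod C f)" "K = Ker C F f"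
    unfolding normal_def by (auto simp: hom_def)
  obtain e m Z where "e \<in> E" "m \<in> M" "e \<in> hom C X Z" "m \<in> hom C Z (Cod C f)" "f = m \<odot>\<^bsub>C\<^esub> e"
    using C.factorE[OF f(1)] .
  then show "\<exists>e Y. e \<in> E \<and> e \<in> hom C X Y \<and> K = Ker C F e" using Ker_factor f(2) by blast
next
  assume "\<exists>e Y. e \<in> E \<and> e \<in> hom C X Y \<and> K = Ker C F e"
  then show "normal C F X K" using C.homD by (metis normal_def)
qed

text \<open>The join is the kernel of the diagonal of the pushout in \<open>C\<close>. The functor
  preserves that pushout, so \<open>VC_pushout_kernel\<close> links identified points by chains of
  the two kernels, and \<open>frag_kernel_join_eq\<close> converts these chains into a sum of
  subgroups.\<close>

lemma normal_join:
  assumes X: "X \<in> Obj C" and KL: "normal C F X K" "normal C F X K'"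
  shows "normal C F X (K \<squnion>\<^bsub>fib F X\<^esub> K')"
proof -
  obtain e Y where e: "e \<in> E" "e \<in> hom C X Y" "K = Ker C F e"
    using KL(1) normal_iff_E[OF X] by blast
  obtain e' Y' where e': "e' \<in> E" "e' \<in> hom C X Y'" "K' = Ker C F e'"
    using KL(2) normal_iff_E[OF X] by blast
  obtain p q where po: "is_pushout C e e' p q"
    using C.pushout_exists[OF e(1) e'(1)] C.homD(2)[OF e(2)] C.homD(2)[OF e'(2)] by auto
  have p: "p \<in> hom C Y (Cod C p)" and q: "q \<in> hom C Y' (Cod C p)" and eq: "p \<odot>\<^bsub>C\<^esub> e = q \<odot>\<^bsub>C\<^esub> e'"
    using po C.homD(3)[OF e(2)] C.homD(3)[OF e'(2)] unfolding is_pushout_def by auto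
  let ?r = "p \<odot>\<^bsub>C\<^esub> e"
  note r = C.comp_hom[OF e(2) p]
  have r_e: "fn ?r x = fn p (fn e x)" and r_e': "fn ?r x = fn q (fn e' x)" if "x \<in> pts X" for x
    using fn_comp[OF e(2) p that] fn_comp[OF e'(2) q that] eq by simp_all
  have fst: "fst (Ta e) = To X" "fst (Ta e') = To X"
    using VC_homD(4) map_hom[OF e(2)] map_hom[OF e'(2)] by auto
  interpret small_subgroup_lattice "pts X" by (rule lattice_pts[OF X])
  interpret bounded_lattice L by (rule L_bounded_lattice)
  note Ker = Ker_F(1)[OF e(2)] Ker_F(1)[OF e'(2)]
  have "group_sum (frag_kernel (pts X) (fn e)) (frag_kernel (pts X) (fn e')) = frag_kernel (pts X) (fn ?r)"
  proof (rule frag_kernel_join_eq)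
    show "(x, y) \<in> ({(x, y). x \<in> pts X \<and> y \<in> pts X \<and> fn e x = fn e y} \<union>
        {(x, y). x \<in> pts X \<and> y \<in> pts X \<and> fn e' x = fn e' y})\<^sup>*"
      if xy: "x \<in> pts X" "y \<in> pts X" "fn ?r x = fn ?r y" for x y
    proof -
      have "(x, y) \<in> (kernel_pair (Ta e) \<union> kernel_pair (Ta e'))\<^sup>*"
      proof (rule VC_pushout_kernel[OF preserves_pushout[OF e(1) e'(1) po]])
        show "Ta e \<in> surjective" "Ta e' \<in> surjective" using e(1) e'(1) map_E by auto
        show "ap (Ta p) (ap (Ta e) x) = ap (Ta p) (ap (Ta e) y)" using xy r_e by simp
      qed (use xy fst in simp_all)
      then show ?thesis by (simp add: kernel_pair_def fst)
    qed
    show "frag_kernel (pts X) (fn e) \<subseteq> frag_kernel (pts X) (fn ?r)"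
      using frag_kernel_comp[of "pts X" "fn e" "fn p"] frag_kernel_cong[of "pts X" "fn ?r"] r_e by metis
    show "frag_kernel (pts X) (fn e') \<subseteq> frag_kernel (pts X) (fn ?r)"
      using frag_kernel_comp[of "pts X" "fn e'" "fn q"] frag_kernel_cong[of "pts X" "fn ?r"] r_e' by metis
  qed
  then have "dec (pts X) (Ker C F e \<squnion>\<^bsub>L\<^esub> Ker C F e') = dec (pts X) (Ker C F ?r)"
    using dec_join[OF Ker] Ker_F(2)[OF e(2)] Ker_F(2)[OF e'(2)] Ker_F(2)[OF r] by simp
  then have "Ker C F e \<squnion>\<^bsub>L\<^esub> Ker C F e' = Ker C F ?r"
    by (rule subgroup_lattice_eqI[OF join_closed[OF Ker] Ker_F(1)[OF r]])
  then show ?thesis using C.homD[OF r] e(3) e'(3) by (auto simp: normal_def)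
qed

text \<open>The meet is the image of the diagonal of the pullback in \<open>C\<close>: by
  \<open>VC_pullback_points\<close> it attains every common point of the two images, and passing to
  supported chains commutes with intersections.\<close>

lemma conormal_meet:
  assumes Y: "Y \<in> Obj C" and ST: "conormal C F Y S" "conormal C F Y S'"
  shows "conormal C F Y (S \<sqinter>\<^bsub>fib F Y\<^esub> S')"
proof -
  obtain m X where m: "m \<in> M" "m \<in> hom C X Y" "S = Im C F m"
    using ST(1) conormal_iff_M[OF Y] by blast
  obtain m' X' where m': "m' \<in> M" "m' \<in> hom C X' Y" "S' = Im C F m'"
    using ST(2) conormal_iff_M[OF Y] by blast
  obtain p q where pb: "is_pullback C m m' p q"
    using C.pullback_exists[OF m(1) m'(1)] C.homD(3)[OF m(2)] C.homD(3)[OF m'(2)] by auto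
  have p: "p \<in> hom C (Dom C p) X" and q: "q \<in> hom C (Dom C p) X'" and eq: "m \<odot>\<^bsub>C\<^esub> p = m' \<odot>\<^bsub>C\<^esub> q"
    using pb C.homD(2)[OF m(2)] C.homD(2)[OF m'(2)] unfolding is_pullback_def by auto
  let ?r = "m \<odot>\<^bsub>C\<^esub> p" and ?P = "Dom C p"
  note r = C.comp_hom[OF p m(2)]
  have r_m: "fn ?r x = fn m (fn p x)" and r_m': "fn ?r x = fn m' (fn q x)" if "x \<in> pts ?P" for x
    using fn_comp[OF p m(2) that] fn_comp[OF q m'(2) that] eq by simp_all
  have fst: "fst (Ta m) = To X" "fst (Ta m') = To X'" "fst (Ta p) = To ?P"
    using VC_homD(4) map_hom[OF m(2)] map_hom[OF m'(2)] map_hom[OF p] by auto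
  interpret small_subgroup_lattice "pts Y" by (rule lattice_pts[OF Y])
  interpret bounded_lattice L by (rule L_bounded_lattice)
  note Im = Im_F(1)[OF m(2)] Im_F(1)[OF m'(2)]
  have "fn m ` pts X \<inter> fn m' ` pts X' = fn ?r ` pts ?P"
  proof
    show "fn ?r ` pts ?P \<subseteq> fn m ` pts X \<inter> fn m' ` pts X'"
    proof
      fix y assume "y \<in> fn ?r ` pts ?P"
      then obtain z where z: "z \<in> pts ?P" "y = fn ?r z" by blast
      show "y \<in> fn m ` pts X \<inter> fn m' ` pts X'"
        using z r_m[OF z(1)] r_m'[OF z(1)] fn_image[OF p] fn_image[OF q] by blast
    qed
    show "fn m ` pts X \<inter> fn m' ` pts X' \<subseteq> fn ?r ` pts ?P"
    proof
      fix y assume "y \<in> fn m ` pts X \<inter> fn m' ` pts X'"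
      then obtain x x' where x: "x \<in> pts X" "x' \<in> pts X'" "y = fn m x" "fn m x = fn m' x'"
        by blast
      have "x \<in> ap (Ta p) ` carrier (fst (Ta p))"
      proof (rule VC_pullback_points[OF preserves_pullback[OF m(1) m'(1) pb]])
        show "Ta m \<in> injective" "Ta m' \<in> injective" using m(1) m'(1) map_M by auto
      qed (use x fst in simp_all)
      then obtain z where "z \<in> pts ?P" "x = fn p z" using fst by auto
      then show "y \<in> fn ?r ` pts ?P" using r_m x(3) by (intro image_eqI[of _ _ z]) simp_all
    qed
  qed
  then have "dec (pts Y) (Im C F m \<sqinter>\<^bsub>L\<^esub> Im C F m') = dec (pts Y) (Im C F ?r)"
    using dec_meet[OF Im] Im_F(2)[OF m(2)] Im_F(2)[OF m'(2)] Im_F(2)[OF r] by (simp add: frags_Int)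
  then have "Im C F m \<sqinter>\<^bsub>L\<^esub> Im C F m' = Im C F ?r"
    by (rule subgroup_lattice_eqI[OF meet_closed[OF Im] Im_F(1)[OF r]])
  then show ?thesis using C.homD[OF r] m(3) m'(3) by (auto simp: conormal_def)
qed

text \<open>(N1) is the calculus of subgroups under linear maps. (N2) comes from the given
  factorization system, whose two parts carry the kernel and the image of \<open>f\<close>.\<close>

lemma F_noetherian_form: "noetherian_form TYPE('u) C F"
proof -
  interpret orean_form "TYPE('u)" C F by (rule F_orean_form)
  show ?thesis
  proof
    fix f X Y assume f: "f \<in> hom C X Y"
    note X = C.hom_objs(1)[OF f] and Y = C.hom_objs(2)[OF f]
    interpret LX: small_subgroup_lattice "pts X" by (rule lattice_pts[OF X])
    interpret LY: small_subgroup_lattice "pts Y" by (rule lattice_pts[OF Y])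
    interpret BX: bounded_lattice LX.L by (rule LX.L_bounded_lattice)
    interpret BY: bounded_lattice LY.L by (rule LY.L_bounded_lattice)
    fix S assume "S \<in> carrier (fib F X)"
    then have S: "S \<in> carrier LX.L" by simp
    note fS = dir_subgroup[OF f S]
    have "dec (pts X) (inv_img F f (dir_img F f S)) = dec (pts X) (S \<squnion>\<^bsub>LX.L\<^esub> Ker C F f)"
      using inv_subgroup(2)[OF f fS(1)] fS(2) LX.dec_join[OF S Ker_F(1)[OF f]] Ker_F(2)[OF f]
        vimage_image_subgroup[OF dec_subgroup[OF S], of "fn f"] by simp
    then show "inv_img F f (dir_img F f S) = S \<squnion>\<^bsub>fib F X\<^esub> Ker C F f"
      using subgroup_lattice_eqI[OF inv_subgroup(1)[OF f fS(1)] BX.join_closed[OF S Ker_F(1)[OF f]]]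
      by simp
  next
    fix f X Y assume f: "f \<in> hom C X Y"
    note X = C.hom_objs(1)[OF f] and Y = C.hom_objs(2)[OF f]
    interpret LY: small_subgroup_lattice "pts Y" by (rule lattice_pts[OF Y])
    interpret BY: bounded_lattice LY.L by (rule LY.L_bounded_lattice)
    fix T assume "T \<in> carrier (fib F Y)"
    then have T: "T \<in> carrier LY.L" by simp
    note fT = inv_subgroup[OF f T]
    have "dec (pts Y) (dir_img F f (inv_img F f T)) = dec (pts Y) (T \<sqinter>\<^bsub>LY.L\<^esub> Im C F f)"
      using dir_subgroup(2)[OF f fT(1)] fT(2) LY.dec_meet[OF T Im_F(1)[OF f]] Im_F(2)[OF f]
        image_vimage_subgroup[of "fn f" "pts X" "dec (pts Y) T"] by simp
    then show "dir_img F f (inv_img F f T) = T \<sqinter>\<^bsub>fib F Y\<^esub> Im C F f"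
      using subgroup_lattice_eqI[OF dir_subgroup(1)[OF f fT(1)] BY.meet_closed[OF T Im_F(1)[OF f]]]
      by simp
  next
    fix f X Y assume f: "f \<in> hom C X Y"
    obtain e m Z where em: "e \<in> E" "m \<in> M" "e \<in> hom C X Z" "m \<in> hom C Z Y" "f = m \<odot>\<^bsub>C\<^esub> e"
      using C.factorE[OF f] .
    have "Ker C F f = Ker C F e" "Im C F f = Im C F m"
      using Ker_factor[OF em(3,2,4)] Im_factor[OF em(1,3,4)] em(5) by simp_all
    then show "\<exists>e m. quotient_of C F X (Ker C F f) e \<and> embedding_of C F Y (Im C F f) m \<and>
        Cod C e = Dom C m \<and> f = m \<odot>\<^bsub>C\<^esub> e"
      using E_quotient_of[OF em(1,3)] M_embedding_of[OF em(2,4)] C.homD(3)[OF em(3)] C.homD(2)[OF em(4)]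
        em(5) by (intro exI[of _ e] exI[of _ m]) simp
  qed (fact normal_join conormal_meet)+
qed

text \<open>For the harder inclusion, factor a quotient \<open>e\<close> of the form as
  \<open>m e'\<close>. The kernel of \<open>e'\<close> is that of \<open>e\<close>, so
  \<open>e' = h e\<close>; uniqueness in the universal property makes \<open>m h\<close> the
  identity, and \<open>m\<close> being a monomorphism does the same for \<open>h m\<close>. So
  \<open>m\<close> is invertible and \<open>e\<close> lies in \<open>E\<close>.\<close>

lemma quotients_F: "quotients C F = E"
proof (intro equalityI subsetI)
  fix e assume e: "e \<in> E"
  then have "e \<in> hom C (Dom C e) (Cod C e)" using C.E_arr by (auto simp: hom_def)
  then show "e \<in> quotients C F"
    unfolding quotients_def using E_quotient_of[OF e] C.hom_objs(1) by blast
next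
  fix e assume "e \<in> quotients C F"
  then obtain X K where X: "X \<in> Obj C" and q: "quotient_of C F X K e"
    unfolding quotients_def by blast
  let ?Y = "Cod C e"
  have e: "e \<in> hom C X ?Y" and K: "K = Ker C F e"
    using q by (auto simp: quotient_of_def hom_def)
  have univ: "\<exists>!h. h \<in> hom C ?Y Z \<and> g = h \<odot>\<^bsub>C\<^esub> e"
    if "g \<in> hom C X Z" "K \<sqsubseteq>\<^bsub>fib F X\<^esub> Ker C F g" for g Z
  proof -
    have "\<exists>!h. h \<in> hom C ?Y (Cod C g) \<and> g = h \<odot>\<^bsub>C\<^esub> e"
      using q that(2) C.homD(1,2)[OF that(1)] unfolding quotient_of_def by blast
    then show ?thesis by (simp only: C.homD(3)[OF that(1)])
  qed
  obtain e' m Z where em: "e' \<in> E" "m \<in> M" "e' \<in> hom C X Z" "m \<in> hom C Z ?Y" "e = m \<odot>\<^bsub>C\<^esub> e'"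
    using C.factorE[OF e] .
  have "Ker C F e' = K" using Ker_factor[OF em(3,2,4)] em(5) K by simp
  then have "K \<sqsubseteq>\<^bsub>fib F X\<^esub> Ker C F e'" by simp
  then obtain h where h: "h \<in> hom C ?Y Z" "e' = h \<odot>\<^bsub>C\<^esub> e" using univ[OF em(3)] by blast
  have Y: "?Y \<in> Obj C" by (rule C.hom_objs(2)[OF e])
  have mh: "m \<odot>\<^bsub>C\<^esub> h \<in> hom C ?Y ?Y" by (rule C.comp_hom[OF h(1) em(4)])
  have "e = (m \<odot>\<^bsub>C\<^esub> h) \<odot>\<^bsub>C\<^esub> e"
    unfolding C.comp_assoc[OF e h(1) em(4)] h(2)[symmetric] em(5)[symmetric] ..
  moreover have "K \<sqsubseteq>\<^bsub>fib F X\<^esub> Ker C F e" using K by simp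
  ultimately have mh_id: "m \<odot>\<^bsub>C\<^esub> h = Idt C ?Y"
    using univ[OF e] C.idt_hom[OF Y] C.idt_comp[OF e, symmetric] mh by blast
  have Z: "Z \<in> Obj C" by (rule C.hom_objs(2)[OF em(3)])
  have "h \<odot>\<^bsub>C\<^esub> m = Idt C Z"
    by (rule C.M_cancel[OF em(2,4) C.comp_hom[OF em(4) h(1)] C.idt_hom[OF Z]])
       (simp only: C.comp_assoc[OF em(4) h(1) em(4), symmetric] mh_id C.idt_comp[OF em(4)]
          C.comp_idt[OF em(4)])
  then have "is_iso C m"
    unfolding is_iso_def using C.homD[OF em(4)] h(1) mh_id by auto
  then have "m \<odot>\<^bsub>C\<^esub> e' \<in> E"
    using C.comp_E[OF em(1) C.iso_E] C.homD[OF em(3)] C.homD[OF em(4)] by simp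
  then show "e \<in> E" using em(5) by simp
qed

text \<open>Dually, an embedding \<open>m\<close> of the form factors as \<open>m' e\<close> with
  \<open>m'\<close> of the same image, so \<open>m' = m h\<close>; uniqueness makes
  \<open>h e\<close> the identity, and cancelling the epimorphism \<open>e\<close> makes
  \<open>e\<close> invertible.\<close>

lemma embeddings_F: "embeddings C F = M"
proof (intro equalityI subsetI)
  fix m assume m: "m \<in> M"
  then have "m \<in> hom C (Dom C m) (Cod C m)" using C.M_arr by (auto simp: hom_def)
  then show "m \<in> embeddings C F"
    unfolding embeddings_def using M_embedding_of[OF m] C.hom_objs(2) by blast
next
  fix m assume "m \<in> embeddings C F"
  then obtain Y S where Y: "Y \<in> Obj C" and emb: "embedding_of C F Y S m"
    unfolding embeddings_def by blast
  let ?X = "Dom C m"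
  have m: "m \<in> hom C ?X Y" and S: "S = Im C F m"
    using emb by (auto simp: embedding_of_def hom_def)
  have univ: "\<exists>!h. h \<in> hom C Z ?X \<and> f = m \<odot>\<^bsub>C\<^esub> h"
    if "f \<in> hom C Z Y" "Im C F f \<sqsubseteq>\<^bsub>fib F Y\<^esub> S" for f Z
  proof -
    have "\<exists>!h. h \<in> hom C (Dom C f) ?X \<and> f = m \<odot>\<^bsub>C\<^esub> h"
      using emb that(2) C.homD(1,3)[OF that(1)] unfolding embedding_of_def by blast
    then show ?thesis by (simp only: C.homD(2)[OF that(1)])
  qed
  obtain e m' Z where em: "e \<in> E" "m' \<in> M" "e \<in> hom C ?X Z" "m' \<in> hom C Z Y" "m = m' \<odot>\<^bsub>C\<^esub> e"
    using C.factorE[OF m] .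
  have "Im C F m' = S" using Im_factor[OF em(1,3,4)] em(5) S by simp
  then have "Im C F m' \<sqsubseteq>\<^bsub>fib F Y\<^esub> S" by simp
  then obtain h where h: "h \<in> hom C Z ?X" "m' = m \<odot>\<^bsub>C\<^esub> h" using univ[OF em(4)] by blast
  have X: "?X \<in> Obj C" by (rule C.hom_objs(1)[OF m])
  have he: "h \<odot>\<^bsub>C\<^esub> e \<in> hom C ?X ?X" by (rule C.comp_hom[OF em(3) h(1)])
  have "m = m \<odot>\<^bsub>C\<^esub> (h \<odot>\<^bsub>C\<^esub> e)"
    unfolding C.comp_assoc[OF em(3) h(1) m, symmetric] h(2)[symmetric] em(5)[symmetric] ..
  moreover have "Im C F m \<sqsubseteq>\<^bsub>fib F Y\<^esub> S" using S by simp
  ultimately have he_id: "h \<odot>\<^bsub>C\<^esub> e = Idt C ?X"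
    using univ[OF m] C.idt_hom[OF X] C.comp_idt[OF m, symmetric] he by blast
  have Z: "Z \<in> Obj C" by (rule C.hom_objs(2)[OF em(3)])
  have "e \<odot>\<^bsub>C\<^esub> h = Idt C Z"
    by (rule C.E_cancel[OF em(1,3) C.comp_hom[OF h(1) em(3)] C.idt_hom[OF Z]])
       (simp only: C.comp_assoc[OF em(3) h(1) em(3)] he_id C.idt_comp[OF em(3)]
          C.comp_idt[OF em(3)])
  then have "is_iso C e"
    unfolding is_iso_def using C.homD[OF em(3)] h(1) he_id by auto
  then have "m' \<odot>\<^bsub>C\<^esub> e \<in> M"
    using C.comp_M[OF C.iso_M em(2)] C.homD[OF em(3)] C.homD[OF em(4)] by simp
  then show "m \<in> M" using em(5) by simp
qed

end

section \<open>Equivalence of the two existence statements\<close>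

theorem theorem3p22:
  fixes Sg :: "'f signature" and Eqs :: "'f equations"
    and C :: "('o, 'm) category" and E M :: "'m set"
  assumes "universe TYPE('u)"
    and "presentation TYPE('u) Sg Eqs"
    and "nontrivial (variety TYPE('u) Sg Eqs)"
    and "factorized_category TYPE('u) C E M"
  shows
    "(\<exists>F :: ('o, 'm, 'u) form.
        noetherian_form TYPE('u) C F \<and> quotients C F = E \<and> embeddings C F = M)
     \<longleftrightarrow>
     (\<exists>To Ta.
        transfer_functor TYPE('u) C E M
          (variety_cat TYPE('u) Sg Eqs)
          (surjective_homs TYPE('u) Sg Eqs) (injective_homs TYPE('u) Sg Eqs) To Ta)"
proof
  have pres: "variety_presentation TYPE('u) Sg Eqs"
    using assms(1,2) by (rule variety_presentation.intro)
  show "\<exists>To Ta. transfer_functor TYPE('u) C E M (variety_cat TYPE('u) Sg Eqs)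
      (surjective_homs TYPE('u) Sg Eqs) (injective_homs TYPE('u) Sg Eqs) To Ta"
    if "\<exists>F :: ('o, 'm, 'u) form.
      noetherian_form TYPE('u) C F \<and> quotients C F = E \<and> embeddings C F = M"
  proof -
    from that obtain F :: "('o, 'm, 'u) form" where F: "noetherian_form TYPE('u) C F"
      "quotients C F = E" "embeddings C F = M" by blast
    obtain A c d where A: "A \<in> variety TYPE('u) Sg Eqs" "c \<in> carrier A" "d \<in> carrier A" "c \<noteq> d"
      using assms(3) unfolding nontrivial_def by blast
    have power: "power_algebra Sg Eqs A"
      by (intro power_algebra.intro power_algebra_axioms.intro pres A(1))
    have form: "inducing_form TYPE('u) C F E M"
      by (intro inducing_form.intro inducing_form_axioms.intro F assms(4))
    show ?thesis using transfer_functor_of_form[OF power form A(2-4)] by blast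
  qed
  show "\<exists>F :: ('o, 'm, 'u) form.
      noetherian_form TYPE('u) C F \<and> quotients C F = E \<and> embeddings C F = M"
    if "\<exists>To Ta. transfer_functor TYPE('u) C E M (variety_cat TYPE('u) Sg Eqs)
      (surjective_homs TYPE('u) Sg Eqs) (injective_homs TYPE('u) Sg Eqs) To Ta"
  proof -
    from that obtain To Ta where T: "transfer_functor TYPE('u) C E M (variety_cat TYPE('u) Sg Eqs)
      (surjective_homs TYPE('u) Sg Eqs) (injective_homs TYPE('u) Sg Eqs) To Ta" by blast
    interpret variety_transfer Sg Eqs C E M To Ta
      by (intro variety_transfer.intro pres T)
    show ?thesis using F_noetherian_form quotients_F embeddings_F by blast
  qed
qed

end
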